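(* Let $r\ge 3$ be an integer. If $3\le r\le 8$, then $|\mathcal T_r|=p'(r-3,6)$, and if $r\ge 9$, then $|\mathcal T_r|>p'(r-3,6)$.
   Context: All graphs are finite and may have parallel edges but no loops. For $X\subseteq V(G)$, $\partial_G(X)$ is the set of edges of $G$ with exactly one end in $X$. An $r$-regular graph $G$ is an $r$-graph if $|\partial_G(X)|\ge r$ for every $X\subseteq V(G)$ of odd cardinality. A graph is class 1 if its edge-chromatic number equals its maximum degree, and class 2 otherwise. $\mathcal T_r$ is the set of the smallest $r$-graphs of class 2, i.e. those having the minimum number of vertices among all $r$-graphs of class 2; graphs are considered up to isomorphism, so $|\mathcal T_r|$ is the number of isomorphism classes. A partition of an integer $n\ge 0$ into $k$ parts is a multiset of $k$ integers $n_1,\dots,n_k$ with $n_i\ge 0$ and $n=\sum_{i=1}^k n_i$ (so $0$ is allowed as a part, and the order of the parts is irrelevant). $p'(n,k)$ is the number of partitions of $n$ into $k$ parts; $p'(0,k)=1$. *)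

theory Defs
  imports Main "HOL-Library.Multiset"
begin

text \<open>Parallel edges are distinct edges with the same set of ends; requiring two ends excludes loops.\<close>

record ('v, 'e) mgraph =
  verts :: "'v set"
  edges :: "'e set"
  ends :: "'e \<Rightarrow> 'v set"

definition multigraph :: "('v, 'e) mgraph \<Rightarrow> bool" where
  "multigraph G \<longleftrightarrow> finite (verts G) \<and> finite (edges G) \<and>
     (\<forall>e \<in> edges G. ends G e \<subseteq> verts G \<and> card (ends G e) = 2)"

definition degree :: "('v, 'e) mgraph \<Rightarrow> 'v \<Rightarrow> nat" where
  "degree G v = card {e \<in> edges G. v \<in> ends G e}"

text \<open>The graph without vertices has maximum degree 0.\<close>

definition max_degree :: "('v, 'e) mgraph \<Rightarrow> nat" where
  "max_degree G = Max (insert 0 (degree G ` verts G))"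

definition regular :: "nat \<Rightarrow> ('v, 'e) mgraph \<Rightarrow> bool" where
  "regular r G \<longleftrightarrow> (\<forall>v \<in> verts G. degree G v = r)"

definition boundary :: "('v, 'e) mgraph \<Rightarrow> 'v set \<Rightarrow> 'e set" where
  "boundary G X = {e \<in> edges G. card (ends G e \<inter> X) = 1}"

definition r_graph :: "nat \<Rightarrow> ('v, 'e) mgraph \<Rightarrow> bool" where
  "r_graph r G \<longleftrightarrow> multigraph G \<and> regular r G \<and>
     (\<forall>X \<subseteq> verts G. odd (card X) \<longrightarrow> r \<le> card (boundary G X))"

definition proper_edge_colouring :: "('v, 'e) mgraph \<Rightarrow> nat \<Rightarrow> ('e \<Rightarrow> nat) \<Rightarrow> bool" where
  "proper_edge_colouring G k c \<longleftrightarrow> c ` edges G \<subseteq> {..<k} \<and>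
     (\<forall>e \<in> edges G. \<forall>f \<in> edges G. e \<noteq> f \<and> ends G e \<inter> ends G f \<noteq> {} \<longrightarrow> c e \<noteq> c f)"

definition chromatic_index :: "('v, 'e) mgraph \<Rightarrow> nat" where
  "chromatic_index G = (LEAST k. \<exists>c. proper_edge_colouring G k c)"

definition class1 :: "('v, 'e) mgraph \<Rightarrow> bool" where
  "class1 G \<longleftrightarrow> chromatic_index G = max_degree G"

definition class2 :: "('v, 'e) mgraph \<Rightarrow> bool" where
  "class2 G \<longleftrightarrow> \<not> class1 G"

definition isomorphic :: "('v, 'e) mgraph \<Rightarrow> ('w, 'f) mgraph \<Rightarrow> bool" where
  "isomorphic G H \<longleftrightarrow> (\<exists>\<phi> \<psi>. bij_betw \<phi> (verts G) (verts H) \<and> bij_betw \<psi> (edges G) (edges H) \<and>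
     (\<forall>e \<in> edges G. ends H (\<psi> e) = \<phi> ` ends G e))"

text \<open>Every finite graph is isomorphic to one whose vertices and edges are natural numbers, so
  these suffice for counting graphs up to isomorphism.\<close>

definition smallest_class2 :: "nat \<Rightarrow> (nat, nat) mgraph set" where
  "smallest_class2 r = {G. r_graph r G \<and> class2 G \<and>
     (\<forall>H :: (nat, nat) mgraph. r_graph r H \<and> class2 H \<longrightarrow> card (verts G) \<le> card (verts H))}"

definition iso_rel :: "('v, 'e) mgraph set \<Rightarrow> ('v, 'e) mgraph rel" where
  "iso_rel A = {(G, H). G \<in> A \<and> H \<in> A \<and> isomorphic G H}"

definition num_smallest_class2 :: "nat \<Rightarrow> nat" where
  "num_smallest_class2 r = card (smallest_class2 r // iso_rel (smallest_class2 r))"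

text \<open>Partitions of \<open>n\<close> into exactly \<open>k\<close> parts, where 0 is allowed as a part.\<close>

definition num_partitions :: "nat \<Rightarrow> nat \<Rightarrow> nat" where
  "num_partitions n k = card {N :: nat multiset. size N = k \<and> sum_mset N = n}"

lemma isomorphic_refl: "isomorphic G G"
  unfolding isomorphic_def by (intro exI[of _ id]) auto

lemma isomorphic_sym:
  assumes G: "multigraph G" and iso: "isomorphic G H"
  shows "isomorphic H G"
proof -
  obtain \<phi> \<psi> where \<phi>: "bij_betw \<phi> (verts G) (verts H)" and \<psi>: "bij_betw \<psi> (edges G) (edges H)"
    and ends: "\<And>e. e \<in> edges G \<Longrightarrow> ends H (\<psi> e) = \<phi> ` ends G e"
    using iso unfolding isomorphic_def by blast
  define \<phi>' where "\<phi>' = inv_into (verts G) \<phi>"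
  define \<psi>' where "\<psi>' = inv_into (edges G) \<psi>"
  have "ends G (\<psi>' f) = \<phi>' ` ends H f" if f: "f \<in> edges H" for f
  proof -
    have e: "\<psi>' f \<in> edges G" and "\<psi> (\<psi>' f) = f"
      using f \<psi> unfolding \<psi>'_def bij_betw_def by (auto simp: inv_into_into f_inv_into_f)
    then have "ends H f = \<phi> ` ends G (\<psi>' f)"
      using ends by metis
    moreover have "ends G (\<psi>' f) \<subseteq> verts G"
      using G e unfolding multigraph_def by blast
    ultimately show ?thesis
      using \<phi> unfolding \<phi>'_def bij_betw_def by (simp add: inv_into_image_cancel)
  qed
  moreover have "bij_betw \<phi>' (verts H) (verts G)" "bij_betw \<psi>' (edges H) (edges G)"
    using \<phi> \<psi> unfolding \<phi>'_def \<psi>'_def by (auto intro: bij_betw_inv_into)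
  ultimately show ?thesis
    unfolding isomorphic_def by blast
qed

lemma isomorphic_trans:
  assumes "isomorphic G H" "isomorphic H K"
  shows "isomorphic G K"
proof -
  obtain \<phi> \<psi> where 1: "bij_betw \<phi> (verts G) (verts H)" "bij_betw \<psi> (edges G) (edges H)"
    "\<And>e. e \<in> edges G \<Longrightarrow> ends H (\<psi> e) = \<phi> ` ends G e"
    using assms(1) unfolding isomorphic_def by blast
  obtain \<phi>' \<psi>' where 2: "bij_betw \<phi>' (verts H) (verts K)" "bij_betw \<psi>' (edges H) (edges K)"
    "\<And>e. e \<in> edges H \<Longrightarrow> ends K (\<psi>' e) = \<phi>' ` ends H e"
    using assms(2) unfolding isomorphic_def by blast
  have "bij_betw (\<phi>' \<circ> \<phi>) (verts G) (verts K)" "bij_betw (\<psi>' \<circ> \<psi>) (edges G) (edges K)"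
    using 1(1,2) 2(1,2) by (auto intro: bij_betw_trans)
  moreover have "ends K ((\<psi>' \<circ> \<psi>) e) = (\<phi>' \<circ> \<phi>) ` ends G e" if "e \<in> edges G" for e
    using bij_betwE[OF 1(2)] by (simp add: that 1(3) 2(3) image_comp)
  ultimately show ?thesis
    unfolding isomorphic_def by blast
qed

lemma equiv_iso_rel: "equiv (smallest_class2 r) (iso_rel (smallest_class2 r))"
proof (rule equivI)
  have mg: "multigraph G" if "G \<in> smallest_class2 r" for G
    using that by (simp add: smallest_class2_def r_graph_def)
  show "iso_rel (smallest_class2 r) \<subseteq> smallest_class2 r \<times> smallest_class2 r"
    by (auto simp: iso_rel_def)
  show "refl_on (smallest_class2 r) (iso_rel (smallest_class2 r))"
    by (auto simp: refl_on_def iso_rel_def isomorphic_refl)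
  show "sym (iso_rel (smallest_class2 r))"
    by (rule symI) (auto simp: iso_rel_def intro: isomorphic_sym mg)
  show "trans (iso_rel (smallest_class2 r))"
    by (rule transI) (auto simp: iso_rel_def intro: isomorphic_trans)
qed

end

(*
A smallest r-graph of class 2 has 10 vertices and is the Petersen graph P plus a multiset of r - 3 of
its six perfect matchings; the counting is then about the action of Aut(P) on these six matchings.

Write "tight" for a cut of an odd set (with at least 3 vertices on either side) of size r. If G has a
tight cut, contracting either side gives smaller r-graphs whose colourings can be glued. Otherwise every
such cut has size at least r + 2 by parity, so removing a perfect matching M (which exists by the
Tutte-Berge formula) leaves an (r-1)-graph unless M meets a cut with 5 + 5 vertices and r + 2 edges in
5 edges. This cannot happen below 10 vertices, so these r-graphs are of class 1. If on 10 vertices every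
M is obstructed in this way, then 2G is a sum of 2r perfect matchings that obstruct one another, which
forces r = 3 and G = P. Otherwise induction shows that G is P plus perfect matchings of P, because P
plus any other perfect matching of the complete graph is of class 1.

Aut(P) is PGL(2,5) acting sharply 3-transitively on the six matchings. If r - 3 <= 5, all but three of
the multiplicities agree, so 3-transitivity makes graphs with equal multisets of multiplicities
isomorphic; if r - 3 >= 6, the multiset {0,0,1,1,2,r-7} has two inequivalent arrangements.
*)
theory Submission
  imports Defs
begin

section \<open>Weighted r-graphs\<close>

text \<open>The threshold of ten vertices: a perfect matching meets an odd cut in an odd number of
  edges, at most the number of vertices on the smaller side. A cut of size r + 2 drops below r - 1
  only by losing five edges, and on ten vertices this needs two sides of five vertices. Such a
  matching cannot be removed from G, but 2G has slack: its cuts with three or more vertices on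
  either side have at least 2r + 4 edges, so one matching can go, and its own cut is left with
  exactly 2r - 1 edges. This artificial tight cut is what leads back to fewer vertices.

  A matching outside P is caught by averaging over six cuts, each separating the two 5-cycles that a
  perfect matching of P leaves: five edges cannot cross each of these cuts just once. For a cut that
  is not crossed just once, the corresponding matching of P can be exchanged for the new one.

  The bound 5 on r - 3 comes from 0 + 0 + 1 + 1 + 2 + 2 = 6, the least sum of six multiplicities no
  three of which are equal. Multiplicities can be read off the graph because the 15 edges of P
  correspond to the 15 pairs of matchings.\<close>

text \<open>A multigraph is represented by its multiplicity function \<open>w\<close> on a finite vertex set, and a
  perfect matching by the involution that exchanges the two ends of each of its edges.\<close>

definition edge_cut :: "'a set \<Rightarrow> ('a \<Rightarrow> 'a \<Rightarrow> nat) \<Rightarrow> 'a set \<Rightarrow> nat" where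
  "edge_cut V w X = (\<Sum>u\<in>X. \<Sum>v\<in>V - X. w u v)"

definition wgraph :: "'a set \<Rightarrow> ('a \<Rightarrow> 'a \<Rightarrow> nat) \<Rightarrow> bool" where
  "wgraph V w \<longleftrightarrow> finite V \<and> (\<forall>u\<in>V. w u u = 0) \<and> (\<forall>u\<in>V. \<forall>v\<in>V. w u v = w v u)"

definition wrgraph :: "'a set \<Rightarrow> nat \<Rightarrow> ('a \<Rightarrow> 'a \<Rightarrow> nat) \<Rightarrow> bool" where
  "wrgraph V r w \<longleftrightarrow> wgraph V w \<and> (\<forall>u\<in>V. (\<Sum>v\<in>V. w u v) = r) \<and>
     (\<forall>X\<subseteq>V. odd (card X) \<longrightarrow> r \<le> edge_cut V w X)"

definition perfect_matching :: "'a set \<Rightarrow> ('a \<Rightarrow> 'a) \<Rightarrow> bool" where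
  "perfect_matching V f \<longleftrightarrow> (\<forall>v\<in>V. f v \<in> V \<and> f v \<noteq> v \<and> f (f v) = v)"

definition matching_weight :: "('a \<Rightarrow> 'a) \<Rightarrow> 'a \<Rightarrow> 'a \<Rightarrow> nat" where
  "matching_weight f u v = of_bool (f u = v)"

text \<open>The type of the indices is left open because the natural colours vary: in the gluing of
  two contractions they are the edges of the cut. Equal matchings may carry different indices, which
  accounts for parallel edges.\<close>

definition colouring :: "'a set \<Rightarrow> ('a \<Rightarrow> 'a \<Rightarrow> nat) \<Rightarrow> 'i set \<Rightarrow> ('i \<Rightarrow> 'a \<Rightarrow> 'a) \<Rightarrow> bool" where
  "colouring V w I F \<longleftrightarrow> finite I \<and> (\<forall>i\<in>I. perfect_matching V (F i)) \<and>
     (\<forall>u\<in>V. \<forall>v\<in>V. w u v = card {i\<in>I. F i u = v})"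

text \<open>An existential quantifier cannot range over types, so the indices are natural numbers
  here; \<open>colouring_decomposable\<close> renumbers every other colouring.\<close>

definition decomposable :: "'a set \<Rightarrow> ('a \<Rightarrow> 'a \<Rightarrow> nat) \<Rightarrow> bool" where
  "decomposable V w \<longleftrightarrow> (\<exists>(I :: nat set) F. colouring V w I F)"

text \<open>The bridge from counting to bijections: it assigns colours to cut edges in the gluing,
  turns equal multiplicities into a bijection of edges, and equal multisets into a permutation of
  positions.\<close>

lemma bij_betw_of_equal_fibres:
  assumes "finite A" "finite B"
    and eq: "\<And>c. card {a\<in>A. f a = c} = card {b\<in>B. g b = c}"
  obtains h where "bij_betw h A B" "\<And>a. a \<in> A \<Longrightarrow> g (h a) = f a"
proof -
  have "\<exists>h. bij_betw h {a\<in>A. f a = c} {b\<in>B. g b = c}" for c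
    using finite_same_card_bij[OF _ _ eq, of c] assms(1,2) by simp
  then obtain H where H: "\<And>c. bij_betw (H c) {a\<in>A. f a = c} {b\<in>B. g b = c}"
    by metis
  define h where "h a = H (f a) a" for a
  have h: "h a \<in> B" "g (h a) = f a" if "a \<in> A" for a
    using bij_betwE[OF H[of "f a"]] that by (auto simp: h_def)
  have "inj_on h A"
  proof (rule inj_onI)
    fix a b assume ab: "a \<in> A" "b \<in> A" "h a = h b"
    then have "f a = f b" using h by metis
    then show "a = b"
      using ab bij_betw_imp_inj_on[OF H[of "f a"]] by (auto simp: h_def inj_on_def)
  qed
  moreover have "h ` A = B"
  proof
    show "h ` A \<subseteq> B" using h by auto
    show "B \<subseteq> h ` A"
    proof
      fix b assume "b \<in> B"
      then have "b \<in> H (g b) ` {a\<in>A. f a = g b}"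
        using bij_betw_imp_surj_on[OF H[of "g b"]] by auto
      then show "b \<in> h ` A" unfolding h_def by force
    qed
  qed
  ultimately show thesis using that h unfolding bij_betw_def by blast
qed

lemma card_filter_eq_sum: "finite I \<Longrightarrow> card {i\<in>I. P i} = (\<Sum>i\<in>I. of_bool (P i))"
  by (simp add: of_bool_def sum.If_cases Int_def)

lemma bij_betw_filter:
  "bij_betw g A B \<Longrightarrow> bij_betw g {a\<in>A. P (g a)} {b\<in>B. P b}"
  by (rule bij_betw_subset[of g A B]) (auto simp: bij_betw_def)

lemma card_eq_card_plus_Diff:
  assumes "finite V" "X \<subseteq> V"
  shows "card V = card X + card (V - X)"
  using assms by (metis card_Diff_subset card_mono finite_subset le_add_diff_inverse)

section \<open>Parity of odd cuts\<close>

lemma even_sum_symmetric: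
  fixes w :: "'a \<Rightarrow> 'a \<Rightarrow> nat"
  assumes "finite X" "\<forall>u\<in>X. w u u = 0" "\<forall>u\<in>X. \<forall>v\<in>X. w u v = w v u"
  shows "even (\<Sum>u\<in>X. \<Sum>v\<in>X. w u v)"
  using assms
proof (induction X rule: finite_induct)
  case (insert x X)
  have "(\<Sum>u\<in>X. w u x) = (\<Sum>v\<in>X. w x v)"
    using insert.prems(2) by (intro sum.cong refl) blast
  then have "(\<Sum>u\<in>insert x X. \<Sum>v\<in>insert x X. w u v)
      = w x x + (\<Sum>v\<in>X. w x v) + ((\<Sum>v\<in>X. w x v) + (\<Sum>u\<in>X. \<Sum>v\<in>X. w u v))"
    by (simp only: sum.insert[OF insert.hyps] sum.distrib)
  moreover have "even (\<Sum>u\<in>X. \<Sum>v\<in>X. w u v)"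
    using insert.prems by (intro insert.IH) blast+
  ultimately show ?case using insert.prems(1) by simp
qed simp

lemma wgraphD:
  assumes "wgraph V w"
  shows "finite V" "u \<in> V \<Longrightarrow> w u u = 0" "u \<in> V \<Longrightarrow> v \<in> V \<Longrightarrow> w u v = w v u"
  using assms unfolding wgraph_def by auto

lemma wrgraphD:
  assumes "wrgraph V r w"
  shows "wgraph V w" "u \<in> V \<Longrightarrow> (\<Sum>v\<in>V. w u v) = r"
    "X \<subseteq> V \<Longrightarrow> odd (card X) \<Longrightarrow> r \<le> edge_cut V w X"
  using assms unfolding wrgraph_def by auto

lemma cut_complement:
  assumes "wgraph V w" "X \<subseteq> V"
  shows "edge_cut V w (V - X) = edge_cut V w X"
proof -
  have "V - (V - X) = X" using assms(2) by auto
  then have "edge_cut V w (V - X) = (\<Sum>u\<in>V - X. \<Sum>v\<in>X. w u v)" by (simp add: edge_cut_def)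
  also have "\<dots> = (\<Sum>v\<in>X. \<Sum>u\<in>V - X. w u v)" by (rule sum.swap)
  also have "\<dots> = edge_cut V w X"
    unfolding edge_cut_def using wgraphD(3)[OF assms(1)] assms(2) by (intro sum.cong refl) blast
  finally show ?thesis .
qed

lemma sum_in_plus_cut:
  assumes "finite V" "X \<subseteq> V" "\<And>u. u \<in> V \<Longrightarrow> (\<Sum>v\<in>V. w u v) = r"
  shows "(\<Sum>u\<in>X. \<Sum>v\<in>X. w u v) + edge_cut V w X = r * card X"
proof -
  have "(\<Sum>u\<in>X. \<Sum>v\<in>X. w u v) + edge_cut V w X = (\<Sum>u\<in>X. \<Sum>v\<in>V. w u v)"
    unfolding edge_cut_def sum.distrib[symmetric] using assms
    by (intro sum.cong refl) (metis add.commute sum.subset_diff)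
  also have "\<dots> = (\<Sum>u\<in>X. r)" using assms by (intro sum.cong) auto
  finally show ?thesis by (simp add: mult.commute)
qed

text \<open>The degrees in \<open>X\<close> add up to r times an odd number, and edges inside
  \<open>X\<close> contribute twice.\<close>

lemma cut_parity:
  assumes "wgraph V w" "X \<subseteq> V" "\<And>u. u \<in> V \<Longrightarrow> (\<Sum>v\<in>V. w u v) = r" "odd (card X)"
  shows "even (edge_cut V w X) \<longleftrightarrow> even r"
proof -
  have "even (\<Sum>u\<in>X. \<Sum>v\<in>X. w u v)"
    using assms(2) wgraphD(1,2)[OF assms(1)] wgraphD(3)[OF assms(1)]
    by (intro even_sum_symmetric) (blast intro: finite_subset)+
  then show ?thesis
    using sum_in_plus_cut[of V X w r] assms wgraphD(1)[OF assms(1)] by (metis even_add even_mult_iff)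
qed

lemma cut_singleton:
  assumes "wgraph V w" "u \<in> V"
  shows "edge_cut V w {u} = (\<Sum>v\<in>V. w u v)"
  using assms wgraphD[OF assms(1)] by (simp add: edge_cut_def sum_diff1_nat)

text \<open>The cut of the whole vertex set is empty.\<close>

lemma even_card_if_wrgraph:
  assumes "wrgraph V r w" "0 < r"
  shows "even (card V)"
  using wrgraphD(3)[OF assms(1), of V] assms(2) by (auto simp: edge_cut_def)

lemma odd_card_complement:
  assumes "wrgraph V r w" "0 < r" "X \<subseteq> V" "odd (card X)"
  shows "odd (card (V - X))"
proof -
  have f: "finite V" using wgraphD(1)[OF wrgraphD(1)[OF assms(1)]] .
  then have "card V = card X + card (V - X)"
    using card_eq_card_plus_Diff[OF f assms(3)] by blast
  then show ?thesis using even_card_if_wrgraph[OF assms(1,2)] assms(4) by auto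
qed

lemma matching_wgraph:
  assumes "perfect_matching V f" "finite V"
  shows "wgraph V (matching_weight f)"
  using assms unfolding perfect_matching_def wgraph_def matching_weight_def by auto

lemma sum_matching_weight:
  assumes "perfect_matching V f" "finite V" "u \<in> V"
  shows "(\<Sum>v\<in>V. matching_weight f u v) = 1"
  using assms unfolding perfect_matching_def matching_weight_def by (simp add: of_bool_def)

lemma cut_matching_eq_card:
  assumes "perfect_matching V f" "finite V" "X \<subseteq> V"
  shows "edge_cut V (matching_weight f) X = card {u\<in>X. f u \<notin> X}"
proof -
  have fX: "finite X" using assms finite_subset by auto
  have "(\<Sum>v\<in>V - X. matching_weight f u v) = of_bool (f u \<notin> X)" if "u \<in> X" for u
    using assms that unfolding perfect_matching_def matching_weight_def by (auto simp: of_bool_def)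
  then show ?thesis unfolding edge_cut_def card_filter_eq_sum[OF fX] by simp
qed

lemma cut_matching_le:
  assumes "perfect_matching V f" "finite V" "X \<subseteq> V"
  shows "edge_cut V (matching_weight f) X \<le> card X"
  using assms finite_subset[OF assms(3,2)]
  by (auto simp: cut_matching_eq_card intro: card_mono)

lemma cut_matching_odd:
  assumes "perfect_matching V f" "finite V" "X \<subseteq> V" "odd (card X)"
  shows "odd (edge_cut V (matching_weight f) X)"
  using cut_parity[OF matching_wgraph[OF assms(1,2)] assms(3) sum_matching_weight[OF assms(1,2)] assms(4)]
  by simp

lemma cut_add: "edge_cut V (\<lambda>u v. w u v + w' u v) X = edge_cut V w X + edge_cut V w' X"
  by (simp add: edge_cut_def sum.distrib)

lemma cut_cong:
  "X \<subseteq> V \<Longrightarrow> (\<And>u v. u \<in> V \<Longrightarrow> v \<in> V \<Longrightarrow> w u v = w' u v) \<Longrightarrow> edge_cut V w X = edge_cut V w' X"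
  unfolding edge_cut_def by (intro sum.cong) auto

lemma cut_sum: "finite I \<Longrightarrow> edge_cut V (\<lambda>u v. \<Sum>i\<in>I. w i u v) X = (\<Sum>i\<in>I. edge_cut V (w i) X)"
  by (induction I rule: finite_induct) (simp_all add: cut_add, simp add: edge_cut_def)

lemma cut_diff:
  assumes "X \<subseteq> V" "\<And>u v. u \<in> V \<Longrightarrow> v \<in> V \<Longrightarrow> w' u v \<le> w u v"
  shows "edge_cut V (\<lambda>u v. w u v - w' u v) X + edge_cut V w' X = edge_cut V w X"
  unfolding cut_add[symmetric] using assms by (intro cut_cong) auto

lemma matching_weight_le:
  assumes "perfect_matching V f" "\<And>u. u \<in> V \<Longrightarrow> 0 < w u (f u)" "u \<in> V"
  shows "matching_weight f u v \<le> w u v"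
  using assms(2)[OF assms(3)] by (auto simp: matching_weight_def)

section \<open>Edge colourings as sums of perfect matchings\<close>

lemma colouring_weight:
  assumes "colouring V w I F" "u \<in> V" "v \<in> V"
  shows "w u v = (\<Sum>i\<in>I. matching_weight (F i) u v)"
  using assms by (auto simp: colouring_def matching_weight_def card_filter_eq_sum)

lemma colouring_decomposable:
  assumes "colouring V w I F"
  shows "decomposable V w"
proof -
  obtain g :: "nat \<Rightarrow> _" where g: "bij_betw g {0..<card I} I"
    using assms ex_bij_betw_nat_finite unfolding colouring_def by blast
  have "colouring V w {0..<card I} (\<lambda>i. F (g i))"
    unfolding colouring_def
  proof (intro conjI ballI)
    fix u v assume uv: "u \<in> V" "v \<in> V"
    have "bij_betw g {i\<in>{0..<card I}. F (g i) u = v} {i\<in>I. F i u = v}"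
      by (rule bij_betw_filter[OF g])
    then show "w u v = card {i\<in>{0..<card I}. F (g i) u = v}"
      using assms uv by (simp add: colouring_def bij_betw_same_card)
  qed (use assms bij_betwE[OF g] in \<open>auto simp: colouring_def\<close>)
  then show ?thesis unfolding decomposable_def by blast
qed

lemma decomposable_cong:
  "(\<And>u v. u \<in> V \<Longrightarrow> v \<in> V \<Longrightarrow> w u v = w' u v) \<Longrightarrow> decomposable V w \<longleftrightarrow> decomposable V w'"
  unfolding decomposable_def colouring_def by simp

lemma decomposable_add_matching:
  assumes "decomposable V w" "perfect_matching V f"
  shows "decomposable V (\<lambda>u v. w u v + matching_weight f u v)"
proof -
  obtain I :: "nat set" and F where c: "colouring V w I F"
    using assms(1) unfolding decomposable_def by blast
  define G where "G j = (case j of None \<Rightarrow> f | Some i \<Rightarrow> F i)" for j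
  have fin: "finite I" using c by (simp add: colouring_def)
  have "{j\<in>insert None (Some ` I). G j u = v} =
      (if f u = v then {None} else {}) \<union> Some ` {i\<in>I. F i u = v}" for u v
    by (auto simp: G_def)
  then have "card {j\<in>insert None (Some ` I). G j u = v} = card {i\<in>I. F i u = v} + of_bool (f u = v)" for u v
    using fin by (auto simp: card_image card_insert_if)
  then have "colouring V (\<lambda>u v. w u v + matching_weight f u v) (insert None (Some ` I)) G"
    using c assms(2) unfolding colouring_def matching_weight_def
    by (auto simp: G_def)
  then show ?thesis by (rule colouring_decomposable)
qed

lemma decomposable_diff_matching:
  assumes "decomposable V (\<lambda>u v. w u v - matching_weight f u v)" "perfect_matching V f"
    "\<And>u. u \<in> V \<Longrightarrow> 0 < w u (f u)"
  shows "decomposable V w"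
proof -
  have "decomposable V (\<lambda>u v. w u v - matching_weight f u v + matching_weight f u v)"
    using decomposable_add_matching[OF assms(1,2)] .
  then show ?thesis
    by (rule decomposable_cong[THEN iffD1, rotated]) (use matching_weight_le[OF assms(2), of w] assms(3) in auto)
qed

lemma decomposable_zero: "(\<And>u v. u \<in> V \<Longrightarrow> v \<in> V \<Longrightarrow> w u v = 0) \<Longrightarrow> decomposable V w"
  unfolding decomposable_def by (rule exI[of _ "{}"], rule exI) (simp add: colouring_def)

lemma colouring_matching_support:
  assumes "colouring V w I F" "i \<in> I" "u \<in> V"
  shows "0 < w u (F i u)"
proof -
  have "F i u \<in> V" using assms by (auto simp: colouring_def perfect_matching_def)
  moreover have "card {j\<in>I. F j u = F i u} > 0"
    using assms by (auto simp: colouring_def card_gt_0_iff)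
  ultimately show ?thesis using assms by (simp add: colouring_def)
qed

lemma card_colouring:
  assumes "colouring V w I F" "finite V" "u \<in> V" "(\<Sum>v\<in>V. w u v) = r"
  shows "card I = r"
proof -
  have "r = (\<Sum>v\<in>V. \<Sum>i\<in>I. matching_weight (F i) u v)"
    unfolding assms(4)[symmetric] using assms colouring_weight[OF assms(1)] by (intro sum.cong) auto
  also have "\<dots> = (\<Sum>i\<in>I. \<Sum>v\<in>V. matching_weight (F i) u v)" by (rule sum.swap)
  also have "\<dots> = card I"
    using assms sum_matching_weight[OF _ assms(2,3)] by (simp add: colouring_def)
  finally show ?thesis by simp
qed

section \<open>Tight cuts\<close>

text \<open>Contraction of \<open>V - X\<close> to the vertex \<open>p\<close>. Taking
  \<open>p\<close> from \<open>V - X\<close> keeps the contracted graph in the type of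
  \<open>V\<close>, so that one induction covers all contractions.\<close>

definition shrink :: "'a set \<Rightarrow> ('a \<Rightarrow> 'a \<Rightarrow> nat) \<Rightarrow> 'a set \<Rightarrow> 'a \<Rightarrow> 'a \<Rightarrow> 'a \<Rightarrow> nat" where
  "shrink V w X p u v = (if u = p then if v = p then 0 else \<Sum>t\<in>V - X. w v t
     else if v = p then \<Sum>t\<in>V - X. w u t else w u v)"

text \<open>Every cut of the contraction is a cut of the original graph: directly if the set avoids
  \<open>p\<close>, and otherwise for its complement, which is again odd because
  \<open>insert p X\<close> has even order. Tightness makes the degree of \<open>p\<close> equal to
  r.\<close>

lemma shrink_wrgraph:
  assumes "wrgraph V r w" "X \<subseteq> V" "odd (card X)" "edge_cut V w X = r" "p \<in> V - X"
  shows "wrgraph (insert p X) r (shrink V w X p)"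
proof -
  let ?V = "insert p X" and ?w = "shrink V w X p"
  note wg = wrgraphD(1)[OF assms(1)]
  have fV: "finite V" by (rule wgraphD(1)[OF wg])
  have fX: "finite X" using assms(2) fV finite_subset by blast
  have pX: "p \<notin> X" using assms(5) by simp
  have wg': "wgraph ?V ?w"
    unfolding wgraph_def
  proof (intro conjI ballI)
    fix u v assume "u \<in> ?V" "v \<in> ?V"
    then show "?w u v = ?w v u"
      using wgraphD(3)[OF wg, of u v] assms(2,5) unfolding shrink_def by (cases "u = p"; cases "v = p") auto
  next
    fix u assume "u \<in> ?V"
    then show "?w u u = 0"
      using wgraphD(2)[OF wg, of u] assms(2) unfolding shrink_def by auto
  qed (use fX in simp)
  \<comment> \<open>The edges from \<open>u\<close> to \<open>V - X\<close> are merged into the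
    single entry at \<open>p\<close>, so row sums outside a subset of \<open>X\<close> do not
    change.\<close>
  have row: "(\<Sum>v\<in>?V - Y. ?w u v) = (\<Sum>v\<in>V - Y. w u v)" if "Y \<subseteq> X" "u \<in> X" for u Y
  proof -
    have "?V - Y = insert p (X - Y)" using that pX by auto
    then have "(\<Sum>v\<in>?V - Y. ?w u v) = ?w u p + (\<Sum>v\<in>X - Y. ?w u v)"
      using fX pX by simp
    also have "(\<Sum>v\<in>X - Y. ?w u v) = (\<Sum>v\<in>X - Y. w u v)"
      using that pX by (intro sum.cong) (auto simp: shrink_def)
    also have "?w u p = (\<Sum>t\<in>V - X. w u t)"
      using that pX by (auto simp: shrink_def)
    also have "(\<Sum>t\<in>V - X. w u t) + (\<Sum>v\<in>X - Y. w u v) = (\<Sum>v\<in>(V - X) \<union> (X - Y). w u v)"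
      using fV fX by (intro sum.union_disjoint[symmetric]) auto
    also have "(V - X) \<union> (X - Y) = V - Y" using that assms(2) by auto
    finally show ?thesis .
  qed
  have cutX: "edge_cut ?V ?w Y = edge_cut V w Y" if "Y \<subseteq> X" for Y
    unfolding edge_cut_def using that by (intro sum.cong refl row) auto
  have deg: "(\<Sum>v\<in>?V. ?w u v) = r" if "u \<in> ?V" for u
  proof (cases "u = p")
    case True
    have "(\<Sum>v\<in>?V. ?w p v) = edge_cut V w X"
      using fX pX unfolding edge_cut_def by (simp add: shrink_def) (rule sum.cong, auto)
    then show ?thesis using True assms(4) by simp
  next
    case False
    then show ?thesis
      using row[of "{}" u] that wrgraphD(2)[OF assms(1), of u] assms(2) by auto
  qed
  have "r \<le> edge_cut ?V ?w Y" if Y: "Y \<subseteq> ?V" "odd (card Y)" for Y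
  proof (cases "p \<in> Y")
    case False
    then have "Y \<subseteq> X" using Y(1) by auto
    then show ?thesis
      using cutX[of Y] Y wrgraphD(3)[OF assms(1), of Y] assms(2) by auto
  next
    case True
    have "card ?V = card Y + card (?V - Y)"
      using Y(1) fX by (metis add.commute card_Diff_subset card_mono finite.insertI finite_subset
          le_add_diff_inverse2)
    moreover have "card ?V = Suc (card X)" using fX pX by simp
    ultimately have "odd (card (?V - Y))"
      using assms(3) Y(2) by (metis even_Suc even_add)
    moreover have "?V - Y \<subseteq> X" using True by auto
    ultimately have "r \<le> edge_cut ?V ?w (?V - Y)"
      using cutX[of "?V - Y"] wrgraphD(3)[OF assms(1), of "?V - Y"] assms(2) by auto
    then show ?thesis using cut_complement[OF wg' Y(1)] by simp
  qed
  then show ?thesis using wg' deg unfolding wrgraph_def by blast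
qed

text \<open>Each colour of either contraction has exactly one edge at the contracted vertex, and
  this edge comes from the cut. So the cut edges can serve as colours: each of them selects one
  colour on either side, and the two matchings are joined along it.\<close>

lemma decomposable_glue:
  assumes wg: "wgraph V w" and X: "X \<subseteq> V" and p: "p \<in> V - X" and q: "q \<in> X"
    and d1: "decomposable (insert p X) (shrink V w X p)"
    and d2: "decomposable (insert q (V - X)) (shrink V w (V - X) q)"
  shows "decomposable V w"
proof -
  have fV: "finite V" by (rule wgraphD(1)[OF wg])
  have fX: "finite X" using X fV finite_subset by blast
  have sym: "w u v = w v u" if "u \<in> V" "v \<in> V" for u v using wgraphD(3)[OF wg that] .
  have VVX: "V - (V - X) = X" using X by auto
  obtain I :: "nat set" and F where c1: "colouring (insert p X) (shrink V w X p) I F"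
    using d1 unfolding decomposable_def by blast
  obtain J :: "nat set" and H where c2: "colouring (insert q (V - X)) (shrink V w (V - X) q) J H"
    using d2 unfolding decomposable_def by blast
  have fI: "finite I" "finite J" using c1 c2 by (auto simp: colouring_def)
  have F: "F i x \<in> insert p X" "F i x \<noteq> x" "F i (F i x) = x" if "i \<in> I" "x \<in> insert p X" for i x
    using c1 that unfolding colouring_def perfect_matching_def by blast+
  have H: "H j x \<in> insert q (V - X)" "H j x \<noteq> x" "H j (H j x) = x"
    if "j \<in> J" "x \<in> insert q (V - X)" for j x
    using c2 that unfolding colouring_def perfect_matching_def by blast+
  have cF: "card {i\<in>I. F i u = v} = shrink V w X p u v" if "u \<in> insert p X" "v \<in> insert p X" for u v
    using c1 that unfolding colouring_def by metis
  have cH: "card {j\<in>J. H j u = v} = shrink V w (V - X) q u v"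
    if "u \<in> insert q (V - X)" "v \<in> insert q (V - X)" for u v
    using c2 that unfolding colouring_def by metis
  \<comment> \<open>The edges of the cut; the third component distinguishes parallel ones.\<close>
  define K where "K = (SIGMA u:X. SIGMA v:V - X. {..<w u v})"
  have fK: "finite K" unfolding K_def using fX fV by auto
  have fib1: "card {e\<in>K. fst e = u} = card {i\<in>I. F i p = u}" for u
  proof (cases "u \<in> X")
    case True
    have "{e\<in>K. fst e = u} = Pair u ` (SIGMA v:V - X. {..<w u v})"
      using True by (auto simp: K_def)
    then have "card {e\<in>K. fst e = u} = (\<Sum>v\<in>V - X. w u v)"
      using fV by (simp add: card_image inj_on_def)
    moreover have "u \<noteq> p" using True p by auto
    ultimately show ?thesis using cF[of p u] True by (simp add: shrink_def)
  next
    case False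
    then have "{e\<in>K. fst e = u} = {}" "{i\<in>I. F i p = u} = {}"
      using F[of _ p] by (auto simp: K_def)
    then show ?thesis by (simp only: card.empty)
  qed
  have fib2: "card {e\<in>K. fst (snd e) = v} = card {j\<in>J. H j q = v}" for v
  proof (cases "v \<in> V - X")
    case True
    have "{e\<in>K. fst (snd e) = v} = (\<lambda>(u, k). (u, v, k)) ` (SIGMA u:X. {..<w u v})"
      using True by (auto simp: K_def image_iff)
    then have "card {e\<in>K. fst (snd e) = v} = (\<Sum>u\<in>X. w u v)"
      using fX by (simp add: card_image inj_on_def)
    also have "\<dots> = (\<Sum>u\<in>X. w v u)"
      using sym X True by (intro sum.cong refl) blast
    finally have "card {e\<in>K. fst (snd e) = v} = (\<Sum>u\<in>X. w v u)" .
    moreover have "v \<noteq> q" using True q by auto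
    ultimately show ?thesis using cH[of q v] True VVX by (simp add: shrink_def)
  next
    case False
    then have "{e\<in>K. fst (snd e) = v} = {}" "{j\<in>J. H j q = v} = {}"
      using H[of _ q] by (auto simp: K_def)
    then show ?thesis by (simp only: card.empty)
  qed
  \<comment> \<open>\<open>a e\<close>, and likewise \<open>b e\<close> below, is the colour
    assigned to the cut edge \<open>e\<close>. Only the end of \<open>e\<close> on the respective
    side has to match, since the contraction sees nothing else of \<open>e\<close>.\<close>
  obtain a where a: "bij_betw a K I" "\<And>e. e \<in> K \<Longrightarrow> F (a e) p = fst e"
    using bij_betw_of_equal_fibres[OF fK fI(1) fib1] by blast
  obtain b where b: "bij_betw b K J" "\<And>e. e \<in> K \<Longrightarrow> H (b e) q = fst (snd e)"
    using bij_betw_of_equal_fibres[OF fK fI(2) fib2] by blast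
  have aI: "a e \<in> I" and bJ: "b e \<in> J" and eX: "fst e \<in> X" and eV: "fst (snd e) \<in> V - X" if "e \<in> K" for e
    using bij_betwE[OF a(1)] bij_betwE[OF b(1)] that by (auto simp: K_def)
  \<comment> \<open>On each side the chosen colour is followed, except that \<open>e\<close> itself
    is used where this colour leads to the contracted vertex.\<close>
  define L where "L e x = (if x \<in> X then if F (a e) x = p then fst (snd e) else F (a e) x
      else if H (b e) x = q then fst e else H (b e) x)" for e x
  have LX: "L e x = (if x = fst e then fst (snd e) else F (a e) x)"
    and LX': "x \<noteq> fst e \<Longrightarrow> L e x \<in> X"
    if "e \<in> K" "x \<in> X" for e x
  proof -
    have *: "F (a e) x = p \<longleftrightarrow> x = fst e"
      using F(3)[OF aI[OF that(1)], of x] F(3)[OF aI[OF that(1)], of p] a(2)[OF that(1)] that(2)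
      by (metis insertI1 insertI2)
    then show "L e x = (if x = fst e then fst (snd e) else F (a e) x)"
      using that by (simp add: L_def)
    show "L e x \<in> X" if "x \<noteq> fst e"
      using * that \<open>x \<in> X\<close> F(1)[OF aI[OF \<open>e \<in> K\<close>], of x] by (auto simp: L_def)
  qed
  have LY: "L e x = (if x = fst (snd e) then fst e else H (b e) x)"
    and LY': "x \<noteq> fst (snd e) \<Longrightarrow> L e x \<in> V - X"
    if "e \<in> K" "x \<in> V - X" for e x
  proof -
    have *: "H (b e) x = q \<longleftrightarrow> x = fst (snd e)"
      using H(3)[OF bJ[OF that(1)], of x] H(3)[OF bJ[OF that(1)], of q] b(2)[OF that(1)] that(2)
      by (metis insertI1 insertI2)
    then show "L e x = (if x = fst (snd e) then fst e else H (b e) x)"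
      using that by (simp add: L_def)
    show "L e x \<in> V - X" if "x \<noteq> fst (snd e)"
      using * that \<open>x \<in> V - X\<close> H(1)[OF bJ[OF \<open>e \<in> K\<close>], of x] by (auto simp: L_def)
  qed
  have "perfect_matching V (L e)" if e: "e \<in> K" for e
    unfolding perfect_matching_def
  proof (intro ballI)
    fix x assume xV: "x \<in> V"
    note eX = eX[OF e] and eV = eV[OF e]
    show "L e x \<in> V \<and> L e x \<noteq> x \<and> L e (L e x) = x"
    proof (cases "x \<in> X")
      case True
      show ?thesis
      proof (cases "x = fst e")
        case True
        then show ?thesis using LX[OF e, of x] LY[OF e, of "fst (snd e)"] eX eV by auto
      next
        case False
        have "L e (L e x) = L e (F (a e) x)" "F (a e) x \<in> X"
          using False True LX[OF e, of x] LX'[OF e, of x] by auto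
        moreover have "F (a e) x \<noteq> fst e"
          using a(2)[OF e] F(3)[OF aI[OF e], of x] F(3)[OF aI[OF e], of p] True p
          by (metis DiffD2 insertI1 insertI2)
        ultimately show ?thesis
          using False True LX[OF e] LX'[OF e, of x] F(2,3)[OF aI[OF e], of x] X by auto
      qed
    next
      case nX: False
      then have xY: "x \<in> V - X" using xV by auto
      show ?thesis
      proof (cases "x = fst (snd e)")
        case True
        then show ?thesis using LY[OF e, of x] LX[OF e, of "fst e"] eX eV X by auto
      next
        case False
        have "L e (L e x) = L e (H (b e) x)" "H (b e) x \<in> V - X"
          using False xY LY[OF e, of x] LY'[OF e, of x] by auto
        moreover have "H (b e) x \<noteq> fst (snd e)"
          using b(2)[OF e] H(3)[OF bJ[OF e], of x] H(3)[OF bJ[OF e], of q] xY q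
          by (metis DiffD2 insertI1 insertI2)
        ultimately show ?thesis
          using False xY LY[OF e] LY'[OF e, of x] H(2,3)[OF bJ[OF e], of x] by auto
      qed
    qed
  qed
  moreover have "w u v = card {e\<in>K. L e u = v}" if uv: "u \<in> V" "v \<in> V" for u v
  proof -
    have mixed: "card {e\<in>K. fst e = x \<and> fst (snd e) = y} = w x y" if "x \<in> X" "y \<in> V - X" for x y
    proof -
      have "{e\<in>K. fst e = x \<and> fst (snd e) = y} = (\<lambda>k. (x, y, k)) ` {..<w x y}"
        using that by (auto simp: K_def)
      then show ?thesis by (simp add: card_image inj_on_def)
    qed
    consider "u \<in> X" "v \<in> X" | "u \<in> X" "v \<in> V - X" | "u \<in> V - X" "v \<in> X" | "u \<in> V - X" "v \<in> V - X"
      using uv by blast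
    then show ?thesis
    proof cases
      case 1
      have "{e\<in>K. L e u = v} = {e\<in>K. F (a e) u = v}"
      proof (intro Collect_cong conj_cong refl)
        fix e assume e: "e \<in> K"
        show "L e u = v \<longleftrightarrow> F (a e) u = v"
          using LX[OF e 1(1)] eV[OF e] 1 a(2)[OF e] F(3)[OF aI[OF e], of p] p
          by (metis DiffD2 insertI1)
      qed
      also have "card \<dots> = card {i\<in>I. F i u = v}"
        by (rule bij_betw_same_card[OF bij_betw_filter[OF a(1)]])
      finally show ?thesis using cF[of u v] 1 p by (auto simp: shrink_def)
    next
      case 2
      have "{e\<in>K. L e u = v} = {e\<in>K. fst e = u \<and> fst (snd e) = v}"
      proof (intro Collect_cong conj_cong refl)
        fix e assume e: "e \<in> K"
        show "L e u = v \<longleftrightarrow> fst e = u \<and> fst (snd e) = v"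
          using LX[OF e 2(1)] LX'[OF e 2(1)] 2 by auto
      qed
      then show ?thesis using mixed[OF 2] by simp
    next
      case 3
      have "{e\<in>K. L e u = v} = {e\<in>K. fst e = v \<and> fst (snd e) = u}"
      proof (intro Collect_cong conj_cong refl)
        fix e assume e: "e \<in> K"
        show "L e u = v \<longleftrightarrow> fst e = v \<and> fst (snd e) = u"
          using LY[OF e 3(1)] LY'[OF e 3(1)] 3 by auto
      qed
      then show ?thesis using mixed[OF 3(2,1)] sym[OF uv] by simp
    next
      case 4
      have "{e\<in>K. L e u = v} = {e\<in>K. H (b e) u = v}"
      proof (intro Collect_cong conj_cong refl)
        fix e assume e: "e \<in> K"
        show "L e u = v \<longleftrightarrow> H (b e) u = v"
          using LY[OF e 4(1)] eX[OF e] 4 b(2)[OF e] H(3)[OF bJ[OF e], of q] q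
          by (metis DiffD2 insertI1)
      qed
      also have "card \<dots> = card {j\<in>J. H j u = v}"
        by (rule bij_betw_same_card[OF bij_betw_filter[OF b(1)]])
      finally show ?thesis using cH[of u v] 4 q by (auto simp: shrink_def)
    qed
  qed
  ultimately have "colouring V w K L" unfolding colouring_def using fK by blast
  then show ?thesis by (rule colouring_decomposable)
qed

section \<open>The Tutte-Berge formula\<close>

text \<open>Matchings that need not be perfect are total involutions whose fixed points are the
  unmatched vertices.\<close>

definition matching_on :: "'a set \<Rightarrow> ('a \<Rightarrow> 'a \<Rightarrow> bool) \<Rightarrow> ('a \<Rightarrow> 'a) \<Rightarrow> bool" where
  "matching_on V E f \<longleftrightarrow> (\<forall>v\<in>V. f v \<in> V \<and> f (f v) = v \<and> (f v \<noteq> v \<longrightarrow> E v (f v)))"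

definition missed :: "'a set \<Rightarrow> ('a \<Rightarrow> 'a) \<Rightarrow> 'a set" where
  "missed V f = {v\<in>V. f v = v}"

definition maximum_matching :: "'a set \<Rightarrow> ('a \<Rightarrow> 'a \<Rightarrow> bool) \<Rightarrow> ('a \<Rightarrow> 'a) \<Rightarrow> bool" where
  "maximum_matching V E f \<longleftrightarrow> matching_on V E f \<and>
     (\<forall>g. matching_on V E g \<longrightarrow> card (missed V f) \<le> card (missed V g))"

lemma matching_onD:
  assumes "matching_on V E f" "v \<in> V"
  shows "f v \<in> V" "f (f v) = v" "f v \<noteq> v \<Longrightarrow> E v (f v)"
  using assms unfolding matching_on_def by auto

lemma perfect_matching_even_card:
  assumes "perfect_matching X f" "finite X"
  shows "even (card X)"
proof -
  have "even (\<Sum>u\<in>X. \<Sum>v\<in>X. matching_weight f u v)"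
    using wgraphD[OF matching_wgraph[OF assms]] by (intro even_sum_symmetric) blast+
  then show ?thesis using sum_matching_weight[OF assms] by simp
qed

lemma maximum_matching_exists: "\<exists>f. maximum_matching V E f"
proof -
  have "matching_on V E (\<lambda>x. x)" by (simp add: matching_on_def)
  then obtain f where "is_arg_min (\<lambda>g. card (missed V g)) (matching_on V E) f"
    using ex_is_arg_min_if_finite[of "{}"] is_arg_min_arg_min_nat by metis
  then show ?thesis unfolding maximum_matching_def is_arg_min_def by (metis not_less)
qed

lemma finite_missed: "finite V \<Longrightarrow> finite (missed V f)"
  by (simp add: missed_def)

lemma matching_missed_parity:
  assumes "finite V" "matching_on V E f"
  shows "even (card (missed V f)) \<longleftrightarrow> even (card V)"
proof -
  have "perfect_matching (V - missed V f) f"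
    using matching_onD[OF assms(2)] unfolding perfect_matching_def missed_def by auto
  then have "even (card (V - missed V f))"
    using assms(1) by (intro perfect_matching_even_card) auto
  moreover have "card V = card (missed V f) + card (V - missed V f)"
    using assms(1) by (subst card_Un_disjoint[symmetric]) (auto simp: missed_def intro: arg_cong[of _ _ card])
  ultimately show ?thesis by simp
qed

lemma maximum_matching_misses_nonadjacent:
  assumes "finite V" "symp E" "maximum_matching V E f"
    "x \<in> V" "y \<in> V" "x \<noteq> y" "f x = x" "f y = y"
  shows "\<not> E x y"
proof
  assume E: "E x y"
  let ?g = "f(x := y, y := x)"
  have f: "matching_on V E f" using assms(3) by (simp add: maximum_matching_def)
  have "f v \<noteq> x" "f v \<noteq> y" if "v \<in> V" "v \<noteq> x" "v \<noteq> y" for v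
    using matching_onD(2)[OF f that(1)] that assms(7,8) by metis+
  then have "matching_on V E ?g"
    using f assms(4,5) E sympD[OF assms(2) E] unfolding matching_on_def by auto
  moreover have "missed V ?g \<subset> missed V f"
    using assms by (auto simp: missed_def)
  ultimately show False
    using assms(3) psubset_card_mono[OF finite_missed[OF assms(1)]]
    unfolding maximum_matching_def by (metis not_less)
qed

text \<open>Gallai's lemma: among maximum matchings missing \<open>t\<close>, one that agrees as much as possible
  with a maximum matching missing \<open>u\<close> and \<open>v\<close> could be improved by a switch.\<close>

lemma gallai_transitive:
  assumes fin: "finite V" and sym: "symp E" and V: "u \<in> V" "v \<in> V" "t \<in> V"
    and t: "maximum_matching V E h" "h t = t"
    and ut: "\<And>f. maximum_matching V E f \<Longrightarrow> f u = u \<Longrightarrow> f t \<noteq> t"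
    and tv: "\<And>f. maximum_matching V E f \<Longrightarrow> f v = v \<Longrightarrow> f t \<noteq> t"
    and uv: "u \<noteq> v"
    and f: "maximum_matching V E f" "f u = u"
  shows "f v \<noteq> v"
proof
  assume fv: "f v = v"
  let ?P = "\<lambda>g. maximum_matching V E g \<and> g t = t"
  let ?a = "\<lambda>g. card {x\<in>V. f x = g x}"
  have "?P g \<longrightarrow> ?a g < Suc (card V)" for g
    using fin by (simp add: card_mono less_Suc_eq_le)
  then obtain g where g: "?P g" and gmax: "\<And>g'. ?P g' \<Longrightarrow> ?a g' \<le> ?a g"
    using ex_has_greatest_nat[of ?P h ?a "Suc (card V)"] t by blast
  have fm: "matching_on V E f" and gm: "matching_on V E g"
    using f g by (auto simp: maximum_matching_def)
  have ft: "f t \<noteq> t" using ut f by blast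
  have gu: "g u \<noteq> u" "g v \<noteq> v" using ut tv g by blast+
  let ?A = "missed V f" and ?B = "missed V g"
  have finA: "finite ?A" "finite ?B" using fin by (auto simp: finite_missed)
  have "card ?A = card ?B"
    using f g fm gm unfolding maximum_matching_def by (metis le_antisym)
  then have "card (?B - ?A) = card (?A - ?B)"
    using finA by (metis card_le_sym_Diff le_antisym order_refl)
  moreover have "{u, v} \<subseteq> ?A - ?B" using V f fv gu by (auto simp: missed_def)
  then have "2 \<le> card (?A - ?B)"
    using card_mono[of "?A - ?B" "{u, v}"] finA uv by simp
  \<comment> \<open>\<open>f\<close> and \<open>g\<close> miss equally many vertices, and
    \<open>u\<close> and \<open>v\<close> are missed by \<open>f\<close> only; so some vertex
    besides \<open>t\<close> is missed by \<open>g\<close> only.\<close>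
  ultimately have "\<not> ?B - ?A \<subseteq> {t}"
    using card_mono[of "{t}" "?B - ?A"] by auto
  then obtain x where x: "x \<in> V" "x \<noteq> t" "g x = x" "f x \<noteq> x"
    by (auto simp: missed_def)
  define y where "y = f x"
  have y: "y \<in> V" "f y = x" "E x y" "y \<noteq> x"
    using matching_onD[OF fm x(1)] x(4) by (auto simp: y_def)
  have gy: "g y \<noteq> y"
    using maximum_matching_misses_nonadjacent[OF fin sym, where f = g and x = x and y = y] g x y
    by metis
  define z where "z = g y"
  have z: "z \<in> V" "g z = y" "z \<noteq> y" "z \<noteq> x" "z \<noteq> t"
    using matching_onD[OF gm y(1)] gy x(3) y(4) g by (auto simp: z_def)
  \<comment> \<open>The edge \<open>y z\<close> of \<open>g\<close> is replaced by the edge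
    \<open>x y\<close> of \<open>f\<close>, which moves a gap from \<open>x\<close> to
    \<open>z\<close>. The number of gaps and the gap at \<open>t\<close> stay, \<open>x\<close> and
    \<open>y\<close> become agreements, and none is lost at \<open>z\<close>, as \<open>f z\<close>
    is not \<open>y\<close>.\<close>
  define g' where "g' = g(x := y, y := x, z := z)"
  have g'm: "matching_on V E g'"
    unfolding matching_on_def
  proof (intro ballI)
    fix a assume a: "a \<in> V"
    consider "a = x" | "a = y" | "a = z" | "a \<noteq> x" "a \<noteq> y" "a \<noteq> z" by blast
    then show "g' a \<in> V \<and> g' (g' a) = a \<and> (g' a \<noteq> a \<longrightarrow> E a (g' a))"
    proof cases
      case 4
      then have "g a \<noteq> x" "g a \<noteq> y" "g a \<noteq> z"
        using matching_onD(2)[OF gm a] x(3) z_def z(2) by metis+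
      then show ?thesis using 4 matching_onD[OF gm a] by (auto simp: g'_def)
    qed (use x y z sympD[OF sym y(3)] in \<open>auto simp: g'_def\<close>)
  qed
  have "missed V g' = insert z (?B - {x})"
    using x y z gy by (auto simp: missed_def g'_def)
  moreover have "z \<notin> ?B" "x \<in> ?B" using x y z by (auto simp: missed_def)
  ultimately have "card (missed V g') = card ?B"
    using finA by (metis (no_types) DiffD1 card_insert_disjoint card_Suc_Diff1 finite_Diff)
  then have "maximum_matching V E g'"
    using g g'm unfolding maximum_matching_def by metis
  moreover have "t \<noteq> y" using g gy by auto
  then have "g' t = t" using g x z by (auto simp: g'_def)
  ultimately have "?a g' \<le> ?a g" by (intro gmax) simp
  moreover have "{b\<in>V. f b = g b} \<subset> {b\<in>V. f b = g' b}"
  proof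
    have "f z \<noteq> g z" using z y matching_onD(2)[OF fm z(1)] by (metis)
    then show "{b\<in>V. f b = g b} \<subseteq> {b\<in>V. f b = g' b}"
      using x y z by (auto simp: g'_def y_def z_def)
    show "{b\<in>V. f b = g b} \<noteq> {b\<in>V. f b = g' b}"
    proof
      assume eq: "{b\<in>V. f b = g b} = {b\<in>V. f b = g' b}"
      have "g' x = f x" using y(4) z(4) by (simp add: g'_def y_def)
      then have "x \<in> {b\<in>V. f b = g b}" unfolding eq using x(1) by simp
      then show False using x(3,4) by simp
    qed
  qed
  then have "?a g < ?a g'" using fin by (intro psubset_card_mono) auto
  ultimately show False by simp
qed

text \<open>A vertex covered by all maximum matchings goes into \<open>S\<close>, and induction
  treats the rest. Without such a vertex \<open>S\<close> is empty: by Gallai's lemma it is an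
  equivalence relation that no maximum matching misses both of two distinct vertices, and its
  classes form \<open>K\<close>.\<close>

lemma tutte_berge:
  assumes "finite V" "symp E" "maximum_matching V E f"
  shows "\<exists>S K. S \<subseteq> V \<and> finite K \<and> (\<forall>C\<in>K. C \<subseteq> V - S \<and> odd (card C)) \<and>
    (\<forall>C\<in>K. \<forall>D\<in>K. C \<noteq> D \<longrightarrow> C \<inter> D = {}) \<and>
    (\<forall>C\<in>K. \<forall>a\<in>C. \<forall>b\<in>V - S - C. \<not> E a b) \<and> card S + card (missed V f) \<le> card K"
  using assms(1,3)
proof (induction V arbitrary: f rule: finite_psubset_induct)
  case (psubset V)
  note fin = psubset.hyps(1)
  have fm: "matching_on V E f" using psubset.prems by (simp add: maximum_matching_def)
  show ?case
  proof (cases "\<exists>v\<in>V. \<forall>g. maximum_matching V E g \<longrightarrow> g v \<noteq> v")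
    case True
    then obtain v where v: "v \<in> V" "\<And>g. maximum_matching V E g \<Longrightarrow> g v \<noteq> v" by blast
    obtain g where g: "maximum_matching (V - {v}) E g" using maximum_matching_exists by blast
    then have gm: "matching_on (V - {v}) E g" by (simp add: maximum_matching_def)
    define g' where "g' = g(v := v)"
    have g'm: "matching_on V E g'"
      using gm v(1) unfolding matching_on_def g'_def by auto
    have "missed V g' = insert v (missed (V - {v}) g)"
      using v(1) by (auto simp: missed_def g'_def)
    moreover have "v \<notin> missed (V - {v}) g" by (simp add: missed_def)
    ultimately have c: "card (missed V g') = Suc (card (missed (V - {v}) g))"
      using fin by (simp add: finite_missed)
    have "card (missed V f) \<le> card (missed V g')"
      using psubset.prems g'm by (simp add: maximum_matching_def)
    moreover have "card (missed V f) \<noteq> card (missed V g')"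
      using psubset.prems g'm v(2)[of g'] unfolding maximum_matching_def g'_def by (metis fun_upd_same)
    moreover have "even (card (missed V f)) \<longleftrightarrow> even (card (missed V g'))"
      using matching_missed_parity[OF fin fm] matching_missed_parity[OF fin g'm] by simp
    \<comment> \<open>The numbers of vertices missed by \<open>f\<close> and \<open>g'\<close> are
      distinct and of equal parity, so they differ by two. One is due to \<open>v\<close> being
      missed by \<open>g'\<close>, the other pays for \<open>v\<close> as a new element of
      \<open>S\<close>.\<close>
    ultimately have le: "Suc (card (missed V f)) \<le> card (missed (V - {v}) g)"
      unfolding c by (metis Suc_leI even_Suc le_neq_implies_less less_Suc_eq_le)
    have "V - {v} \<subset> V" using v(1) by auto
    from psubset.IH[OF this g] obtain S K where SK: "S \<subseteq> V - {v}" "finite K"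
      "\<forall>C\<in>K. C \<subseteq> V - {v} - S \<and> odd (card C)" "\<forall>C\<in>K. \<forall>D\<in>K. C \<noteq> D \<longrightarrow> C \<inter> D = {}"
      "\<forall>C\<in>K. \<forall>a\<in>C. \<forall>b\<in>V - {v} - S - C. \<not> E a b"
      "card S + card (missed (V - {v}) g) \<le> card K"
      by (elim exE conjE) (rule that; assumption)
    have "v \<notin> S" "finite S" using SK(1) fin finite_subset by auto
    then have "card (insert v S) + card (missed V f) \<le> card K" using le SK(6) by simp
    moreover have "V - {v} - S = V - insert v S" by auto
    ultimately show ?thesis
      using SK(1-5) v(1) by (intro exI[of _ "insert v S"] exI[of _ K]) auto
  next
    case False
    then have D: "\<exists>g. maximum_matching V E g \<and> g v = v" if "v \<in> V" for v using that by blast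
    define R where "R = {(u, v). u \<in> V \<and> v \<in> V \<and>
      (u = v \<or> (\<forall>g. maximum_matching V E g \<longrightarrow> g u = u \<longrightarrow> g v \<noteq> v))}"
    have "equiv V R"
    proof (rule equivI)
      show "R \<subseteq> V \<times> V" "refl_on V R" "sym R"
        by (auto simp: R_def refl_on_def sym_def)
      show "trans R"
      proof (rule transI)
        fix u t v assume "(u, t) \<in> R" "(t, v) \<in> R"
        then have V: "u \<in> V" "t \<in> V" "v \<in> V"
          and ut: "u = t \<or> (\<forall>g. maximum_matching V E g \<longrightarrow> g u = u \<longrightarrow> g t \<noteq> t)"
          and tv: "t = v \<or> (\<forall>g. maximum_matching V E g \<longrightarrow> g t = t \<longrightarrow> g v \<noteq> v)"
          by (auto simp: R_def)
        obtain h where "maximum_matching V E h" "h t = t" using D[OF V(2)] by blast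
        then show "(u, v) \<in> R"
          using gallai_transitive[OF fin assms(2) V(1,3,2), where h = h] ut tv V
          unfolding R_def by auto
      qed
    qed
    have adj: "(x, y) \<in> R" if "x \<in> V" "y \<in> V" "E x y" for x y
      using maximum_matching_misses_nonadjacent[OF fin assms(2)] that by (auto simp: R_def)
    \<comment> \<open>Matched vertices are adjacent, hence equivalent: a maximum matching maps every
      class to itself.\<close>
    have closed: "g x \<in> C" if "C \<in> V // R" "x \<in> C" "maximum_matching V E g" for C x g
    proof -
      have xV: "x \<in> V" using that(1,2) \<open>equiv V R\<close> in_quotient_imp_subset by blast
      have "matching_on V E g" using that(3) by (simp add: maximum_matching_def)
      then have "(x, g x) \<in> R"
        using matching_onD[of V E g x] xV adj[of x "g x"] by (cases "g x = x") (auto simp: R_def)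
      then show ?thesis using in_quotient_imp_closed[OF \<open>equiv V R\<close> that(1,2)] by blast
    qed
    \<comment> \<open>A maximum matching that misses \<open>v\<close> misses no other vertex of its
      class and therefore pairs up the rest of the class.\<close>
    have "odd (card C)" if C: "C \<in> V // R" for C
    proof -
      obtain v where v: "v \<in> C" using in_quotient_imp_non_empty[OF \<open>equiv V R\<close> C] by blast
      have CV: "C \<subseteq> V" using in_quotient_imp_subset[OF \<open>equiv V R\<close> C] .
      have fC: "finite C" using CV fin finite_subset by blast
      obtain g where g: "maximum_matching V E g" "g v = v" using D v CV by blast
      have "perfect_matching (C - {v}) g"
        unfolding perfect_matching_def
      proof (intro ballI)
        fix x assume x: "x \<in> C - {v}"
        have "(v, x) \<in> R"
          using in_quotient_imp_in_rel[OF \<open>equiv V R\<close> C] v x by auto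
        then have "g x \<noteq> x" using g x by (auto simp: R_def)
        moreover have gg: "g (g x) = x"
          using g x CV matching_onD(2)[of V E g x] by (auto simp: maximum_matching_def)
        moreover have "g x \<noteq> v" using gg g(2) x by auto
        ultimately show "g x \<in> C - {v} \<and> g x \<noteq> x \<and> g (g x) = x"
          using closed[OF C _ g(1), of x] x by auto
      qed
      then have "even (card (C - {v}))" using fC by (intro perfect_matching_even_card) auto
      then show ?thesis using v fC by (metis card_Suc_Diff1 even_Suc)
    qed
    moreover have "card (missed V f) \<le> card (V // R)"
    proof (rule card_inj_on_le[of "\<lambda>x. R `` {x}"])
      show "inj_on (\<lambda>x. R `` {x}) (missed V f)"
      proof (rule inj_onI)
        fix x y assume xy: "x \<in> missed V f" "y \<in> missed V f" "R `` {x} = R `` {y}"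
        then have "(x, y) \<in> R"
          using eq_equiv_class[OF _ \<open>equiv V R\<close>] by (auto simp: missed_def)
        then show "x = y" using xy psubset.prems by (auto simp: R_def missed_def)
      qed
      show "(\<lambda>x. R `` {x}) ` missed V f \<subseteq> V // R"
        by (auto simp: missed_def quotient_def)
      show "finite (V // R)"
        using fin \<open>equiv V R\<close> by (intro finite_quotient) (auto simp: R_def)
    qed
    moreover have "finite (V // R)"
      using fin \<open>equiv V R\<close> by (intro finite_quotient) (auto simp: R_def)
    moreover have "\<not> E a b" if "C \<in> V // R" "a \<in> C" "b \<in> V - C" for C a b
    proof
      assume "E a b"
      then have "(a, b) \<in> R" using adj in_quotient_imp_subset[OF \<open>equiv V R\<close> that(1)] that by blast
      then show False using in_quotient_imp_closed[OF \<open>equiv V R\<close> that(1,2)] that by blast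
    qed
    moreover have "C \<subseteq> V" if "C \<in> V // R" for C
      using in_quotient_imp_subset[OF \<open>equiv V R\<close> that] .
    moreover have "C \<inter> D = {}" if "C \<in> V // R" "D \<in> V // R" "C \<noteq> D" for C D
      using quotient_disj[OF \<open>equiv V R\<close> that(1,2)] that(3) by blast
    ultimately show ?thesis
      by (intro exI[of _ "{}"] exI[of _ "V // R"]) auto
  qed
qed

text \<open>Double counting: each odd set in \<open>K\<close> sends at least r edges to
  \<open>S\<close>, and each vertex of \<open>S\<close> receives at most r. So \<open>K\<close> is
  no larger than \<open>S\<close>, and a maximum matching misses nothing.\<close>

lemma wrgraph_perfect_matching:
  assumes G: "wrgraph V r w" and r: "0 < r"
  obtains f where "perfect_matching V f" "\<And>u. u \<in> V \<Longrightarrow> 0 < w u (f u)"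
proof -
  note wg = wrgraphD(1)[OF G]
  have fin: "finite V" by (rule wgraphD(1)[OF wg])
  define E where "E u v \<longleftrightarrow> u \<in> V \<and> v \<in> V \<and> 0 < w u v" for u v
  have sym: "symp E" using wgraphD(3)[OF wg] by (auto simp: E_def intro!: sympI)
  obtain f where f: "maximum_matching V E f" using maximum_matching_exists by blast
  obtain S K where SK: "S \<subseteq> V" "finite K" "\<forall>C\<in>K. C \<subseteq> V - S \<and> odd (card C)"
    "\<forall>C\<in>K. \<forall>D\<in>K. C \<noteq> D \<longrightarrow> C \<inter> D = {}"
    "\<forall>C\<in>K. \<forall>a\<in>C. \<forall>b\<in>V - S - C. \<not> E a b" "card S + card (missed V f) \<le> card K"
    using tutte_berge[OF fin sym f] by (elim exE conjE) (rule that; assumption)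
  have fS: "finite S" "\<forall>C\<in>K. finite C" using SK fin by (auto intro: finite_subset)
  have "card K * r = (\<Sum>C\<in>K. r)" by simp
  also have "\<dots> \<le> (\<Sum>C\<in>K. edge_cut V w C)"
    using SK(3) by (intro sum_mono wrgraphD(3)[OF G]) auto
  also have "\<dots> = (\<Sum>C\<in>K. \<Sum>u\<in>C. \<Sum>s\<in>S. w u s)"
    unfolding edge_cut_def
  proof (rule sum.cong[OF refl], rule sum.cong[OF refl])
    fix C u assume C: "C \<in> K" "u \<in> C"
    then have "u \<in> V" "S \<subseteq> V - C" using SK(1,3) by auto
    moreover have "w u v = 0" if "v \<in> V - C - S" for v
    proof -
      have "v \<in> V - S - C" "v \<in> V" using that by auto
      then have "\<not> E u v" using SK(5)[rule_format, OF C] by (simp only: not_False_eq_True)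
      then show ?thesis using \<open>u \<in> V\<close> \<open>v \<in> V\<close> by (simp add: E_def)
    qed
    ultimately show "(\<Sum>v\<in>V - C. w u v) = (\<Sum>s\<in>S. w u s)"
      using fin by (intro sum.mono_neutral_right) auto
  qed
  also have "\<dots> = (\<Sum>u\<in>\<Union>K. \<Sum>s\<in>S. w u s)"
    using fS SK(4) by (subst sum.Union_disjoint) auto
  also have "\<dots> = (\<Sum>s\<in>S. \<Sum>u\<in>\<Union>K. w u s)" by (rule sum.swap)
  also have "\<dots> \<le> (\<Sum>s\<in>S. r)"
  proof (rule sum_mono)
    fix s assume s: "s \<in> S"
    then have "s \<in> V" using SK(1) by auto
    have KV: "\<Union>K \<subseteq> V" using SK(3) by auto
    have "(\<Sum>u\<in>\<Union>K. w u s) = (\<Sum>u\<in>\<Union>K. w s u)"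
      using KV wgraphD(3)[OF wg, OF _ \<open>s \<in> V\<close>] by (intro sum.cong refl) blast
    also have "\<dots> \<le> (\<Sum>u\<in>V. w s u)" using KV fin by (intro sum_mono2) auto
    also have "\<dots> = r" using wrgraphD(2)[OF G \<open>s \<in> V\<close>] .
    finally show "(\<Sum>u\<in>\<Union>K. w u s) \<le> r" .
  qed
  also have "\<dots> = card S * r" by simp
  finally have "card K \<le> card S" using r by simp
  then have "card (missed V f) = 0" using SK(6) by linarith
  then have "missed V f = {}" using finite_missed[OF fin, of f] by simp
  then have "perfect_matching V f" "\<And>u. u \<in> V \<Longrightarrow> 0 < w u (f u)"
    using f unfolding maximum_matching_def matching_on_def perfect_matching_def missed_def E_def
    by auto
  then show thesis by (rule that)
qed

section \<open>Graphs with fewer than ten vertices\<close>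

lemma odd_nat_cases: "odd (n :: nat) \<Longrightarrow> n = 1 \<or> 3 \<le> n"
  by presburger

lemma wrgraph_zero_decomposable:
  assumes "wrgraph V 0 w"
  shows "decomposable V w"
proof (rule decomposable_zero)
  fix u v assume "u \<in> V" "v \<in> V"
  then show "w u v = 0"
    using wrgraphD(2)[OF assms, of u] wgraphD(1)[OF wrgraphD(1)[OF assms]] by auto
qed

text \<open>Either contraction replaces at least three vertices by one. The induction hypothesis is
  stated as a premise, so that the same lemma works within the induction below ten vertices and for
  graphs on ten vertices.\<close>

lemma tight_cut_decomposable:
  fixes V :: "'a set"
  assumes G: "wrgraph V r w" and X: "X \<subseteq> V" "odd (card X)" "3 \<le> card X" "card X + 3 \<le> card V"
    and tight: "edge_cut V w X = r"
    and IH: "\<And>(V' :: 'a set) w'. card V' < card V \<Longrightarrow> wrgraph V' r w' \<Longrightarrow> decomposable V' w'"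
  shows "decomposable V w"
proof (cases "r = 0")
  case True
  then show ?thesis using wrgraph_zero_decomposable G by auto
next
  case False
  note wg = wrgraphD(1)[OF G]
  have fin: "finite V" by (rule wgraphD(1)[OF wg])
  have fX: "finite X" using X fin finite_subset by blast
  have cV: "card V = card X + card (V - X)"
    by (rule card_eq_card_plus_Diff[OF fin X(1)])
  obtain q where q: "q \<in> X" using X(3) by fastforce
  have "V - X \<noteq> {}" using X(4) cV by force
  then obtain p where p: "p \<in> V - X" by blast
  have odd': "odd (card (V - X))" using odd_card_complement[OF G _ X(1,2)] False by simp
  have tight': "edge_cut V w (V - X) = r" using cut_complement[OF wg X(1)] tight by simp
  have "card (insert p X) < card V" "card (insert q (V - X)) < card V"
    using X(3,4) cV fX fin p q by auto
  moreover have "q \<in> V - (V - X)" using q X(1) by auto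
  ultimately show ?thesis
    using decomposable_glue[OF wg X(1) p q] IH shrink_wrgraph[OF G X(1,2) tight p]
      shrink_wrgraph[OF G _ odd' tight', of q] by blast
qed

text \<open>Cuts around one vertex, or around all but one, are determined by the degrees; only cuts
  with at least three vertices on either side need a check. The inequality in \<open>cuts\<close>
  says that r - 1 edges remain, in a form without subtraction.\<close>

lemma wrgraph_diff_matching:
  assumes G: "wrgraph V r w" and r: "0 < r"
    and f: "perfect_matching V f" "\<And>u. u \<in> V \<Longrightarrow> 0 < w u (f u)"
    and cuts: "\<And>X. X \<subseteq> V \<Longrightarrow> odd (card X) \<Longrightarrow> 3 \<le> card X \<Longrightarrow> card X + 3 \<le> card V \<Longrightarrow>
      edge_cut V (matching_weight f) X + r \<le> edge_cut V w X + 1"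
  shows "wrgraph V (r - 1) (\<lambda>u v. w u v - matching_weight f u v)"
proof -
  let ?w = "\<lambda>u v. w u v - matching_weight f u v"
  note wg = wrgraphD(1)[OF G]
  have fin: "finite V" by (rule wgraphD(1)[OF wg])
  note mg = matching_wgraph[OF f(1) fin]
  have le: "matching_weight f u v \<le> w u v" if "u \<in> V" for u v
    using matching_weight_le[OF f(1), of w] f(2) that by blast
  have wg': "wgraph V ?w"
    unfolding wgraph_def
    using fin wgraphD(2)[OF wg] wgraphD(3)[OF wg] wgraphD(3)[OF mg] by (metis diff_0_eq_0)
  have deg: "(\<Sum>v\<in>V. ?w u v) = r - 1" if "u \<in> V" for u
    using that le sum_matching_weight[OF f(1) fin that] wrgraphD(2)[OF G that]
    by (simp add: sum_subtractf_nat)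
  have "r - 1 \<le> edge_cut V ?w X" if X: "X \<subseteq> V" "odd (card X)" for X
  proof -
    have cV: "card V = card X + card (V - X)"
      by (rule card_eq_card_plus_Diff[OF fin X(1)])
    have o: "odd (card (V - X))" using odd_card_complement[OF G r X] .
    consider "card X = 1" | "card (V - X) = 1" | "3 \<le> card X" "3 \<le> card (V - X)"
      using odd_nat_cases[OF X(2)] odd_nat_cases[OF o] by blast
    then show ?thesis
    proof cases
      case 1
      then obtain u where "X = {u}" using card_1_singletonE by blast
      then show ?thesis using cut_singleton[OF wg', of u] deg X(1) by simp
    next
      case 2
      then obtain u where u: "V - X = {u}" using card_1_singletonE by blast
      then have "u \<in> V" by auto
      then show ?thesis
        using cut_singleton[OF wg', of u] deg cut_complement[OF wg' X(1)] u by simp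
    next
      case 3
      then show ?thesis
        using cuts[OF X] cV cut_diff[of X V "matching_weight f" w] X(1) le by auto
    qed
  qed
  then show ?thesis using wg' deg unfolding wrgraph_def by blast
qed

lemma wrgraph_nontight_cut:
  assumes G: "wrgraph V r w" and X: "X \<subseteq> V" "odd (card X)" "edge_cut V w X \<noteq> r"
  shows "r + 2 \<le> edge_cut V w X"
proof -
  have "r \<le> edge_cut V w X" using wrgraphD(3)[OF G X(1,2)] .
  moreover have "even (edge_cut V w X) \<longleftrightarrow> even r"
    using cut_parity[OF wrgraphD(1)[OF G] X(1) _ X(2)] wrgraphD(2)[OF G] by blast
  ultimately show ?thesis
    using X(3) by (metis Suc_leI add_2_eq_Suc' even_Suc le_neq_implies_less le_antisym not_less_eq_eq)
qed

text \<open>On at most eight vertices an odd cut has a side with at most three vertices, so a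
  perfect matching takes at most three of its edges, and a nontight cut keeps r - 1. The measure
  \<open>card V + r\<close> serves both reductions: contraction lowers the order, removal of a
  matching lowers r.\<close>

theorem small_wrgraph_decomposable:
  fixes V :: "'a set"
  assumes "wrgraph V r w" "card V \<le> 8"
  shows "decomposable V w"
  using assms
proof (induction "card V + r" arbitrary: V r w rule: less_induct)
  case less
  note G = less.prems(1)
  have fin: "finite V" by (rule wgraphD(1)[OF wrgraphD(1)[OF G]])
  show ?case
  proof (cases "r = 0")
    case True
    then show ?thesis using wrgraph_zero_decomposable G by auto
  next
    case r: False
    show ?thesis
    proof (cases "\<exists>X\<subseteq>V. odd (card X) \<and> 3 \<le> card X \<and> card X + 3 \<le> card V \<and> edge_cut V w X = r")
      case True
      then obtain X where X: "X \<subseteq> V" "odd (card X)" "3 \<le> card X" "card X + 3 \<le> card V" "edge_cut V w X = r"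
        by blast
      show ?thesis
      proof (rule tight_cut_decomposable[OF G X])
        fix V' :: "'a set" and w' assume "card V' < card V" "wrgraph V' r w'"
        then show "decomposable V' w'" using less.hyps[of V' r w'] less.prems(2) by simp
      qed
    next
      case False
      obtain f where f: "perfect_matching V f" "\<And>u. u \<in> V \<Longrightarrow> 0 < w u (f u)"
        using wrgraph_perfect_matching[OF G] r by blast
      have "wrgraph V (r - 1) (\<lambda>u v. w u v - matching_weight f u v)"
      proof (rule wrgraph_diff_matching[OF G _ f])
        fix X assume X: "X \<subseteq> V" "odd (card X)" "3 \<le> card X" "card X + 3 \<le> card V"
        then have "r + 2 \<le> edge_cut V w X" using wrgraph_nontight_cut[OF G X(1,2)] False by blast
        moreover have "edge_cut V (matching_weight f) X \<le> 3"
        proof -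
          have "card V = card X + card (V - X)"
            by (rule card_eq_card_plus_Diff[OF fin X(1)])
          then have "card X \<le> 4 \<or> card (V - X) \<le> 4" using less.prems(2) by linarith
          moreover have "odd (card (V - X))" using odd_card_complement[OF G _ X(1,2)] r by simp
          ultimately have "card X \<le> 3 \<or> card (V - X) \<le> 3"
            using X(2) by presburger
          then show ?thesis
            using cut_matching_le[OF f(1) fin X(1)] cut_matching_le[OF f(1) fin, of "V - X"]
              cut_complement[OF matching_wgraph[OF f(1) fin] X(1)] by auto
        qed
        ultimately show "edge_cut V (matching_weight f) X + r \<le> edge_cut V w X + 1" by simp
      qed (use r in simp_all)
      then have "decomposable V (\<lambda>u v. w u v - matching_weight f u v)"
        using less.hyps[of V "r - 1"] less.prems(2) r by simp
      then show ?thesis using decomposable_diff_matching f by blast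
    qed
  qed
qed

section \<open>Obstructed perfect matchings on ten vertices\<close>

lemma card_lt_10_decomposable:
  assumes "wrgraph V r w" "card V < 10"
  shows "decomposable V w"
proof (cases "r = 0")
  case False
  then have "card V \<noteq> 9" using even_card_if_wrgraph[OF assms(1)] by auto
  then show ?thesis using small_wrgraph_decomposable[OF assms(1)] assms(2) by simp
qed (use wrgraph_zero_decomposable assms in auto)

lemma order_10_nontight:
  assumes G: "wrgraph V r w" and V: "card V = 10" and nd: "\<not> decomposable V w"
    and X: "X \<subseteq> V" "odd (card X)" "3 \<le> card X" "card X + 3 \<le> card V"
  shows "r + 2 \<le> edge_cut V w X"
  using tight_cut_decomposable[OF G X] card_lt_10_decomposable nd V wrgraph_nontight_cut[OF G X(1,2)]
  by metis

lemma cut_matching_le_5: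
  assumes g: "perfect_matching V g" and V: "finite V" "card V = 10" and X: "X \<subseteq> V"
  shows "edge_cut V (matching_weight g) X \<le> 5"
proof -
  have "card V = card X + card (V - X)"
    by (rule card_eq_card_plus_Diff[OF V(1) X])
  then have "card X \<le> 5 \<or> card (V - X) \<le> 5" using V by linarith
  then show ?thesis
    using cut_matching_le[OF g V(1) X] cut_matching_le[OF g V(1), of "V - X"]
      cut_complement[OF matching_wgraph[OF g V(1)] X] by auto
qed

text \<open>The two sets consist of four common vertices \<open>A\<close> and one vertex each,
  \<open>b\<close> and \<open>c\<close>. The sum of the two cuts is the sum of the degrees of
  \<open>b\<close> and \<open>c\<close> plus twice the number \<open>e\<close> of edges from
  \<open>A\<close> to the other four vertices. This makes \<open>e\<close> too small for
  \<open>f\<close>, which leads \<open>A\<close> out of \<open>X\<close> and can use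
  \<open>c\<close> only once.\<close>

lemma near_tight_cuts_overlap:
  assumes G: "wrgraph V r w" and V: "card V = 10"
    and X: "X \<subseteq> V" "card X = 5" "edge_cut V w X = r + 2"
    and Y: "Y \<subseteq> V" "card Y = 5" "edge_cut V w Y = r + 2"
    and XY: "X \<noteq> Y" "4 \<le> card (X \<inter> Y)"
    and f: "perfect_matching V f" "\<And>u. u \<in> V \<Longrightarrow> 0 < w u (f u)" "\<And>u. u \<in> X \<Longrightarrow> f u \<notin> X"
  shows False
proof -
  note wg = wrgraphD(1)[OF G]
  have fin: "finite V" by (rule wgraphD(1)[OF wg])
  have fX: "finite X" "finite Y" using X Y fin finite_subset by blast+
  define A where "A = X \<inter> Y"
  define D where "D = V - (X \<union> Y)"
  have fAD: "finite A" "finite D" using fX fin by (auto simp: A_def D_def)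
  have "A \<noteq> X"
  proof
    assume "A = X"
    then have "X \<subseteq> Y" by (auto simp: A_def)
    then show False using card_subset_eq[OF fX(2)] X Y XY by auto
  qed
  then have "A \<subset> X" by (auto simp: A_def)
  then have cA: "card A = 4" using psubset_card_mono[OF fX(1), of A] X(2) XY(2) by (simp add: A_def)
  have "card (X - A) = 1" "card (Y - A) = 1"
    using fX X(2) Y(2) cA by (auto simp: card_Diff_subset A_def fAD)
  then obtain b c where b: "X - A = {b}" and c: "Y - A = {c}" by (meson card_1_singletonE)
  have Xb: "X = insert b A" and Yc: "Y = insert c A" and nA: "b \<notin> A" "c \<notin> A" and bc: "b \<noteq> c"
    using b c XY(1) by (auto simp: A_def)
  have VX: "V - X = insert c D" "V - Y = insert b D" and nD: "b \<notin> D" "c \<notin> D" and bV: "b \<in> V" "c \<in> V"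
    and AV: "A \<subseteq> V" "D \<subseteq> V"
    using Xb Yc nA bc X(1) Y(1) by (auto simp: D_def)
  have disj: "A \<inter> D = {}" by (auto simp: A_def D_def)
  have Vb: "V - {b} = insert c (A \<union> D)" and Vc: "V - {c} = insert b (A \<union> D)"
    using Xb Yc nA bc X(1) Y(1) by (auto simp: D_def)
  define e where "e = (\<Sum>u\<in>A. \<Sum>v\<in>D. w u v)"
  have s1: "(\<Sum>u\<in>A. w u c) = (\<Sum>u\<in>A. w c u)" and s2: "(\<Sum>u\<in>A. w u b) = (\<Sum>u\<in>A. w b u)"
    using wgraphD(3)[OF wg] AV bV by (auto intro!: sum.cong)
  have "edge_cut V w X = w b c + (\<Sum>v\<in>D. w b v) + ((\<Sum>u\<in>A. w c u) + e)"
    unfolding edge_cut_def VX(1) unfolding Xb using fAD nA nD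
    by (simp add: sum.distrib e_def s1)
  moreover have "edge_cut V w Y = w c b + (\<Sum>v\<in>D. w c v) + ((\<Sum>u\<in>A. w b u) + e)"
    unfolding edge_cut_def VX(2) unfolding Yc using fAD nA nD
    by (simp add: sum.distrib e_def s2)
  moreover have "w b c + (\<Sum>u\<in>A. w b u) + (\<Sum>v\<in>D. w b v) = r"
    using cut_singleton[OF wg bV(1)] wrgraphD(2)[OF G bV(1)] fAD nA nD disj
    by (simp add: edge_cut_def Vb sum.union_disjoint)
  moreover have "w c b + (\<Sum>u\<in>A. w c u) + (\<Sum>v\<in>D. w c v) = r"
    using cut_singleton[OF wg bV(2)] wrgraphD(2)[OF G bV(2)] fAD nA nD disj
    by (simp add: edge_cut_def Vc sum.union_disjoint)
  \<comment> \<open>The four equations add up to 2 (r + 2) = 2 r + 2 e.\<close>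
  ultimately have "e = 2" using X(3) Y(3) by linarith
  moreover have "3 \<le> e"
  proof -
    have "f u \<in> insert c D" if "u \<in> A" for u
      using f(1) f(3)[of u] that AV VX(1) unfolding Xb perfect_matching_def by blast
    then have "A \<subseteq> {u\<in>A. f u \<in> D} \<union> {f c}"
      using f(1) AV unfolding perfect_matching_def by fastforce
    then have "card A \<le> card ({u\<in>A. f u \<in> D} \<union> {f c})"
      using fAD by (intro card_mono) auto
    also have "\<dots> \<le> card {u\<in>A. f u \<in> D} + 1"
      using card_Un_le[of "{u\<in>A. f u \<in> D}" "{f c}"] by simp
    finally have "3 \<le> card {u\<in>A. f u \<in> D}" using cA by simp
    also have "\<dots> = (\<Sum>u\<in>A. of_bool (f u \<in> D))" by (rule card_filter_eq_sum[OF fAD(1)])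
    also have "\<dots> \<le> e"
      unfolding e_def
    proof (rule sum_mono)
      fix u assume u: "u \<in> A"
      show "of_bool (f u \<in> D) \<le> (\<Sum>v\<in>D. w u v)"
      proof (cases "f u \<in> D")
        case True
        then have "w u (f u) \<le> (\<Sum>v\<in>D. w u v)" using fAD(2) by (intro member_le_sum) auto
        then show ?thesis using f(2)[of u] u AV True by auto
      qed simp
    qed
    finally show ?thesis .
  qed
  ultimately show False by simp
qed

lemma crossing_all_iff:
  assumes f: "perfect_matching V f" and fin: "finite V" and X: "X \<subseteq> V"
  shows "edge_cut V (matching_weight f) X = card X \<longleftrightarrow> (\<forall>u\<in>X. f u \<notin> X)"
proof -
  have fX: "finite X" using X fin finite_subset by blast
  have "card {u\<in>X. f u \<notin> X} = card X \<longleftrightarrow> {u\<in>X. f u \<notin> X} = X"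
    using card_subset_eq[OF fX, of "{u\<in>X. f u \<notin> X}"] by auto
  then show ?thesis unfolding cut_matching_eq_card[OF f fin X] by blast
qed

text \<open>Subtracting a matching that meets a near-tight cut in five edges from \<open>2 w\<close> makes this cut
  tight, hence \<open>2 w\<close> is a sum of \<open>2 r\<close> perfect matchings. Each of them meets a near-tight cut of its
  own in five edges and the cuts of the others in one edge; relative to a fixed one of these matchings,
  the two sides of each other cut select two of the ten pairs of its edges.\<close>

lemma no_removable_matching:
  assumes G: "wrgraph V r w" and V: "card V = 10" and r: "0 < r"
    and nd: "\<not> decomposable V w"
    and bad: "\<And>f. perfect_matching V f \<Longrightarrow> (\<And>u. u \<in> V \<Longrightarrow> 0 < w u (f u)) \<Longrightarrow>
      \<exists>X\<subseteq>V. card X = 5 \<and> edge_cut V w X = r + 2 \<and> (\<forall>u\<in>X. f u \<notin> X)"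
  shows "r = 3" "\<exists>f X. perfect_matching V f \<and> X \<subseteq> V \<and> card X = 5 \<and> edge_cut V w X = 5 \<and>
    (\<forall>u\<in>X. f u \<notin> X) \<and> (\<forall>u\<in>V. 0 < w u (f u))"
proof -
  note wg = wrgraphD(1)[OF G]
  have fin: "finite V" by (rule wgraphD(1)[OF wg])
  obtain f where f: "perfect_matching V f" "\<And>u. u \<in> V \<Longrightarrow> 0 < w u (f u)"
    using wrgraph_perfect_matching[OF G r] by blast
  obtain Z where Z: "Z \<subseteq> V" "card Z = 5" "edge_cut V w Z = r + 2" "\<forall>u\<in>Z. f u \<notin> Z"
    using bad[OF f] by blast
  have fZ: "finite Z" using Z(1) fin finite_subset by blast
  have le: "matching_weight f u v \<le> w u v" if "u \<in> V" for u v
    using matching_weight_le[OF f(1), of w] f(2) that by blast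
  let ?w2 = "\<lambda>u v. w u v + w u v"
  let ?w' = "\<lambda>u v. w u v + w u v - matching_weight f u v"
  have G2: "wrgraph V (2 * r) ?w2"
    unfolding wrgraph_def wgraph_def cut_add
    using fin wgraphD(2,3)[OF wg] wrgraphD(2,3)[OF G] by (auto simp: sum.distrib mult_2 intro!: add_mono)
  \<comment> \<open>In \<open>?w2\<close> the relevant cuts have size at least 2 r + 4, of which a
    matching takes at most five.\<close>
  have G': "wrgraph V (2 * r - 1) ?w'"
  proof (rule wrgraph_diff_matching[OF G2 _ f(1)])
    fix X assume X: "X \<subseteq> V" "odd (card X)" "3 \<le> card X" "card X + 3 \<le> card V"
    show "edge_cut V (matching_weight f) X + 2 * r \<le> edge_cut V ?w2 X + 1"
      using order_10_nontight[OF G V nd X] cut_matching_le_5[OF f(1) fin V X(1)] by (simp add: cut_add)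
  qed (use r f in auto)
  have cZ: "edge_cut V (matching_weight f) Z = 5"
    using crossing_all_iff[OF f(1) fin Z(1)] Z by simp
  have cut': "edge_cut V ?w' X + edge_cut V (matching_weight f) X = 2 * edge_cut V w X" if "X \<subseteq> V" for X
    using cut_diff[OF that, of "matching_weight f" ?w2] le by (simp add: cut_add trans_le_add1)
  \<comment> \<open>2 (r + 2) - 5 is the degree of \<open>?w'\<close>, so \<open>Z\<close> is tight
    and both contractions have six vertices.\<close>
  have "edge_cut V ?w' Z = 2 * r - 1" using cut'[OF Z(1)] cZ Z(3) by simp
  then have "decomposable V ?w'"
    using tight_cut_decomposable[OF G' Z(1)] Z(2) V card_lt_10_decomposable by auto
  then obtain I :: "nat set" and F where F: "colouring V ?w' I F"
    unfolding decomposable_def by blast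
  have fI: "finite I" and Fpm: "\<And>i. i \<in> I \<Longrightarrow> perfect_matching V (F i)"
    using F by (auto simp: colouring_def)
  have cI: "card I = 2 * r - 1"
  proof -
    obtain u where "u \<in> V" using V by fastforce
    then show ?thesis using card_colouring[OF F fin] wrgraphD(2)[OF G'] by blast
  qed
  have Fw: "0 < w u (F i u)" if "i \<in> I" "u \<in> V" for i u
    using colouring_matching_support[OF F that] by auto
  have "\<forall>i\<in>I. \<exists>X\<subseteq>V. card X = 5 \<and> edge_cut V w X = r + 2 \<and> (\<forall>u\<in>X. F i u \<notin> X)"
    using bad Fpm Fw by blast
  then obtain X where X: "\<And>i. i \<in> I \<Longrightarrow> X i \<subseteq> V" "\<And>i. i \<in> I \<Longrightarrow> card (X i) = 5"
    "\<And>i. i \<in> I \<Longrightarrow> edge_cut V w (X i) = r + 2" "\<And>i u. i \<in> I \<Longrightarrow> u \<in> X i \<Longrightarrow> F i u \<notin> X i"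
    by metis
  let ?c = "\<lambda>g Y. edge_cut V (matching_weight g) Y"
  have total: "?c f (X i) + (\<Sum>j\<in>I. ?c (F j) (X i)) = 2 * r + 4" if i: "i \<in> I" for i
  proof -
    have "edge_cut V ?w' (X i) = (\<Sum>j\<in>I. ?c (F j) (X i))"
      unfolding cut_sum[OF fI, symmetric]
      using colouring_weight[OF F] X(1)[OF i] by (intro cut_cong) auto
    then show ?thesis using cut'[OF X(1)[OF i]] X(3)[OF i] by simp
  qed
  have pos: "1 \<le> ?c g (X i)" if "perfect_matching V g" "i \<in> I" for g i
    using cut_matching_odd[OF that(1) fin X(1)[OF that(2)]] X(2)[OF that(2)]
    by (metis Suc_leI even_zero gr0I odd_numeral One_nat_def)
  have self: "?c (F i) (X i) = 5" if "i \<in> I" for i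
    using crossing_all_iff[OF Fpm[OF that] fin X(1)[OF that]] X(2,4)[OF that] by simp
  \<comment> \<open>The 2 r matchings cross \<open>X i\<close> in 2 r + 4 edges altogether.
    \<open>F i\<close> takes five of these, and each of the 2 r - 1 others at least one, so exactly
    one.\<close>
  have one: "?c f (X i) = 1" "\<And>j. j \<in> I \<Longrightarrow> j \<noteq> i \<Longrightarrow> ?c (F j) (X i) = 1" if i: "i \<in> I" for i
  proof -
    let ?J = "I - {i}"
    have "(\<Sum>j\<in>I. ?c (F j) (X i)) = 5 + (\<Sum>j\<in>?J. ?c (F j) (X i))"
      using sum.remove[OF fI i, of "\<lambda>j. ?c (F j) (X i)"] self[OF i] by simp
    then have *: "?c f (X i) + (\<Sum>j\<in>?J. ?c (F j) (X i)) = Suc (card ?J)"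
      using total[OF i] cI card_Suc_Diff1[OF fI i] r by linarith
    have "(\<Sum>j\<in>?J. ?c (F j) (X i)) = (\<Sum>j\<in>?J. (?c (F j) (X i) - 1) + 1)"
      using pos[OF Fpm i] by (intro sum.cong refl) (metis DiffD1 le_add_diff_inverse2)
    also have "\<dots> = (\<Sum>j\<in>?J. ?c (F j) (X i) - 1) + card ?J"
      by (simp only: sum.distrib) simp
    finally have **: "?c f (X i) - 1 + (\<Sum>j\<in>?J. ?c (F j) (X i) - 1) = 0"
      using * pos[OF f(1) i] by simp
    then show "?c f (X i) = 1" using pos[OF f(1) i] by simp
    fix j assume "j \<in> I" "j \<noteq> i"
    then have "?c (F j) (X i) - 1 = 0" using ** fI by simp
    then show "?c (F j) (X i) = 1" using pos[OF Fpm[OF \<open>j \<in> I\<close>] i] by simp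
  qed
  \<comment> \<open>Both sides of every cut are used, which gives 2 (2 r - 1) sets; one side alone
    would only bound r by 5.\<close>
  define Y where "Y p = (if snd p then X (fst p) else V - X (fst p))" for p
  let ?P = "I \<times> (UNIV :: bool set)"
  have Yp: "Y p \<subseteq> V" "card (Y p) = 5" "edge_cut V w (Y p) = r + 2"
    "\<And>g. perfect_matching V g \<Longrightarrow> ?c g (Y p) = ?c g (X (fst p))" if "p \<in> ?P" for p
  proof -
    have i: "fst p \<in> I" using that by auto
    note Xi = X(1)[OF i] X(2)[OF i] X(3)[OF i]
    show "Y p \<subseteq> V" using Xi by (auto simp: Y_def)
    show "card (Y p) = 5"
      using Xi V fin by (simp add: Y_def card_Diff_subset finite_subset)
    show "edge_cut V w (Y p) = r + 2"
      using Xi cut_complement[OF wg] by (simp add: Y_def)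
    show "?c g (Y p) = ?c g (X (fst p))" if "perfect_matching V g" for g
      using cut_complement[OF matching_wgraph[OF that fin] Xi(1)] by (simp add: Y_def)
  qed
  \<comment> \<open>\<open>f\<close> crosses \<open>Y p\<close> once, so two edges of
    \<open>f\<close> lie inside \<open>Y p\<close>. As \<open>Z\<close> contains one end of each
    edge of \<open>f\<close>, these two edges are recorded by a pair in \<open>Z\<close>.\<close>
  define D where "D p = {u\<in>Z. u \<in> Y p \<and> f u \<in> Y p}" for p
  define Q where "Q p = {u\<in>Y p. f u \<in> Y p}" for p
  have fV: "f u \<in> V" "f (f u) = u" if "u \<in> V" for u
    using f(1) that by (auto simp: perfect_matching_def)
  have Zf: "f u \<in> Z" if "u \<in> V - Z" for u
  proof (rule ccontr)
    assume "f u \<notin> Z"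
    then have "insert u (f ` Z) \<subseteq> V - Z - {f u}" using that fV Z(1,4) f(1)
      by (auto simp: perfect_matching_def) (metis subsetD)+
    then have "card (insert u (f ` Z)) \<le> card (V - Z - {f u})" using fin by (intro card_mono) auto
    moreover have "u \<notin> f ` Z" using \<open>f u \<notin> Z\<close> fV Z(1) by auto
    moreover have "inj_on f Z" using fV Z(1) by (metis inj_onI subsetD)
    ultimately show False
      using fZ fin V Z(1,2) that fV \<open>f u \<notin> Z\<close> by (simp add: card_image card_Diff_subset)
  qed
  have QD: "Q p = D p \<union> f ` D p" if "p \<in> ?P" for p
  proof
    show "D p \<union> f ` D p \<subseteq> Q p" using fV Yp(1)[OF that] by (auto simp: D_def Q_def)
    show "Q p \<subseteq> D p \<union> f ` D p"
    proof
      fix u assume u: "u \<in> Q p"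
      then have uV: "u \<in> V" using Yp(1)[OF that] by (auto simp: Q_def)
      show "u \<in> D p \<union> f ` D p"
      proof (cases "u \<in> Z")
        case True
        then show ?thesis using u by (simp add: D_def Q_def)
      next
        case False
        then have "f u \<in> D p" "f (f u) = u" using Zf[of u] uV fV(2)[OF uV] u by (auto simp: D_def Q_def)
        then show ?thesis by (metis UnI2 imageI)
      qed
    qed
  qed
  have cQ: "card (Q p) = 4" if "p \<in> ?P" for p
  proof -
    have fY: "finite (Y p)" using Yp(1)[OF that] fin finite_subset by blast
    have "card {u\<in>Y p. f u \<notin> Y p} = 1"
      using cut_matching_eq_card[OF f(1) fin Yp(1)[OF that]] Yp(4)[OF that f(1)] one(1)[of "fst p"] that by auto
    moreover have "Y p = Q p \<union> {u\<in>Y p. f u \<notin> Y p}" "Q p \<inter> {u\<in>Y p. f u \<notin> Y p} = {}"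
      by (auto simp: Q_def)
    then have "card (Y p) = card (Q p) + card {u\<in>Y p. f u \<notin> Y p}"
      using fY by (metis (no_types, lifting) card_Un_disjoint finite_Un)
    ultimately show ?thesis using Yp(2)[OF that] by simp
  qed
  have cD: "card (D p) = 2" if "p \<in> ?P" for p
  proof -
    have "D p \<subseteq> Z" by (auto simp: D_def)
    then have "D p \<inter> f ` D p = {}" "finite (D p)" "inj_on f (D p)"
      using Z(1,4) fZ fV by (blast intro: finite_subset)+
        (metis inj_onI subsetD Z(1) \<open>D p \<subseteq> Z\<close> fV(2))
    then show ?thesis using cQ[OF that] unfolding QD[OF that] by (simp add: card_Un_disjoint card_image)
  qed
  \<comment> \<open>If \<open>D p = D q\<close>, then \<open>Y p\<close> and \<open>Y q\<close>
    share the four ends of two edges of \<open>f\<close>, which distinct near-tight sets cannot do.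
    Sides of different cuts are distinct, because \<open>F (fst p)\<close> crosses the first cut
    five times and the second once.\<close>
  have "inj_on D ?P"
  proof (rule inj_onI, rule ccontr)
    fix p q assume pq: "p \<in> ?P" "q \<in> ?P" "D p = D q" "p \<noteq> q"
    then have pI: "fst p \<in> I" "fst q \<in> I" by auto
    have "Y p \<noteq> Y q"
    proof
      assume eq: "Y p = Y q"
      show False
      proof (cases "fst p = fst q")
        case True
        then have "X (fst p) = V - X (fst p)"
          using eq pq(4) by (auto simp: Y_def prod_eq_iff split: if_splits)
        moreover have "X (fst p) \<subseteq> V" "X (fst p) \<noteq> {}" using X(1,2)[OF pI(1)] by auto
        ultimately show False by blast
      next
        case False
        then show False
          using self[OF pI(1)] one(2)[OF pI(2,1)] Yp(4)[OF pq(1) Fpm[OF pI(1)]]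
            Yp(4)[OF pq(2) Fpm[OF pI(1)]] eq by simp
      qed
    qed
    moreover have "Q p \<subseteq> Y p \<inter> Y q"
      using QD[OF pq(1)] QD[OF pq(2)] pq(3) by (auto simp: Q_def)
    then have "4 \<le> card (Y p \<inter> Y q)"
      using card_mono[of "Y p \<inter> Y q" "Q p"] cQ[OF pq(1)] finite_subset[OF Yp(1)[OF pq(1)] fin] by simp
    moreover have "\<forall>u\<in>Y p. F (fst p) u \<notin> Y p"
      using crossing_all_iff[OF Fpm[OF pI(1)] fin Yp(1)[OF pq(1)]] Yp(2,4)[OF pq(1)]
        Fpm[OF pI(1)] self[OF pI(1)] by simp
    ultimately show False
      using near_tight_cuts_overlap[OF G V Yp(1,2,3)[OF pq(1)] Yp(1,2,3)[OF pq(2)] _ _ Fpm[OF pI(1)]]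
        Fw[OF pI(1)] by blast
  qed
  moreover have "D ` ?P \<subseteq> {S. S \<subseteq> Z \<and> card S = 2}" using cD by (auto simp: D_def)
  ultimately have "card ?P \<le> card {S. S \<subseteq> Z \<and> card S = 2}"
    using fZ by (intro card_inj_on_le) auto
  also have "\<dots> = 10" using n_subsets[OF fZ, of 2] Z(2) by (simp add: choose_two)
  \<comment> \<open>The ten pairs in \<open>Z\<close> give r \<le> 3; the reverse inequality holds
    since a cut of size r + 2 contains five edges of \<open>f\<close>.\<close>
  finally have "2 * r - 1 \<le> 5" using cI by (simp add: card_cartesian_product card_UNIV_bool)
  moreover have "5 \<le> r + 2"
    using cut_diff[OF Z(1), of "matching_weight f" w] le cZ Z(3) by simp
  ultimately show r3: "r = 3" by simp
  show "\<exists>f X. perfect_matching V f \<and> X \<subseteq> V \<and> card X = 5 \<and> edge_cut V w X = 5 \<and>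
    (\<forall>u\<in>X. f u \<notin> X) \<and> (\<forall>u\<in>V. 0 < w u (f u))"
    using f Z r3 by (intro exI[of _ f] exI[of _ Z]) auto
qed

section \<open>Two 5-cycles joined by a perfect matching\<close>

definition cycle5 :: "nat \<Rightarrow> nat \<Rightarrow> bool" where
  "cycle5 i j \<longleftrightarrow> j = (i + 1) mod 5 \<or> i = (j + 1) mod 5"

lemma all_less_5: "(\<forall>i<5. P i) \<longleftrightarrow> P 0 \<and> P 1 \<and> P 2 \<and> P 3 \<and> P (4 :: nat)"
  by (simp add: numeral_eq_Suc All_less_Suc conj_ac)

lemma less_5_cases:
  assumes "i < (5 :: nat)"
  obtains "i = 0" | "i = 1" | "i = 2" | "i = 3" | "i = 4"
  using assms by linarith

text \<open>A simple 2-regular graph on five vertices can only be a 5-cycle. The labelling starts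
  with a prescribed edge, so that two 5-cycles can be aligned along a common edge.\<close>

lemma five_cycle:
  assumes X: "finite X" "card X = 5" and w: "\<And>u. u \<in> X \<Longrightarrow> w u u = (0 :: nat)"
    "\<And>u v. u \<in> X \<Longrightarrow> v \<in> X \<Longrightarrow> w u v = w v u"
    and le: "\<And>u v. u \<in> X \<Longrightarrow> v \<in> X \<Longrightarrow> w u v \<le> 1"
    and deg: "\<And>u. u \<in> X \<Longrightarrow> (\<Sum>v\<in>X. w u v) = 2"
    and ab: "a \<in> X" "b \<in> X" "w a b = 1"
  obtains p where "bij_betw p {..<5} X" "p 0 = a" "p 1 = b"
    "\<And>i j. i < 5 \<Longrightarrow> j < 5 \<Longrightarrow> w (p i) (p j) = of_bool (cycle5 i j)"
proof -
  define N where "N u = {v\<in>X. w u v = 1}" for u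
  have wN: "w u v = of_bool (v \<in> N u)" if "u \<in> X" "v \<in> X" for u v
    using le[OF that] that by (auto simp: N_def)
  have cN: "card (N u) = 2" if "u \<in> X" for u
  proof -
    have "card (N u) = (\<Sum>v\<in>X. of_bool (w u v = 1))"
      unfolding N_def by (rule card_filter_eq_sum[OF X(1)])
    also have "\<dots> = (\<Sum>v\<in>X. w u v)" using wN that by (intro sum.cong) (auto simp: N_def)
    finally show ?thesis using deg that by simp
  qed
  have NX: "N u \<subseteq> X" and nN: "u \<in> X \<Longrightarrow> u \<notin> N u" for u using w(1)[of u] by (auto simp: N_def)
  have symN: "v \<in> N u \<longleftrightarrow> u \<in> N v" if "u \<in> X" "v \<in> X" for u v
    using w(2)[OF that] that by (auto simp: N_def)
  have fN: "finite (N u)" for u using NX X(1) finite_subset by blast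
  have other: "\<exists>z. z \<noteq> v \<and> N u = {v, z}" if "u \<in> X" "v \<in> N u" for u v
  proof -
    have "card (N u - {v}) = 1" using cN that fN by simp
    then obtain z where "N u - {v} = {z}" by (rule card_1_singletonE)
    then show ?thesis using that by blast
  qed
  have determined: "N u = {v, z}" if "u \<in> X" "v \<in> N u" "z \<in> N u" "v \<noteq> z" for u v z
    using other[OF that(1,2)] that(3,4) by auto
  have bNa: "b \<in> N a" using ab by (auto simp: N_def)
  then have aNb: "a \<in> N b" using symN ab by blast
  obtain e where e: "e \<noteq> b" "N a = {b, e}" using other[OF ab(1) bNa] by blast
  obtain c where c: "c \<noteq> a" "N b = {a, c}" using other[OF ab(2) aNb] by blast
  have X': "e \<in> X" "c \<in> X" using NX e c by blast+
  have ne: "a \<noteq> b" "a \<noteq> e" "b \<noteq> c" using nN[OF ab(1)] nN[OF ab(2)] bNa e c by auto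
  have aNe: "a \<in> N e" and bNc: "b \<in> N c" using symN[of a e] symN[of b c] ab X' e c by auto
  \<comment> \<open>Otherwise \<open>a\<close>, \<open>b\<close>, \<open>c\<close> form a triangle,
    and each of the remaining two vertices has at most the other one as a neighbour.\<close>
  have "c \<noteq> e"
  proof
    assume ce: "c = e"
    have Nc: "N c = {a, b}" using determined[OF X'(2), of a b] aNe bNc ce ne by auto
    have "card (X - {a, b, c}) = 2" using X ab X' ne c(1) by (simp add: card_Diff_subset)
    then obtain s t where st: "X - {a, b, c} = {s, t}" "s \<noteq> t" by (auto simp: card_2_iff)
    then have sX: "s \<in> X" "s \<noteq> a" "s \<noteq> b" "s \<noteq> c" "X = {a, b, c, s, t}" using ab X' by auto
    have "a \<notin> N s" "b \<notin> N s" "c \<notin> N s"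
      using symN[of a s] symN[of b s] symN[of c s] ab X' sX e c Nc ce by auto
    then have "N s \<subseteq> {t}" using NX[of s] nN[OF sX(1)] sX(5) by auto
    then show False using cN[OF sX(1)] card_mono[of "{t}" "N s"] by simp
  qed
  then have "card (X - {a, b, c, e}) = 1" using X ab X' ne e(1) c(1) by (simp add: card_Diff_subset)
  then obtain d where d: "X - {a, b, c, e} = {d}" by (rule card_1_singletonE)
  then have dX: "d \<in> X" "d \<noteq> a" "d \<noteq> b" "d \<noteq> c" "d \<noteq> e" "X = {a, b, c, d, e}" using ab X' by auto
  have "a \<notin> N d" "b \<notin> N d"
    using symN[of a d] symN[of b d] ab dX e c by auto
  then have "N d \<subseteq> {c, e}" using NX[of d] nN[OF dX(1)] dX(6) by auto
  then have Nd: "N d = {c, e}"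
    using cN[OF dX(1)] \<open>c \<noteq> e\<close> by (intro card_subset_eq) auto
  have Nc: "N c = {b, d}" using determined[OF X'(2) bNc, of d] symN[OF dX(1) X'(2)] Nd dX by auto
  have Ne: "N e = {a, d}" using determined[OF X'(1) aNe, of d] symN[OF dX(1) X'(1)] Nd dX by auto
  let ?l = "[a, b, c, d, e]"
  have dist: "distinct ?l" using dX ne e(1) c(1) \<open>c \<noteq> e\<close> by auto
  have "bij_betw ((!) ?l) {..<5} X"
    by (rule bij_betw_nth[OF dist]) (use dX in auto)
  moreover have "\<forall>i<5. \<forall>j<5. w (?l ! i) (?l ! j) = of_bool (cycle5 i j)"
    unfolding all_less_5 using dist ab(1,2) X' dX(1)
    by (auto simp: wN e(2) c(2) Nc Nd Ne cycle5_def)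
  ultimately show thesis using that by simp
qed

text \<open>A proper 3-edge-colouring of the 5-cycle 0, 1, 2, 3, 4, each colour being an involution
  that fixes the vertices it misses. Colour 0 is the single edge 01, colour 1 misses only 0 and
  colour 2 only 1: the colour missing at a vertex depends only on which vertices bear the labels 0
  and 1.\<close>

definition prism_colour :: "nat \<Rightarrow> nat \<Rightarrow> nat" where
  "prism_colour i k = [[1, 0, 2, 3, 4], [0, 2, 1, 4, 3], [4, 1, 3, 2, 0]] ! i ! k"

lemma less_3_cases:
  assumes "i < (3 :: nat)"
  obtains "i = 0" | "i = 1" | "i = 2"
  using assms by linarith

lemma prism_colour:
  assumes "i < 3" "k < 5"
  shows "prism_colour i k < 5" "prism_colour i (prism_colour i k) = k"
    "prism_colour i k = k \<longleftrightarrow> (if i = 0 then 2 \<le> k else if i = 1 then k = 0 else k = 1)"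
  using assms(1)
  by (cases rule: less_3_cases; use assms(2) in \<open>cases rule: less_5_cases; simp add: prism_colour_def\<close>)+

lemma prism_colour_count:
  assumes "k < 5" "l < 5" "k \<noteq> l"
  shows "(\<Sum>i<3. of_bool (prism_colour i k = l)) = (of_bool (cycle5 k l) :: nat)"
proof -
  have *: "(\<Sum>i<3. g i) = g 0 + g 1 + (g 2 :: nat)" for g :: "nat \<Rightarrow> nat"
    by (simp add: numeral_eq_Suc)
  show ?thesis
    unfolding * using assms(1)
    by (cases rule: less_5_cases; use assms(2,3) in \<open>cases rule: less_5_cases; simp add: prism_colour_def cycle5_def\<close>)
qed

text \<open>Both 5-cycles are coloured by \<open>prism_colour\<close>, starting at the common edge
  from \<open>a\<close> to \<open>b\<close>. Then the same colour is missing at \<open>u\<close> and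
  \<open>f u\<close>, however the cycles continue, and the edge joining them receives it.\<close>

lemma shared_edge_decomposable:
  assumes wg: "wgraph V w" and f: "perfect_matching V f"
    and X: "finite X" "card X = 5" "V = X \<union> f ` X" "\<And>u. u \<in> X \<Longrightarrow> f u \<notin> X"
    and cross: "\<And>u v. u \<in> X \<Longrightarrow> v \<in> X \<Longrightarrow> w u (f v) = of_bool (u = v)"
    and X1: "\<And>u v. u \<in> X \<Longrightarrow> v \<in> X \<Longrightarrow> w u v \<le> 1" "\<And>u. u \<in> X \<Longrightarrow> (\<Sum>v\<in>X. w u v) = 2"
    and X2: "\<And>u v. u \<in> X \<Longrightarrow> v \<in> X \<Longrightarrow> w (f u) (f v) \<le> 1"
      "\<And>u. u \<in> X \<Longrightarrow> (\<Sum>v\<in>X. w (f u) (f v)) = 2"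
    and ab: "a \<in> X" "b \<in> X" "w a b = 1" "w (f a) (f b) = 1"
  shows "decomposable V w"
proof -
  have XV: "u \<in> V" "f u \<in> V" "f (f u) = u" if "u \<in> X" for u
    using that X(3) f by (auto simp: perfect_matching_def)
  have sym: "w u v = w v u" if "u \<in> V" "v \<in> V" for u v using wgraphD(3)[OF wg that] .
  have w0: "w u u = 0" "w (f u) (f u) = 0" if "u \<in> X" for u
    using wgraphD(2)[OF wg] XV that by auto
  have symX: "w u v = w v u" "w (f u) (f v) = w (f v) (f u)" if "u \<in> X" "v \<in> X" for u v
    using sym XV(1,2) that by blast+
  obtain p where p: "bij_betw p {..<5} X" "p 0 = a" "p 1 = b"
    "\<And>i j. i < 5 \<Longrightarrow> j < 5 \<Longrightarrow> w (p i) (p j) = of_bool (cycle5 i j)"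
    by (rule five_cycle[OF X(1,2), of w, OF w0(1) symX(1) X1 ab(1-3)]) (assumption | rule that)+
  obtain q where q: "bij_betw q {..<5} X" "q 0 = a" "q 1 = b"
    "\<And>i j. i < 5 \<Longrightarrow> j < 5 \<Longrightarrow> w (f (q i)) (f (q j)) = of_bool (cycle5 i j)"
    by (rule five_cycle[OF X(1,2), of "\<lambda>u v. w (f u) (f v)", OF w0(2) symX(2) X2 ab(1,2,4)]) (assumption | rule that)+
  define g where "g s i u = s (prism_colour i (inv_into {..<5} s u))" for s :: "nat \<Rightarrow> 'a" and i u
  have g: "g s i u \<in> X" "g s i (g s i u) = u"
      "g s i u = u \<longleftrightarrow> (if i = 0 then u \<noteq> a \<and> u \<noteq> b else if i = 1 then u = a else u = b)"
      "\<And>v. v \<in> X \<Longrightarrow> u \<noteq> v \<Longrightarrow> W u v = (\<Sum>i<3. of_bool (g s i u = v))"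
    if s: "bij_betw s {..<5} X" "s 0 = a" "s 1 = b"
      "\<And>i j. i < 5 \<Longrightarrow> j < 5 \<Longrightarrow> W (s i) (s j) = of_bool (cycle5 i j)"
      and i: "i < 3" and u: "u \<in> X" for s and W :: "'a \<Rightarrow> 'a \<Rightarrow> nat" and i u
  proof -
    have inj: "inj_on s {..<5}" and sX: "\<And>k. k < 5 \<Longrightarrow> s k \<in> X" using s(1) by (auto simp: bij_betw_def)
    have gs: "g s j (s k) = s (prism_colour j k)" if "k < 5" for j k
      using inj that by (simp add: g_def)
    have seq: "s k = s l \<longleftrightarrow> k = l" if "k < 5" "l < 5" for k l
      using inj that by (auto simp: inj_on_def)
    obtain k where k: "k < 5" "u = s k" using s(1) u by (auto simp: bij_betw_def)
    note pc = prism_colour[OF i k(1)]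
    show "g s i u \<in> X" "g s i (g s i u) = u" using k pc gs sX by simp_all
    have "u = a \<longleftrightarrow> k = 0" "u = b \<longleftrightarrow> k = 1" using seq[OF k(1), of 0] seq[OF k(1), of 1] k s by auto
    then show "g s i u = u \<longleftrightarrow> (if i = 0 then u \<noteq> a \<and> u \<noteq> b else if i = 1 then u = a else u = b)"
      using k pc gs seq by auto
    fix v assume v: "v \<in> X" "u \<noteq> v"
    obtain l where l: "l < 5" "v = s l" using s(1) v by (auto simp: bij_betw_def)
    have "(\<Sum>i<3. of_bool (g s i u = v)) = (\<Sum>i<3. of_bool (prism_colour i k = l) :: nat)"
      using k l gs seq prism_colour(1)[OF _ k(1)] by (intro sum.cong) auto
    moreover have "k \<noteq> l" using k l v by auto
    ultimately show "W u v = (\<Sum>i<3. of_bool (g s i u = v))"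
      using prism_colour_count[OF k(1) l(1)] s(4)[OF k(1) l(1)] k(2) l(2) by metis
  qed
  have gp: "g p i u \<in> X" "g p i (g p i u) = u"
      "g p i u = u \<longleftrightarrow> (if i = 0 then u \<noteq> a \<and> u \<noteq> b else if i = 1 then u = a else u = b)"
      "\<And>v. v \<in> X \<Longrightarrow> u \<noteq> v \<Longrightarrow> w u v = (\<Sum>i<3. of_bool (g p i u = v))"
    if "i < 3" "u \<in> X" for i u
    by (rule g[of p w, OF p that]; assumption)+
  have gq: "g q i u \<in> X" "g q i (g q i u) = u"
      "g q i u = u \<longleftrightarrow> (if i = 0 then u \<noteq> a \<and> u \<noteq> b else if i = 1 then u = a else u = b)"
      "\<And>v. v \<in> X \<Longrightarrow> u \<noteq> v \<Longrightarrow> w (f u) (f v) = (\<Sum>i<3. of_bool (g q i u = v))"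
    if "i < 3" "u \<in> X" for i u
    by (rule g[of q "\<lambda>u v. w (f u) (f v)", OF q that]; assumption)+
  have fixed: "g p i u = u \<longleftrightarrow> g q i u = u" if "i < 3" "u \<in> X" for i u
    using gp(3)[OF that] gq(3)[OF that] by auto
  have one: "(\<Sum>i<3. of_bool (g p i u = u)) = (1 :: nat)" if "u \<in> X" for u
  proof -
    have "a \<noteq> b" using ab(3) wgraphD(2)[OF wg, of a] XV[OF ab(1)] by auto
    moreover have "(\<Sum>i<3. of_bool (g p i u = u)) =
        of_bool (g p 0 u = u) + of_bool (g p 1 u = u) + (of_bool (g p 2 u = u) :: nat)"
      by (simp add: numeral_eq_Suc)
    ultimately show ?thesis
      using gp(3)[OF _ that, of 0] gp(3)[OF _ that, of 1] gp(3)[OF _ that, of 2] by auto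
  qed
  \<comment> \<open>Fixed points of a colour on the cycles become ends of edges of
    \<open>f\<close>.\<close>
  define F where "F i u = (if u \<in> X then if g p i u = u then f u else g p i u
     else if g q i (f u) = f u then f u else f (g q i (f u)))" for i u
  have Fx: "F i u = (if g p i u = u then f u else g p i u)"
    and Fy: "F i (f u) = (if g p i u = u then u else f (g q i u))" if "i < 3" "u \<in> X" for i u
    using that X(4)[OF that(2)] XV(3)[OF that(2)] fixed[OF that] by (simp_all add: F_def)
  have finj: "f u = f v \<longleftrightarrow> u = v" if "u \<in> X" "v \<in> X" for u v using XV(3) that by metis
  have fne: "f u \<noteq> v" if "u \<in> X" "v \<in> X" for u v using X(4) that by metis
  have "perfect_matching V (F i)" if i: "i < 3" for i
    unfolding perfect_matching_def
  proof
    fix z assume "z \<in> V"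
    then obtain u where u: "u \<in> X" "z = u \<or> z = f u" using X(3) by auto
    note a = gp(1,2)[OF i u(1)] gq(1,2)[OF i u(1)]
    show "F i z \<in> V \<and> F i z \<noteq> z \<and> F i (F i z) = z"
    proof (cases "g p i u = u")
      case True
      then show ?thesis using u i XV[OF u(1)] fne[OF u(1) u(1)] Fx[OF i u(1)] Fy[OF i u(1)] by auto
    next
      case False
      then have "g p i (g p i u) \<noteq> g p i u" "g q i u \<noteq> u" "g p i (g q i u) \<noteq> g q i u"
        using a fixed[OF i] u(1) by metis+
      then show ?thesis
        using False u a XV fne finj Fx[OF i] Fy[OF i] by auto
    qed
  qed
  moreover have "w y z = card {i\<in>{..<3}. F i y = z}" if yz: "y \<in> V" "z \<in> V" for y z
  proof -
    have c: "card {i\<in>{..<3}. F i y = z} = (\<Sum>i<3. of_bool (F i y = z))" for y z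
      by (rule card_filter_eq_sum) simp
    have cross': "w u (f v) = (\<Sum>i<3. of_bool (F i u = f v))" if "u \<in> X" "v \<in> X" for u v
    proof -
      have "(\<Sum>i<3. of_bool (F i u = f v)) = (\<Sum>i<3. of_bool (g p i u = u) * (of_bool (u = v) :: nat))"
      proof (rule sum.cong[OF refl])
        fix i :: nat assume "i \<in> {..<3}"
        then show "of_bool (F i u = f v) = of_bool (g p i u = u) * (of_bool (u = v) :: nat)"
          using that gp(1)[of i u] Fx[of i u] finj[of u v] fne[of v "g p i u"] by auto
      qed
      then show ?thesis using one[OF that(1)] cross[OF that] by (simp add: sum_distrib_right[symmetric])
    qed
    have cross'': "w (f u) v = (\<Sum>i<3. of_bool (F i (f u) = v))" if "u \<in> X" "v \<in> X" for u v
    proof -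
      have "(\<Sum>i<3. of_bool (F i (f u) = v)) = (\<Sum>i<3. of_bool (g p i u = u) * (of_bool (u = v) :: nat))"
      proof (rule sum.cong[OF refl])
        fix i :: nat assume "i \<in> {..<3}"
        then show "of_bool (F i (f u) = v) = of_bool (g p i u = u) * (of_bool (u = v) :: nat)"
          using that gq(1)[of i u] Fy[of i u] fne[of "g q i u" v] by auto
      qed
      then show ?thesis
        using one[OF that(1)] cross[OF that(2,1)] sym[of "f u" v] XV that
        by (auto simp: sum_distrib_right[symmetric])
    qed
    obtain u v where u: "u \<in> X" "y = u \<or> y = f u" and v: "v \<in> X" "z = v \<or> z = f v"
      using yz X(3) by auto
    consider "y = u" "z = f v" | "y = f u" "z = v" | "y = u" "z = v" | "y = f u" "z = f v"
      using u v by blast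
    then show ?thesis
    proof cases
      case 3
      show ?thesis
      proof (cases "u = v")
        case True
        then show ?thesis
          using wgraphD(2)[OF wg yz(1)] \<open>\<And>i. i < 3 \<Longrightarrow> perfect_matching V (F i)\<close> yz 3
          by (auto simp: perfect_matching_def)
      next
        case False
        have "(\<Sum>i<3. of_bool (F i u = v)) = (\<Sum>i<3. of_bool (g p i u = v) :: nat)"
          using u v False Fx fne by (intro sum.cong) auto
        then show ?thesis using gp(4)[of 0 u v] u v False 3 c by auto
      qed
    next
      case 4
      show ?thesis
      proof (cases "u = v")
        case True
        then show ?thesis
          using wgraphD(2)[OF wg yz(1)] \<open>\<And>i. i < 3 \<Longrightarrow> perfect_matching V (F i)\<close> yz 4
          by (auto simp: perfect_matching_def)
      next
        case False
        have "(\<Sum>i<3. of_bool (F i (f u) = f v)) = (\<Sum>i<3. of_bool (g q i u = v) :: nat)"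
        proof (rule sum.cong[OF refl])
          fix i :: nat assume "i \<in> {..<3}"
          then show "of_bool (F i (f u) = f v) = (of_bool (g q i u = v) :: nat)"
            using u(1) v(1) False Fy[of i u] fne[of v u] finj[of "g q i u" v] gq(1)[of i u] fixed[of i u]
            by auto
        qed
        then show ?thesis using gq(4)[of 0 u v] u v False 4 c by auto
      qed
    qed (use cross' cross'' u v c in auto)
  qed
  ultimately have "colouring V w {..<3 :: nat} F" unfolding colouring_def by blast
  then show ?thesis by (rule colouring_decomposable)
qed

section \<open>The Petersen graph\<close>

text \<open>The vertices \<open>0,\<dots>,4\<close> and \<open>5,\<dots>,9\<close> are the outer and the inner cycle of the Petersen graph; row \<open>5\<close>
  consists of the spokes, row \<open>i < 5\<close> is the other perfect matching containing the spoke at \<open>i\<close>.\<close>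

definition petersen_matching :: "nat \<Rightarrow> nat \<Rightarrow> nat" where
  "petersen_matching i u =
    [[5, 2, 1, 4, 3, 0, 8, 9, 6, 7], [4, 6, 3, 2, 0, 8, 1, 9, 5, 7], [1, 0, 7, 4, 3, 8, 9, 2, 5, 6],
     [4, 2, 1, 8, 0, 7, 9, 5, 3, 6], [1, 0, 3, 2, 9, 7, 8, 5, 6, 4], [5, 6, 7, 8, 9, 0, 1, 2, 3, 4]] ! i ! u"

text \<open>The six matchings cover every edge of the Petersen graph twice; the indicator counts it
  once.\<close>

definition petersen :: "nat \<Rightarrow> nat \<Rightarrow> nat" where
  "petersen u v = of_bool (\<exists>i<6. petersen_matching i u = v)"

text \<open>One of the two 5-cycles that remain when the \<open>i\<close>-th perfect matching is removed.\<close>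

definition petersen_side :: "nat \<Rightarrow> nat list" where
  "petersen_side i = [[0, 1, 4, 6, 9], [0, 1, 2, 5, 7], [0, 4, 5, 7, 9],
     [0, 1, 5, 6, 8], [0, 3, 4, 5, 8], [0, 1, 2, 3, 4]] ! i"

lemma all_less_6: "(\<forall>i<6. P i) \<longleftrightarrow> P 0 \<and> P 1 \<and> P 2 \<and> P 3 \<and> P 4 \<and> P (5 :: nat)"
  by (simp add: numeral_eq_Suc All_less_Suc conj_ac)

lemma all_less_10: "(\<forall>i<10. P i) \<longleftrightarrow> P 0 \<and> P 1 \<and> P 2 \<and> P 3 \<and> P 4 \<and> P 5 \<and> P 6 \<and> P 7 \<and> P 8 \<and> P (9 :: nat)"
  by (simp add: numeral_eq_Suc All_less_Suc conj_ac)

lemma ex_less_6: "(\<exists>i<6. P i) \<longleftrightarrow> P 0 \<or> P 1 \<or> P 2 \<or> P 3 \<or> P 4 \<or> P (5 :: nat)"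
  by (simp add: numeral_eq_Suc Ex_less_Suc disj_ac)

lemma petersen_matching_perfect: "i < 6 \<Longrightarrow> perfect_matching {..<10} (petersen_matching i)"
proof -
  have "\<forall>i<6. \<forall>u<10. petersen_matching i u < 10 \<and> petersen_matching i u \<noteq> u \<and>
      petersen_matching i (petersen_matching i u) = u"
    unfolding all_less_6 all_less_10 by (simp add: petersen_matching_def)
  then show "i < 6 \<Longrightarrow> perfect_matching {..<10} (petersen_matching i)"
    by (simp add: perfect_matching_def)
qed

text \<open>The existential quantifier is evaluated once; later finite checks rewrite with the
  table.\<close>

lemma petersen_table:
  assumes "u < 10" "v < 10"
  shows "petersen u v = [[0, 1, 0, 0, 1, 1, 0, 0, 0, 0],
      [1, 0, 1, 0, 0, 0, 1, 0, 0, 0],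
      [0, 1, 0, 1, 0, 0, 0, 1, 0, 0],
      [0, 0, 1, 0, 1, 0, 0, 0, 1, 0],
      [1, 0, 0, 1, 0, 0, 0, 0, 0, 1],
      [1, 0, 0, 0, 0, 0, 0, 1, 1, 0],
      [0, 1, 0, 0, 0, 0, 0, 0, 1, 1],
      [0, 0, 1, 0, 0, 1, 0, 0, 0, 1],
      [0, 0, 0, 1, 0, 1, 1, 0, 0, 0],
      [0, 0, 0, 0, 1, 0, 1, 1, 0, 0]] ! u ! v"
proof -
  have "\<forall>u<10. \<forall>v<10. petersen u v = [[0, 1, 0, 0, 1, 1, 0, 0, 0, 0],
      [1, 0, 1, 0, 0, 0, 1, 0, 0, 0],
      [0, 1, 0, 1, 0, 0, 0, 1, 0, 0],
      [0, 0, 1, 0, 1, 0, 0, 0, 1, 0],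
      [1, 0, 0, 1, 0, 0, 0, 0, 0, 1],
      [1, 0, 0, 0, 0, 0, 0, 1, 1, 0],
      [0, 1, 0, 0, 0, 0, 0, 0, 1, 1],
      [0, 0, 1, 0, 0, 1, 0, 0, 0, 1],
      [0, 0, 0, 1, 0, 1, 1, 0, 0, 0],
      [0, 0, 0, 0, 1, 0, 1, 1, 0, 0]] ! u ! v"
    unfolding all_less_10 petersen_def ex_less_6 by (simp add: petersen_matching_def)
  then show ?thesis using assms by blast
qed

lemma petersen_symmetric: "\<forall>u<10. \<forall>v<10. petersen u v = petersen v u \<and> petersen u u = 0"
  unfolding all_less_10 by (simp add: petersen_table)

text \<open>The inner cycle is the complement of the outer one. In this form the graph is recognised
  in \<open>cubic_order_10\<close>.\<close>

lemma petersen_blocks: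
  "\<forall>i<5. \<forall>j<5. petersen i j = of_bool (cycle5 i j) \<and> petersen i (j + 5) = of_bool (i = j) \<and>
     petersen (i + 5) j = of_bool (i = j) \<and> petersen (i + 5) (j + 5) = of_bool (i \<noteq> j \<and> \<not> cycle5 i j)"
  unfolding all_less_5 petersen_def ex_less_6 by (simp add: petersen_matching_def cycle5_def)

text \<open>This matches the 15 pairs of matchings with the 15 edges and makes edge multiplicities
  readable as sums over pairs.\<close>

lemma petersen_matchings_meet_once:
  assumes "i < 6" "j < 6" "i \<noteq> j"
  shows "\<exists>u<10. \<forall>k<6. petersen_matching k u = petersen_matching i u \<longleftrightarrow> k = i \<or> k = j"
proof -
  \<comment> \<open>The entry at i, j is an end of the edge common to the matchings i and j; the
    diagonal is a filler.\<close>
  let ?e = "\<lambda>i j. [[0, 7, 3, 1, 6, 0], [7, 0, 5, 0, 2, 1], [3, 5, 0, 6, 0, 2],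
    [1, 0, 6, 0, 5, 3], [6, 2, 0, 5, 0, 4], [0, 1, 2, 3, 4, 0]] ! i ! j :: nat"
  have "\<forall>i<6. \<forall>j<6. ?e i j < 10 \<and> (i \<noteq> j \<longrightarrow> (\<forall>k<6.
      petersen_matching k (?e i j) = petersen_matching i (?e i j) \<longleftrightarrow> k = i \<or> k = j))"
    unfolding all_less_6 by (simp add: petersen_matching_def)
  then show ?thesis using assms by (intro exI[of _ "?e i j"]) blast
qed

text \<open>The input of the averaging argument: any edge of the complete graph, not only one of the
  Petersen graph, crosses at least two of the six cuts.\<close>

lemma petersen_separated_twice:
  "\<forall>u<10. \<forall>v<10. u \<noteq> v \<longrightarrow>
    2 \<le> (\<Sum>i<6. of_bool ((u \<in> set (petersen_side i)) \<noteq> (v \<in> set (petersen_side i))) :: nat)"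
proof -
  have *: "(\<Sum>i<6. g i) = g 0 + g 1 + g 2 + g 3 + g 4 + (g 5 :: nat)" for g :: "nat \<Rightarrow> nat"
    by (simp add: numeral_eq_Suc)
  show ?thesis unfolding * all_less_10 by (simp add: petersen_side_def)
qed

text \<open>The matchings that join the two cycles along a nontrivial rotation or a reflection, each with four
  perfect matchings whose sum is the Petersen graph plus this matching.\<close>

definition twisted_spokes :: "(nat list \<times> nat list list) list" where
  "twisted_spokes =
    [([6, 7, 8, 9, 5, 4, 0, 1, 2, 3],
      [[1, 0, 3, 2, 5, 4, 8, 9, 6, 7], [4, 6, 7, 9, 0, 8, 1, 2, 5, 3], [5, 7, 8, 4, 3, 0, 9, 1, 2, 6], [6, 2, 1, 8, 9, 7, 0, 5, 3, 4]]),
     ([7, 8, 9, 5, 6, 3, 4, 0, 1, 2],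
      [[1, 0, 3, 2, 6, 8, 4, 9, 5, 7], [4, 6, 9, 8, 0, 7, 1, 5, 3, 2], [5, 8, 7, 4, 3, 0, 9, 2, 1, 6], [7, 2, 1, 5, 9, 3, 8, 0, 6, 4]]),
     ([8, 9, 5, 6, 7, 2, 3, 4, 0, 1],
      [[1, 0, 3, 2, 7, 8, 9, 4, 5, 6], [4, 6, 5, 8, 0, 2, 1, 9, 3, 7], [5, 9, 7, 4, 3, 0, 8, 2, 6, 1], [8, 2, 1, 6, 9, 7, 3, 5, 0, 4]]),
     ([9, 5, 6, 7, 8, 1, 2, 3, 4, 0],
      [[1, 0, 3, 2, 8, 7, 9, 5, 4, 6], [4, 5, 6, 8, 0, 1, 2, 9, 3, 7], [5, 2, 1, 7, 9, 0, 8, 3, 6, 4], [9, 6, 7, 4, 3, 8, 1, 2, 5, 0]]),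
     ([5, 9, 8, 7, 6, 0, 4, 3, 2, 1],
      [[1, 0, 3, 2, 6, 8, 4, 9, 5, 7], [4, 2, 1, 8, 0, 7, 9, 5, 3, 6], [5, 6, 8, 7, 9, 0, 1, 3, 2, 4], [5, 9, 7, 4, 3, 0, 8, 2, 6, 1]]),
     ([6, 5, 9, 8, 7, 1, 0, 4, 3, 2],
      [[1, 0, 3, 2, 7, 8, 9, 4, 5, 6], [4, 6, 9, 8, 0, 7, 1, 5, 3, 2], [5, 2, 1, 4, 3, 0, 8, 9, 6, 7], [6, 5, 7, 8, 9, 1, 0, 2, 3, 4]]),
     ([7, 6, 5, 9, 8, 2, 1, 0, 4, 3],
      [[1, 0, 3, 2, 8, 7, 9, 5, 4, 6], [4, 6, 7, 9, 0, 8, 1, 2, 5, 3], [5, 2, 1, 4, 3, 0, 8, 9, 6, 7], [7, 6, 5, 8, 9, 2, 1, 0, 3, 4]]),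
     ([8, 7, 6, 5, 9, 3, 2, 1, 0, 4],
      [[1, 0, 6, 4, 3, 8, 2, 9, 5, 7], [4, 2, 1, 8, 0, 7, 9, 5, 3, 6], [5, 7, 3, 2, 9, 0, 8, 1, 6, 4], [8, 6, 7, 5, 9, 3, 1, 2, 0, 4]]),
     ([9, 8, 7, 6, 5, 4, 3, 2, 1, 0],
      [[1, 0, 3, 2, 5, 4, 8, 9, 6, 7], [4, 2, 1, 8, 0, 7, 9, 5, 3, 6], [5, 8, 7, 6, 9, 0, 3, 2, 1, 4], [9, 6, 7, 4, 3, 8, 1, 2, 5, 0]])]"

lemma twisted_spokes_matchings:
  "\<forall>(L, Fs) \<in> set twisted_spokes. \<forall>F \<in> set Fs. \<forall>u<10. F ! u < 10 \<and> F ! u \<noteq> u \<and> F ! (F ! u) = u"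
  unfolding all_less_10 by (simp add: twisted_spokes_def)

lemma twisted_spokes_sum:
  "\<forall>(L, Fs) \<in> set twisted_spokes. \<forall>u<10. \<forall>v<10.
    petersen u v + of_bool (L ! u = v) = length (filter (\<lambda>F. F ! u = v) Fs)"
  unfolding all_less_10 by (simp add: twisted_spokes_def petersen_table)

text \<open>Row \<open>i\<close> is an automorphism that maps the \<open>i\<close>-th perfect matching to the spokes.\<close>

definition petersen_turn :: "nat \<Rightarrow> nat \<Rightarrow> nat" where
  "petersen_turn i u =
    [[0, 1, 6, 9, 4, 5, 2, 8, 7, 3], [0, 1, 2, 7, 5, 4, 6, 3, 9, 8], [0, 5, 7, 9, 4, 1, 8, 2, 6, 3],
     [0, 1, 6, 8, 5, 4, 2, 9, 3, 7], [0, 5, 7, 2, 1, 4, 8, 9, 3, 6], [0, 1, 2, 3, 4, 5, 6, 7, 8, 9]] ! i ! u"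

lemma petersen_turn:
  assumes "i < 6"
  shows "bij_betw (petersen_turn i) {..<10} {..<10}"
    "u < 10 \<Longrightarrow> petersen_turn i (petersen_matching i u) = petersen_matching 5 (petersen_turn i u)"
    "u < 10 \<Longrightarrow> v < 10 \<Longrightarrow> petersen (petersen_turn i u) (petersen_turn i v) = petersen u v"
    "u < 10 \<Longrightarrow> u \<in> set (petersen_side i) \<longleftrightarrow> petersen_turn i u < 5"
proof -
  have d: "\<forall>i<6. distinct (map (petersen_turn i) [0..<10]) \<and> (\<forall>u<10. petersen_turn i u < 10)"
    unfolding all_less_6 all_less_10 by (simp add: petersen_turn_def upt_rec)
  then have "inj_on (petersen_turn i) {..<10}" "petersen_turn i ` {..<10} \<subseteq> {..<10}"
    using assms by (auto simp: distinct_map atLeast0LessThan)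
  then show "bij_betw (petersen_turn i) {..<10} {..<10}"
    by (simp add: bij_betw_def endo_inj_surj)
  have "\<forall>i<6. \<forall>u<10. petersen_turn i (petersen_matching i u) = petersen_matching 5 (petersen_turn i u)"
    unfolding all_less_6 all_less_10 by (simp add: petersen_turn_def petersen_matching_def)
  then show "u < 10 \<Longrightarrow> petersen_turn i (petersen_matching i u) = petersen_matching 5 (petersen_turn i u)"
    using assms by blast
  have "\<forall>i<6. \<forall>u<10. u \<in> set (petersen_side i) \<longleftrightarrow> petersen_turn i u < 5"
    unfolding all_less_6 all_less_10 by (simp add: petersen_turn_def petersen_side_def)
  then show "u < 10 \<Longrightarrow> u \<in> set (petersen_side i) \<longleftrightarrow> petersen_turn i u < 5"
    using assms by blast
  have "\<forall>i<6. \<forall>u<10. \<forall>v<10. petersen (petersen_turn i u) (petersen_turn i v) = petersen u v"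
    unfolding all_less_6 all_less_10 by (simp add: petersen_turn_def petersen_table)
  then show "u < 10 \<Longrightarrow> v < 10 \<Longrightarrow> petersen (petersen_turn i u) (petersen_turn i v) = petersen u v"
    using assms by blast
qed

text \<open>Every vertex has three possible partners, so the claim is propositional in the 30 atoms
  \<open>f u = v\<close>, given existence, symmetry and uniqueness of partners.\<close>

lemma petersen_perfect_matching:
  assumes f: "perfect_matching {..<10} f" and P: "\<And>u. u < 10 \<Longrightarrow> petersen u (f u) = 1"
  shows "\<exists>i<6. \<forall>u<10. f u = petersen_matching i u"
proof -
  have n: "f u = petersen_matching 0 u \<or> f u = petersen_matching 1 u \<or> f u = petersen_matching 2 u \<or>
      f u = petersen_matching 3 u \<or> f u = petersen_matching 4 u \<or> f u = petersen_matching 5 u" if "u < 10" for u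
  proof -
    have "\<exists>i<6. petersen_matching i u = f u" using P[OF that] by (simp only: petersen_def of_bool_eq_1_iff)
    then show ?thesis unfolding ex_less_6 by metis
  qed
  have inv: "f (f u) = u" if "u < 10" for u
    using f that by (auto simp: perfect_matching_def)
  have n0: "f 0 = 1 \<or> f 0 = 4 \<or> f 0 = 5"
    using n[of 0] by (auto simp: petersen_matching_def)
  have n1: "f 1 = 0 \<or> f 1 = 2 \<or> f 1 = 6"
    using n[of 1] by (auto simp: petersen_matching_def)
  have n2: "f 2 = 1 \<or> f 2 = 3 \<or> f 2 = 7"
    using n[of 2] by (auto simp: petersen_matching_def)
  have n3: "f 3 = 2 \<or> f 3 = 4 \<or> f 3 = 8"
    using n[of 3] by (auto simp: petersen_matching_def)
  have n4: "f 4 = 0 \<or> f 4 = 3 \<or> f 4 = 9"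
    using n[of 4] by (auto simp: petersen_matching_def)
  have n5: "f 5 = 0 \<or> f 5 = 7 \<or> f 5 = 8"
    using n[of 5] by (auto simp: petersen_matching_def)
  have n6: "f 6 = 1 \<or> f 6 = 8 \<or> f 6 = 9"
    using n[of 6] by (auto simp: petersen_matching_def)
  have n7: "f 7 = 2 \<or> f 7 = 5 \<or> f 7 = 9"
    using n[of 7] by (auto simp: petersen_matching_def)
  have n8: "f 8 = 3 \<or> f 8 = 5 \<or> f 8 = 6"
    using n[of 8] by (auto simp: petersen_matching_def)
  have n9: "f 9 = 4 \<or> f 9 = 6 \<or> f 9 = 7"
    using n[of 9] by (auto simp: petersen_matching_def)
  have swap: "f u = v \<longleftrightarrow> f v = u" if "u < 10" "v < 10" for u v
    using inv that by metis
  have sym: "f 0 = 1 \<longleftrightarrow> f 1 = 0" "f 0 = 4 \<longleftrightarrow> f 4 = 0" "f 0 = 5 \<longleftrightarrow> f 5 = 0" "f 1 = 2 \<longleftrightarrow> f 2 = 1"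
    "f 1 = 6 \<longleftrightarrow> f 6 = 1" "f 2 = 3 \<longleftrightarrow> f 3 = 2" "f 2 = 7 \<longleftrightarrow> f 7 = 2" "f 3 = 4 \<longleftrightarrow> f 4 = 3"
    "f 3 = 8 \<longleftrightarrow> f 8 = 3" "f 4 = 9 \<longleftrightarrow> f 9 = 4" "f 5 = 7 \<longleftrightarrow> f 7 = 5" "f 5 = 8 \<longleftrightarrow> f 8 = 5"
    "f 6 = 8 \<longleftrightarrow> f 8 = 6" "f 6 = 9 \<longleftrightarrow> f 9 = 6" "f 7 = 9 \<longleftrightarrow> f 9 = 7"
    by (rule swap; simp)+
  have am: "\<not> (f 0 = 1 \<and> f 0 = 4)" "\<not> (f 0 = 1 \<and> f 0 = 5)" "\<not> (f 0 = 4 \<and> f 0 = 5)"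
    "\<not> (f 1 = 0 \<and> f 1 = 2)" "\<not> (f 1 = 0 \<and> f 1 = 6)" "\<not> (f 1 = 2 \<and> f 1 = 6)" "\<not> (f 2 = 1 \<and> f 2 = 3)"
    "\<not> (f 2 = 1 \<and> f 2 = 7)" "\<not> (f 2 = 3 \<and> f 2 = 7)" "\<not> (f 3 = 2 \<and> f 3 = 4)" "\<not> (f 3 = 2 \<and> f 3 = 8)"
    "\<not> (f 3 = 4 \<and> f 3 = 8)" "\<not> (f 4 = 0 \<and> f 4 = 3)" "\<not> (f 4 = 0 \<and> f 4 = 9)" "\<not> (f 4 = 3 \<and> f 4 = 9)"
    "\<not> (f 5 = 0 \<and> f 5 = 7)" "\<not> (f 5 = 0 \<and> f 5 = 8)" "\<not> (f 5 = 7 \<and> f 5 = 8)" "\<not> (f 6 = 1 \<and> f 6 = 8)"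
    "\<not> (f 6 = 1 \<and> f 6 = 9)" "\<not> (f 6 = 8 \<and> f 6 = 9)" "\<not> (f 7 = 2 \<and> f 7 = 5)" "\<not> (f 7 = 2 \<and> f 7 = 9)"
    "\<not> (f 7 = 5 \<and> f 7 = 9)" "\<not> (f 8 = 3 \<and> f 8 = 5)" "\<not> (f 8 = 3 \<and> f 8 = 6)" "\<not> (f 8 = 5 \<and> f 8 = 6)"
    "\<not> (f 9 = 4 \<and> f 9 = 6)" "\<not> (f 9 = 4 \<and> f 9 = 7)" "\<not> (f 9 = 6 \<and> f 9 = 7)"
    by auto
  show ?thesis
    unfolding ex_less_6 all_less_10
    using n0 n1 n2 n3 n4 n5 n6 n7 n8 n9 sym am
    by (simp add: petersen_matching_def, argo)
qed

text \<open>Going on along the cycle repeats the last step modulo 5, so the next vertex is 2 q - p;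
  the coefficient 4 stands for -1.\<close>

lemma cycle5_continue:
  assumes "p < 5" "q < 5" "r < 5" "cycle5 p q" "cycle5 q r" "p \<noteq> r"
  shows "r = (2 * q + 4 * p) mod 5"
proof -
  have "\<forall>p<5. \<forall>q<5. \<forall>r<5. cycle5 p q \<longrightarrow> cycle5 q r \<longrightarrow> p \<noteq> r \<longrightarrow> r = (2 * q + 4 * p) mod 5"
    unfolding all_less_5 by (simp add: cycle5_def)
  then show ?thesis using assms by blast
qed

text \<open>The images of 0 and 1 determine the others by going on along the cycle. The list has the
  five rotations, then the five reflections.\<close>

lemma cycle5_automorphism:
  assumes "\<And>i. i < 5 \<Longrightarrow> p i < 5" "inj_on p {..<5}"
    "\<And>i j. i < 5 \<Longrightarrow> j < 5 \<Longrightarrow> cycle5 i j \<Longrightarrow> cycle5 (p i) (p j)"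
  shows "[p 0, p 1, p 2, p 3, p 4] \<in> set [[0,1,2,3,4], [1,2,3,4,0], [2,3,4,0,1], [3,4,0,1,2], [4,0,1,2,3],
    [0,4,3,2,1], [1,0,4,3,2], [2,1,0,4,3], [3,2,1,0,4], [4,3,2,1,0]]"
proof -
  have l: "p 0 < 5" "p 1 < 5" "p 2 < 5" "p 3 < 5" "p 4 < 5" using assms(1) by simp_all
  have c: "cycle5 (p 0) (p 1)" "cycle5 (p 1) (p 2)" "cycle5 (p 2) (p 3)" "cycle5 (p 3) (p 4)"
    by (rule assms(3); simp add: cycle5_def)+
  have ne: "p 0 \<noteq> p 2" "p 1 \<noteq> p 3" "p 2 \<noteq> p 4"
    using inj_onD[OF assms(2), of 0 2] inj_onD[OF assms(2), of 1 3] inj_onD[OF assms(2), of 2 4] by auto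
  have p2: "p 2 = (2 * p 1 + 4 * p 0) mod 5" using cycle5_continue[OF l(1,2,3) c(1,2) ne(1)] .
  have p3: "p 3 = (2 * p 2 + 4 * p 1) mod 5" using cycle5_continue[OF l(2,3,4) c(2,3) ne(2)] .
  have p4: "p 4 = (2 * p 3 + 4 * p 2) mod 5" using cycle5_continue[OF l(3,4,5) c(3,4) ne(3)] .
  have "\<forall>a<5. \<forall>b<5. cycle5 a b \<longrightarrow> (let c = (2 * b + 4 * a) mod 5; d = (2 * c + 4 * b) mod 5;
      e = (2 * d + 4 * c) mod 5 in [a, b, c, d, e] \<in> set [[0,1,2,3,4], [1,2,3,4,0], [2,3,4,0,1],
    [3,4,0,1,2], [4,0,1,2,3], [0,4,3,2,1], [1,0,4,3,2], [2,1,0,4,3], [3,2,1,0,4], [4,3,2,1,0]])"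
    unfolding all_less_5 by (simp add: cycle5_def)
  then have "let c = (2 * p 1 + 4 * p 0) mod 5; d = (2 * c + 4 * p 1) mod 5;
      e = (2 * d + 4 * c) mod 5 in [p 0, p 1, c, d, e] \<in> set [[0,1,2,3,4], [1,2,3,4,0], [2,3,4,0,1],
    [3,4,0,1,2], [4,0,1,2,3], [0,4,3,2,1], [1,0,4,3,2], [2,1,0,4,3], [3,2,1,0,4], [4,3,2,1,0]]"
    using l(1,2) c(1) by blast
  then show ?thesis unfolding Let_def p2[symmetric] p3[symmetric] p4[symmetric] .
qed

section \<open>Classification on ten vertices\<close>

lemma sum_less_5: "(\<Sum>k<(5 :: nat). g k) = g 0 + g 1 + g 2 + g 3 + (g 4 :: nat)"
  by (simp add: numeral_eq_Suc)

lemma sum_less_6: "(\<Sum>k<(6 :: nat). g k) = g 0 + g 1 + g 2 + g 3 + g 4 + (g 5 :: nat)"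
  by (simp add: numeral_eq_Suc)

lemma decomposable_bij:
  assumes \<phi>: "bij_betw \<phi> V V'" and w: "\<And>u v. u \<in> V \<Longrightarrow> v \<in> V \<Longrightarrow> w' (\<phi> u) (\<phi> v) = w u v"
    and d: "decomposable V w"
  shows "decomposable V' w'"
proof -
  obtain I :: "nat set" and F where F: "colouring V w I F" using d unfolding decomposable_def by blast
  define \<psi> where "\<psi> = inv_into V \<phi>"
  have \<psi>: "\<psi> x \<in> V" "\<phi> (\<psi> x) = x" if "x \<in> V'" for x
    using \<phi> that unfolding \<psi>_def bij_betw_def by (auto simp: inv_into_into f_inv_into_f)
  have \<phi>': "\<phi> u \<in> V'" "\<psi> (\<phi> u) = u" if "u \<in> V" for u
    using \<phi> that unfolding \<psi>_def bij_betw_def by auto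
  have "colouring V' w' I (\<lambda>i x. \<phi> (F i (\<psi> x)))"
    unfolding colouring_def
  proof (intro conjI ballI)
    show "finite I" using F by (simp add: colouring_def)
    show "perfect_matching V' (\<lambda>x. \<phi> (F i (\<psi> x)))" if "i \<in> I" for i
      unfolding perfect_matching_def
    proof
      fix x assume x: "x \<in> V'"
      then have "F i (\<psi> x) \<in> V" "F i (\<psi> x) \<noteq> \<psi> x" "F i (F i (\<psi> x)) = \<psi> x"
        using F that \<psi>[OF x] by (auto simp: colouring_def perfect_matching_def)
      then show "\<phi> (F i (\<psi> x)) \<in> V' \<and> \<phi> (F i (\<psi> x)) \<noteq> x \<and> \<phi> (F i (\<psi> (\<phi> (F i (\<psi> x))))) = x"
        using \<phi>' \<psi>[OF x] by metis
    qed
    fix x y assume xy: "x \<in> V'" "y \<in> V'"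
    have "\<phi> (F i (\<psi> x)) = y \<longleftrightarrow> F i (\<psi> x) = \<psi> y" if "i \<in> I" for i
    proof -
      have "F i (\<psi> x) \<in> V" using F that \<psi>[OF xy(1)] by (auto simp: colouring_def perfect_matching_def)
      then show ?thesis using \<phi>' \<psi>[OF xy(2)] by metis
    qed
    then have "{i\<in>I. \<phi> (F i (\<psi> x)) = y} = {i\<in>I. F i (\<psi> x) = \<psi> y}" by blast
    moreover have "w' x y = w (\<psi> x) (\<psi> y)" using w[of "\<psi> x" "\<psi> y"] \<psi> xy by simp
    ultimately show "w' x y = card {i\<in>I. \<phi> (F i (\<psi> x)) = y}"
      using F \<psi> xy by (simp add: colouring_def)
  qed
  then show ?thesis by (rule colouring_decomposable)
qed

lemma perfect_matching_bij:
  assumes \<phi>: "bij_betw \<phi> U V" and f: "perfect_matching V f"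
  obtains g where "perfect_matching U g" "\<And>u. u \<in> U \<Longrightarrow> \<phi> (g u) = f (\<phi> u)"
    "\<And>u v. u \<in> U \<Longrightarrow> v \<in> U \<Longrightarrow> matching_weight f (\<phi> u) (\<phi> v) = matching_weight g u v"
proof -
  define \<psi> where "\<psi> = inv_into U \<phi>"
  have \<psi>: "\<psi> x \<in> U" "\<phi> (\<psi> x) = x" if "x \<in> V" for x
    using \<phi> that unfolding \<psi>_def bij_betw_def by (auto simp: inv_into_into f_inv_into_f)
  have \<phi>': "\<phi> u \<in> V" "\<psi> (\<phi> u) = u" if "u \<in> U" for u
    using \<phi> that unfolding \<psi>_def bij_betw_def by auto
  define g where "g u = \<psi> (f (\<phi> u))" for u
  have fV: "f x \<in> V" "f x \<noteq> x" "f (f x) = x" if "x \<in> V" for x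
    using f that by (auto simp: perfect_matching_def)
  have g: "g u \<in> U" "\<phi> (g u) = f (\<phi> u)" if "u \<in> U" for u
    using \<psi>[OF fV(1)[OF \<phi>'(1)[OF that]]] by (simp_all add: g_def)
  have "perfect_matching U g"
    unfolding perfect_matching_def
  proof
    fix u assume u: "u \<in> U"
    have "g u \<noteq> u" using g(2)[OF u] fV(2)[OF \<phi>'(1)[OF u]] by metis
    moreover have "g (g u) = u"
      using g(2)[OF u] fV(3)[OF \<phi>'(1)[OF u]] \<phi>'(2)[OF u] by (simp add: g_def)
    ultimately show "g u \<in> U \<and> g u \<noteq> u \<and> g (g u) = u" using g(1)[OF u] by blast
  qed
  moreover have "matching_weight f (\<phi> u) (\<phi> v) = matching_weight g u v" if "u \<in> U" "v \<in> U" for u v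
  proof -
    have "f (\<phi> u) = \<phi> v \<longleftrightarrow> g u = v" using g[OF that(1)] \<phi>'(2)[OF that(2)] \<phi>'(2)[OF g(1)[OF that(1)]] by metis
    then show ?thesis by (simp add: matching_weight_def)
  qed
  ultimately show thesis using that g(2) by blast
qed

lemma decomposable_add_multiples:
  assumes "finite I" "\<And>i. i \<in> I \<Longrightarrow> perfect_matching V (M i)" "decomposable V w"
  shows "decomposable V (\<lambda>u v. w u v + (\<Sum>i\<in>I. n i * matching_weight (M i) u v))"
  using assms(1,2)
proof (induction I rule: finite_induct)
  case (insert i I)
  have "decomposable V (\<lambda>u v. w u v + (\<Sum>i\<in>I. n i * matching_weight (M i) u v) + k * matching_weight (M i) u v)" for k
  proof (induction k)
    case 0
    then show ?case using insert by simp
  next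
    case (Suc k)
    from decomposable_add_matching[OF this, of "M i"] insert.prems show ?case
      by (simp add: algebra_simps)
  qed
  from this[of "n i"] show ?case using insert.hyps by (simp add: algebra_simps)
qed (use assms(3) in simp)

lemma decomposable_by_list:
  assumes "\<And>F u. F \<in> set Fs \<Longrightarrow> u < n \<Longrightarrow> F ! u < n \<and> F ! u \<noteq> u \<and> F ! (F ! u) = u"
    and "\<And>u v. u < n \<Longrightarrow> v < n \<Longrightarrow> w u v = length (filter (\<lambda>F. F ! u = v) Fs)"
  shows "decomposable {..<n} w"
proof -
  have "colouring {..<n} w {i. i < length Fs} (\<lambda>i u. Fs ! i ! u)"
    using assms unfolding colouring_def perfect_matching_def
    by (auto simp: length_filter_conv_card conj_commute)
  then show ?thesis by (rule colouring_decomposable)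
qed

lemma wrgraph_add_matching:
  assumes G: "wrgraph V r w" and f: "perfect_matching V f"
  shows "wrgraph V (r + 1) (\<lambda>u v. w u v + matching_weight f u v)"
proof -
  have fin: "finite V" by (rule wgraphD(1)[OF wrgraphD(1)[OF G]])
  note mg = matching_wgraph[OF f fin]
  have "r + 1 \<le> edge_cut V (\<lambda>u v. w u v + matching_weight f u v) X" if "X \<subseteq> V" "odd (card X)" for X
  proof -
    have "edge_cut V (matching_weight f) X \<noteq> 0"
      using cut_matching_odd[OF f fin that] by (metis even_zero)
    then show ?thesis using wrgraphD(3)[OF G that] by (simp add: cut_add)
  qed
  moreover have "wgraph V (\<lambda>u v. w u v + matching_weight f u v)"
    unfolding wgraph_def using fin wgraphD(2,3)[OF wrgraphD(1)[OF G]] wgraphD(2,3)[OF mg]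
    by (metis add_0)
  ultimately show ?thesis
    using wrgraphD(2)[OF G] sum_matching_weight[OF f fin] unfolding wrgraph_def by (simp add: sum.distrib)
qed

section \<open>Cubic graphs on ten vertices\<close>

lemma perfect_matching_swaps_sides:
  assumes f: "perfect_matching V f" and V: "finite V" "card V = 2 * card X" and X: "X \<subseteq> V" "\<And>u. u \<in> X \<Longrightarrow> f u \<notin> X"
  shows "V - X = f ` X"
proof -
  have fX: "finite X" using X V finite_subset by blast
  have inj: "inj_on f X" using f X(1) unfolding perfect_matching_def inj_on_def by (metis subsetD)
  have "f ` X \<subseteq> V - X" using f X unfolding perfect_matching_def by blast
  moreover have "card (f ` X) = card (V - X)"
    using V X(1) fX by (simp add: card_image[OF inj] card_Diff_subset)
  ultimately show ?thesis using V(1) by (metis card_subset_eq finite_Diff)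
qed

text \<open>The five edges of \<open>f\<close> exhaust the cut, so degree 2 remains inside
  \<open>X\<close>. The ends of a double edge in \<open>X\<close> would have no further neighbours
  in \<open>X\<close>, and the other three vertices of \<open>X\<close> would have a tight cut of
  size 3.\<close>

lemma cubic_near_tight_side:
  assumes G: "wrgraph V 3 w" and V: "card V = 10" and nd: "\<not> decomposable V w"
    and f: "perfect_matching V f" "\<And>u. u \<in> V \<Longrightarrow> 0 < w u (f u)"
    and X: "X \<subseteq> V" "card X = 5" "edge_cut V w X = 5" "\<And>u. u \<in> X \<Longrightarrow> f u \<notin> X"
  shows "\<And>u v. u \<in> X \<Longrightarrow> v \<in> V - X \<Longrightarrow> w u v = of_bool (f u = v)"
    "\<And>u v. u \<in> X \<Longrightarrow> v \<in> X \<Longrightarrow> w u v \<le> 1"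
    "\<And>u. u \<in> X \<Longrightarrow> (\<Sum>v\<in>X. w u v) = 2"
proof -
  note wg = wrgraphD(1)[OF G]
  have fin: "finite V" by (rule wgraphD(1)[OF wg])
  have fX: "finite X" using X(1) fin finite_subset by blast
  have le: "matching_weight f u v \<le> w u v" if "u \<in> V" for u v
    using matching_weight_le[OF f(1), of w] f(2) that by blast
  have "edge_cut V (matching_weight f) X = 5"
    using crossing_all_iff[OF f(1) fin X(1)] X by simp
  then have "edge_cut V (\<lambda>u v. w u v - matching_weight f u v) X = 0"
    using cut_diff[OF X(1), of "matching_weight f" w] le X(3) by simp
  then have "w u v - matching_weight f u v = 0" if "u \<in> X" "v \<in> V - X" for u v
    using that fX fin by (simp add: edge_cut_def)
  then show cross: "w u v = of_bool (f u = v)" if "u \<in> X" "v \<in> V - X" for u v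
    using that le[of u v] X(1) by (fastforce simp: matching_weight_def)
  have c1: "(\<Sum>v\<in>V - X. w u v) = 1" if "u \<in> X" for u
  proof -
    have "f u \<in> V - X" using f(1) X(1,4) that by (auto simp: perfect_matching_def)
    then have "(\<Sum>v\<in>V - X. of_bool (f u = v)) = (1 :: nat)" using fin by (simp add: of_bool_def)
    then show ?thesis using cross[OF that] by simp
  qed
  show deg: "(\<Sum>v\<in>X. w u v) = 2" if "u \<in> X" for u
  proof -
    have "(\<Sum>v\<in>V. w u v) = (\<Sum>v\<in>V - X. w u v) + (\<Sum>v\<in>X. w u v)"
      using sum.subset_diff[OF X(1) fin] by blast
    then show ?thesis using wrgraphD(2)[OF G, of u] c1[OF that] that X(1) by auto
  qed
  show "w u v \<le> 1" if uv: "u \<in> X" "v \<in> X" for u v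
  proof (rule ccontr)
    assume gt: "\<not> w u v \<le> 1"
    have V': "u \<in> V" "v \<in> V" using uv X(1) by auto
    have "u \<noteq> v" using gt wgraphD(2)[OF wg V'(1)] by auto
    let ?T = "X - {u, v}"
    have cT: "card ?T = 3" using uv \<open>u \<noteq> v\<close> X(2) fX by (simp add: card_Diff_subset)
    have zero: "w x t = 0" if "x \<in> X" "y \<in> X" "x \<noteq> y" "2 \<le> w x y" "t \<in> X - {x, y}" for x y t
    proof -
      have "y \<noteq> t" using that(5) by blast
      then have "w x y + w x t = (\<Sum>z\<in>{y, t}. w x z)" by simp
      also have "\<dots> \<le> (\<Sum>z\<in>X. w x z)" using that fX by (intro sum_mono2) auto
      finally show ?thesis using deg[OF that(1)] that(4) by simp
    qed
    have "edge_cut V w ?T = (\<Sum>t\<in>?T. \<Sum>s\<in>V - X. w t s)"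
      unfolding edge_cut_def
    proof (rule sum.cong[OF refl])
      fix t assume t: "t \<in> ?T"
      have "w u t = 0" "w v t = 0"
        using zero[of u v t] zero[of v u t] uv \<open>u \<noteq> v\<close> gt t wgraphD(3)[OF wg V'] by auto
      then have "w t u = 0" "w t v = 0" using wgraphD(3)[OF wg] V' t X(1) by auto
      moreover have "V - ?T = insert u (insert v (V - X))" using V' by auto
      ultimately show "(\<Sum>s\<in>V - ?T. w t s) = (\<Sum>s\<in>V - X. w t s)"
        using fin uv \<open>u \<noteq> v\<close> by simp
    qed
    also have "\<dots> = 3" using c1 cT by simp
    finally show False
      using order_10_nontight[OF G V nd, of ?T] cT X(1) V by auto
  qed
qed

text \<open>Both sides of the cut are 2-regular and joined by \<open>f\<close>. If \<open>f\<close>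
  carried an edge of one side to an edge of the other, the graph would be decomposable; hence one
  side is the complement of the 5-cycle on the other, as in the Petersen graph.\<close>

lemma cubic_order_10:
  assumes G: "wrgraph V 3 w" and V: "card V = 10" and nd: "\<not> decomposable V w"
    and f: "perfect_matching V f" "\<And>u. u \<in> V \<Longrightarrow> 0 < w u (f u)"
    and X: "X \<subseteq> V" "card X = 5" "edge_cut V w X = 5" "\<And>u. u \<in> X \<Longrightarrow> f u \<notin> X"
  obtains \<phi> where "bij_betw \<phi> {..<10} V" "\<And>i j. i < 10 \<Longrightarrow> j < 10 \<Longrightarrow> w (\<phi> i) (\<phi> j) = petersen i j"
proof -
  note wg = wrgraphD(1)[OF G]
  have fin: "finite V" by (rule wgraphD(1)[OF wg])
  have fX: "finite X" using X(1) fin finite_subset by blast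
  have VX: "V - X = f ` X"
    by (rule perfect_matching_swaps_sides[OF f(1) fin]) (use V X in auto)
  have fV: "f u \<in> V" "f (f u) = u" if "u \<in> V" for u using f(1) that by (auto simp: perfect_matching_def)
  have inj: "inj_on f X" using fV X(1) by (metis inj_onI subsetD)
  have side: "\<And>u v. u \<in> X \<Longrightarrow> v \<in> V - X \<Longrightarrow> w u v = of_bool (f u = v)"
    "\<And>u v. u \<in> X \<Longrightarrow> v \<in> X \<Longrightarrow> w u v \<le> 1" "\<And>u. u \<in> X \<Longrightarrow> (\<Sum>v\<in>X. w u v) = 2"
    by (rule cubic_near_tight_side[OF G V nd f X]; assumption)+
  have X': "V - X \<subseteq> V" "card (V - X) = 5" "edge_cut V w (V - X) = 5"
    using V X(1,2,3) fX cut_complement[OF wg X(1)] by (simp_all add: card_Diff_subset)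
  have cr': "f u \<notin> V - X" if "u \<in> V - X" for u
    using that VX fV X(1) by (metis DiffD2 imageE subsetD)
  have side': "\<And>u v. u \<in> V - X \<Longrightarrow> v \<in> V - X \<Longrightarrow> w u v \<le> 1"
    "\<And>u. u \<in> V - X \<Longrightarrow> (\<Sum>v\<in>V - X. w u v) = 2"
    by (rule cubic_near_tight_side(2,3)[OF G V nd f X' cr']; assumption)+
  have sym: "w u v = w v u" if "u \<in> V" "v \<in> V" for u v using wgraphD(3)[OF wg that] .
  have cross: "w u (f v) = of_bool (u = v)" if "u \<in> X" "v \<in> X" for u v
    using side(1)[of u "f v"] that inj VX by (auto simp: inj_on_def)
  have le': "w (f u) (f v) \<le> 1" if "u \<in> X" "v \<in> X" for u v
    using side'(1)[of "f u" "f v"] that VX by auto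
  have deg': "(\<Sum>v\<in>X. w (f u) (f v)) = 2" if "u \<in> X" for u
    using side'(2)[of "f u"] that VX by (simp add: sum.reindex[OF inj])
  have no_shared: "\<not> (w a b = 1 \<and> w (f a) (f b) = 1)" if "a \<in> X" "b \<in> X" for a b
  proof
    assume ab: "w a b = 1 \<and> w (f a) (f b) = 1"
    have "V = X \<union> f ` X" using VX X(1) by auto
    then show False
      using shared_edge_decomposable[OF wg f(1) fX X(2) _ X(4) cross side(2,3) le' deg' that] ab nd by blast
  qed
  obtain a where a: "a \<in> X" using X(2) by fastforce
  have "\<exists>b\<in>X. w a b \<noteq> 0"
  proof (rule ccontr)
    assume "\<not> (\<exists>b\<in>X. w a b \<noteq> 0)"
    then show False using side(3)[OF a] by simp
  qed
  then obtain b where b: "b \<in> X" "w a b = 1" using side(2)[OF a] by (metis le_antisym less_one not_le)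
  have w0: "w u u = 0" and symX: "w u v = w v u" if "u \<in> X" "v \<in> X" for u v
    using wgraphD(2)[OF wg] sym X(1) that by auto
  obtain p where p: "bij_betw p {..<5} X"
    "\<And>i j. i < 5 \<Longrightarrow> j < 5 \<Longrightarrow> w (p i) (p j) = of_bool (cycle5 i j)"
    by (rule five_cycle[OF fX X(2), of w a b]) (use w0 symX side(2,3) a b in auto)
  have pX: "p i \<in> X" if "i < 5" for i using p(1) that by (auto simp: bij_betw_def)
  have pinj: "p i = p j \<longleftrightarrow> i = j" if "i < 5" "j < 5" for i j
    using p(1) that by (auto simp: bij_betw_def inj_on_def)
  \<comment> \<open>The absence of shared edges gives only an upper bound; equality follows because
    both row sums are 2.\<close>
  have inner: "w (f (p i)) (f (p j)) = of_bool (i \<noteq> j \<and> \<not> cycle5 i j)" if ij: "i < 5" "j < 5" for i j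
  proof -
    have le: "w (f (p i)) (f (p k)) \<le> of_bool (i \<noteq> k \<and> \<not> cycle5 i k)" if "k < 5" for k
    proof (cases "i = k")
      case True
      then show ?thesis using wgraphD(2)[OF wg] fV pX[OF that] X(1) by auto
    next
      case False
      then show ?thesis
        using le'[OF pX[OF ij(1)] pX[OF that]] no_shared[OF pX[OF ij(1)] pX[OF that]] p(2)[OF ij(1) that]
        by (auto simp: le_Suc_eq)
    qed
    have "(\<Sum>k<5. w (f (p i)) (f (p k))) = 2"
      using deg'[OF pX[OF ij(1)]] sum.reindex_bij_betw[OF p(1), of "\<lambda>v. w (f (p i)) (f v)"] by simp
    moreover have "(\<Sum>k<5. of_bool (i \<noteq> k \<and> \<not> cycle5 i k)) = (2 :: nat)"
    proof -
      have "\<forall>i<5. (\<Sum>k<5. of_bool (i \<noteq> k \<and> \<not> cycle5 i k)) = (2 :: nat)"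
        unfolding all_less_5 sum_less_5 by (simp add: cycle5_def)
      then show ?thesis using ij by blast
    qed
    ultimately show ?thesis
      using sum_mono_inv[of "\<lambda>k. w (f (p i)) (f (p k))" "{..<5}" "\<lambda>k. of_bool (i \<noteq> k \<and> \<not> cycle5 i k)" j] le ij
      by auto
  qed
  define \<phi> where "\<phi> k = (if k < 5 then p k else f (p (k - 5)))" for k
  have "bij_betw \<phi> ({..<5} \<union> {5..<10}) (X \<union> (V - X))"
  proof (rule bij_betw_combine)
    show "bij_betw \<phi> {..<5} X"
      using p(1) by (rule bij_betw_cong[THEN iffD1, rotated]) (simp add: \<phi>_def)
    have "bij_betw (\<lambda>k. k - 5) {5..<10} {..<5 :: nat}"
      by (rule bij_betw_byWitness[of _ "\<lambda>k. k + 5"]) auto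
    then have "bij_betw (f \<circ> p \<circ> (\<lambda>k. k - 5)) {5..<10} (V - X)"
      using p(1) inj VX by (intro bij_betw_trans) (auto simp: bij_betw_def)
    then show "bij_betw \<phi> {5..<10} (V - X)"
      by (rule bij_betw_cong[THEN iffD1, rotated]) (simp add: \<phi>_def)
  qed auto
  moreover have "{..<5} \<union> {5..<10} = {..<10 :: nat}" "X \<union> (V - X) = V" using X(1) by auto
  ultimately have "bij_betw \<phi> {..<10} V" by simp
  moreover have "w (\<phi> i) (\<phi> j) = petersen i j" if ij: "i < 10" "j < 10" for i j
  proof -
    have pb: "petersen k l = of_bool (cycle5 k l)" "petersen k (l + 5) = of_bool (k = l)"
      "petersen (k + 5) l = of_bool (k = l)" "petersen (k + 5) (l + 5) = of_bool (k \<noteq> l \<and> \<not> cycle5 k l)"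
      if "k < 5" "l < 5" for k l using petersen_blocks that by blast+
    have sw: "w (f (p k)) (p l) = of_bool (k = l)" "w (p k) (f (p l)) = of_bool (k = l)" if "k < 5" "l < 5" for k l
      using cross[OF pX pX] sym[of "f (p k)" "p l"] fV pX X(1) pinj that by (auto simp: subset_iff)
    have ex: "\<exists>k<5. i = k \<or> i = k + 5" if "i < 10" for i :: nat
      using that by (intro exI[of _ "if i < 5 then i else i - 5"]) auto
    obtain k where k: "k < 5" "i = k \<or> i = k + 5" using ex[OF ij(1)] by blast
    obtain l where "l < 5" "j = l \<or> j = l + 5" using ex[OF ij(2)] by blast
    with k show ?thesis using pb[of k l] sw[of k l] p(2)[of k l] inner[of k l] by (auto simp: \<phi>_def)
  qed
  ultimately show thesis by (rule that)
qed

section \<open>The Petersen graph plus one perfect matching\<close>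

lemma sum_less_10:
  "(\<Sum>k<(10 :: nat). g k) = g 0 + g 1 + g 2 + g 3 + g 4 + g 5 + g 6 + g 7 + g 8 + (g 9 :: nat)"
  by (simp add: numeral_eq_Suc)

lemma twice_petersen:
  assumes "u < 10" "v < 10"
  shows "2 * petersen u v = (\<Sum>i<6. matching_weight (petersen_matching i) u v)"
proof -
  have "\<forall>u<10. \<forall>v<10. 2 * petersen u v = (\<Sum>i<6. matching_weight (petersen_matching i) u v)"
    unfolding all_less_10 sum_less_6 by (simp add: petersen_table petersen_matching_def matching_weight_def)
  then show ?thesis using assms by blast
qed

text \<open>Twice an odd cut is a sum of six odd numbers, one for each matching, hence at least
  6.\<close>

lemma petersen_wrgraph: "wrgraph {..<10} 3 petersen"
proof -
  have deg: "(\<Sum>v\<in>{..<10}. petersen u v) = 3" if "u < 10" for u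
  proof -
    have "\<forall>u<10. (\<Sum>v\<in>{..<10}. petersen u v) = 3"
      unfolding all_less_10 sum_less_10 by (simp add: petersen_table)
    then show ?thesis using that by blast
  qed
  have "3 \<le> edge_cut {..<10} petersen X" if X: "X \<subseteq> {..<10}" "odd (card X)" for X
  proof -
    have "2 * edge_cut {..<10} petersen X = edge_cut {..<10} (\<lambda>u v. petersen u v + petersen u v) X"
      by (simp add: cut_add)
    also have "\<dots> = edge_cut {..<10} (\<lambda>u v. \<Sum>i<6. matching_weight (petersen_matching i) u v) X"
      using X(1) twice_petersen by (intro cut_cong) (auto simp: mult_2[symmetric])
    also have "\<dots> = (\<Sum>i<6. edge_cut {..<10} (matching_weight (petersen_matching i)) X)"
      by (rule cut_sum) simp
    also have "\<dots> \<ge> (\<Sum>i<(6::nat). 1)"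
    proof (rule sum_mono)
      fix i :: nat assume "i \<in> {..<6}"
      then have "odd (edge_cut {..<10} (matching_weight (petersen_matching i)) X)"
        using cut_matching_odd[OF petersen_matching_perfect _ X] by simp
      then show "1 \<le> edge_cut {..<10} (matching_weight (petersen_matching i)) X"
        by (metis One_nat_def Suc_leI even_zero gr0I)
    qed
    finally show ?thesis by simp
  qed
  moreover have "wgraph {..<10} petersen"
    using petersen_symmetric unfolding wgraph_def by blast
  ultimately show ?thesis using deg unfolding wrgraph_def by blast
qed

lemma petersen_matching_support: "i < 6 \<Longrightarrow> petersen u (petersen_matching i u) = 1"
  by (auto simp: petersen_def)

lemma spokes: "u < 5 \<Longrightarrow> petersen_matching 5 u = u + 5" "u < 5 \<Longrightarrow> petersen_matching 5 (u + 5) = u"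
proof -
  have "\<forall>u<5. petersen_matching 5 u = u + 5 \<and> petersen_matching 5 (u + 5) = u"
    unfolding all_less_5 by (simp add: petersen_matching_def)
  then show "u < 5 \<Longrightarrow> petersen_matching 5 u = u + 5" "u < 5 \<Longrightarrow> petersen_matching 5 (u + 5) = u" by blast+
qed

text \<open>Without the spokes two disjoint 5-cycles remain, and an uncrossed set is a union of
  them; its size excludes the trivial unions.\<close>

lemma petersen_uncrossed_cut:
  assumes X: "X \<subseteq> {..<10}" "3 \<le> card X" "card X + 3 \<le> 10"
    and zero: "edge_cut {..<10} (\<lambda>u v. petersen u v - matching_weight (petersen_matching 5) u v) X = 0"
  shows "X = {..<5} \<or> X = {..<10} - {..<5}"
proof -
  have fX: "finite X" using X(1) finite_subset by blast
  have same: "u \<in> X \<longleftrightarrow> v \<in> X" if "u < 10" "v < 10" "petersen u v = 1" "petersen_matching 5 u \<noteq> v" for u v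
  proof -
    have "petersen v u = 1" "petersen_matching 5 v \<noteq> u"
      using petersen_symmetric petersen_matching_perfect[of 5] that by (auto simp: perfect_matching_def)
    then have "petersen u v - matching_weight (petersen_matching 5) u v = 1"
      "petersen v u - matching_weight (petersen_matching 5) v u = 1"
      using that by (auto simp: matching_weight_def)
    moreover have "petersen x y - matching_weight (petersen_matching 5) x y = 0" if "x \<in> X" "y \<in> {..<10} - X" for x y
      using zero that fX by (simp add: edge_cut_def)
    ultimately show ?thesis using that by (metis Diff_iff lessThan_iff one_neq_zero)
  qed
  \<comment> \<open>Along the outer path 0 1 2 3 4 and the inner path 5 7 9 6 8.\<close>
  have "0 \<in> X \<longleftrightarrow> 1 \<in> X" "1 \<in> X \<longleftrightarrow> 2 \<in> X" "2 \<in> X \<longleftrightarrow> 3 \<in> X" "3 \<in> X \<longleftrightarrow> 4 \<in> X"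
    "5 \<in> X \<longleftrightarrow> 7 \<in> X" "7 \<in> X \<longleftrightarrow> 9 \<in> X" "9 \<in> X \<longleftrightarrow> 6 \<in> X" "6 \<in> X \<longleftrightarrow> 8 \<in> X"
    by (rule same; simp add: petersen_table petersen_matching_def)+
  then have "\<forall>u<10. u \<in> X \<longleftrightarrow> (if u < 5 then 0 \<in> X else 5 \<in> X)"
    unfolding all_less_10 by simp
  then have m: "u \<in> X \<longleftrightarrow> u < 10 \<and> (if u < 5 then P else Q)" if "(0 \<in> X) = P" "(5 \<in> X) = Q" for u P Q
    using X(1) that by (metis lessThan_iff subsetD)
  show ?thesis
  proof (cases "0 \<in> X"; cases "5 \<in> X")
    assume "0 \<in> X" "5 \<in> X"
    then have "u \<in> X \<longleftrightarrow> u < 10" for u using m[of True True u] by auto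
    then have "X = {..<10}" by blast
    then show ?thesis using X(3) by simp
  next
    assume "0 \<in> X" "5 \<notin> X"
    then have "u \<in> X \<longleftrightarrow> u < 5" for u using m[of True False u] by auto
    then have "X = {..<5}" by blast
    then show ?thesis ..
  next
    assume "0 \<notin> X" "5 \<in> X"
    then have "u \<in> X \<longleftrightarrow> u < 10 \<and> \<not> u < 5" for u using m[of False True u] by auto
    then have "X = {..<10} - {..<5}" by blast
    then show ?thesis ..
  next
    assume "0 \<notin> X" "5 \<notin> X"
    then have "u \<in> X \<longleftrightarrow> False" for u using m[of False False u] by auto
    then have "X = {}" by blast
    then show ?thesis using X(2) by simp
  qed
qed

text \<open>Exchanging the spokes for \<open>f\<close> leaves two 5-cycles joined by \<open>f\<close>.\<close>

lemma petersen_plus_matching_spokes: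
  assumes f: "perfect_matching {..<10} f"
    and nd: "\<not> decomposable {..<10} (\<lambda>u v. petersen u v + matching_weight f u v)"
    and c: "edge_cut {..<10} (matching_weight f) {..<5} \<noteq> 1"
  shows "\<forall>u<10. f u = petersen_matching 5 u"
proof -
  let ?V = "{..<10 :: nat}" and ?s = "petersen_matching 5"
  let ?w = "\<lambda>u v. petersen u v + matching_weight f u v"
  let ?H = "\<lambda>u v. petersen u v + matching_weight f u v - matching_weight ?s u v"
  let ?C = "\<lambda>u v. petersen u v - matching_weight ?s u v"
  have fin: "finite ?V" "card ?V = 10" by simp_all
  have s: "perfect_matching ?V ?s" "\<And>u. 0 < petersen u (?s u)"
    using petersen_matching_perfect[of 5] petersen_matching_support[of 5] by simp_all
  have sle: "matching_weight ?s u v \<le> petersen u v" if "u \<in> ?V" for u v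
    using matching_weight_le[OF s(1), of petersen] s(2) that by blast
  have G: "wrgraph ?V 4 ?w" using wrgraph_add_matching[OF petersen_wrgraph f] by simp
  have nH: "\<not> decomposable ?V ?H"
    using decomposable_diff_matching[OF _ s(1), of ?w] nd s(2) by (metis add_gr_0)
  have "wrgraph ?V (4 - 1) ?H"
  proof (rule wrgraph_diff_matching[OF G _ s(1)])
    fix X assume X: "X \<subseteq> ?V" "odd (card X)" "3 \<le> card X" "card X + 3 \<le> card ?V"
    have ge: "4 + 2 \<le> edge_cut ?V ?w X" using order_10_nontight[OF G fin(2) nd X] .
    have ev: "even (edge_cut ?V ?w X)"
      using cut_parity[OF wrgraphD(1)[OF G] X(1) wrgraphD(2)[OF G] X(2)] by simp
    have s5: "edge_cut ?V (matching_weight ?s) X \<le> 5" using cut_matching_le_5[OF s(1) fin X(1)] .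
    have so: "odd (edge_cut ?V (matching_weight ?s) X)" using cut_matching_odd[OF s(1) fin(1) X(1,2)] .
    have fo: "odd (edge_cut ?V (matching_weight f) X)" using cut_matching_odd[OF f fin(1) X(1,2)] .
    have split: "edge_cut ?V ?w X = edge_cut ?V ?C X + edge_cut ?V (matching_weight ?s) X + edge_cut ?V (matching_weight f) X"
      using cut_diff[OF X(1), of "matching_weight ?s" petersen] sle by (simp add: cut_add)
    \<comment> \<open>By parity a violation has size 6 and contains all five spokes. What is left is
      one edge of \<open>f\<close> and no edge of the 5-cycles, so the cut separates these cycles,
      contrary to \<open>c\<close>.\<close>
    show "edge_cut ?V (matching_weight ?s) X + 4 \<le> edge_cut ?V ?w X + 1"
    proof (rule ccontr)
      assume "\<not> ?thesis"
      moreover have "a = 6 \<and> b = 5" if "\<not> b + 4 \<le> a + 1" "4 + 2 \<le> a" "even a" "b \<le> 5" "odd b" for a b :: nat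
        using that by presburger
      ultimately have "edge_cut ?V ?w X = 6 \<and> edge_cut ?V (matching_weight ?s) X = 5"
        using ge ev s5 so by blast
      then have "6 = edge_cut ?V ?C X + 5 + edge_cut ?V (matching_weight f) X"
        using split by metis
      moreover have "a = 0 \<and> b = 1" if "6 = a + 5 + b" "odd b" for a b :: nat
        using that by presburger
      ultimately have "edge_cut ?V ?C X = 0 \<and> edge_cut ?V (matching_weight f) X = 1"
        using fo by blast
      then show False
        using petersen_uncrossed_cut[OF X(1,3)] X(4) c
          cut_complement[OF matching_wgraph[OF f fin(1)], of "{..<5}"] by auto
    qed
  qed (use s(2) in auto)
  then have H: "wrgraph ?V 3 ?H" by simp
  have cross: "?H u v = of_bool (f u = v)" if uv: "u < 5" "v \<in> ?V - {..<5}" for u v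
  proof -
    have "v - 5 < 5" "v = (v - 5) + 5" using uv(2) by auto
    then obtain k where "k < 5" "v = k + 5" by blast
    then show ?thesis
      using petersen_blocks uv(1) spokes(1)[OF uv(1)] by (auto simp: matching_weight_def)
  qed
  \<comment> \<open>In \<open>?H\<close> only \<open>f\<close> crosses between the outer and the
    inner vertices, and this cut is not tight: all five edges of \<open>f\<close> cross it.\<close>
  have "edge_cut ?V ?H {..<5} = edge_cut ?V (matching_weight f) {..<5}"
    unfolding edge_cut_def using cross by (intro sum.cong refl) (auto simp: matching_weight_def)
  moreover have "3 + 2 \<le> edge_cut ?V ?H {..<5}"
    using order_10_nontight[OF H fin(2) nH, of "{..<5}"] by auto
  moreover have "edge_cut ?V (matching_weight f) {..<5} \<le> 5"
    using cut_matching_le_5[OF f fin, of "{..<5}"] by auto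
  ultimately have "edge_cut ?V (matching_weight f) {..<5} = card {..<5 :: nat}" by simp
  then have f5: "f u \<notin> {..<5}" if "u \<in> {..<5}" for u
    using crossing_all_iff[OF f fin(1), of "{..<5}"] that by auto
  have fV: "f u < 10" "f (f u) = u" if "u < 10" for u using f that by (auto simp: perfect_matching_def)
  define p where "p u = f u - 5" for u
  have p: "f u = p u + 5" "p u < 5" if "u < 5" for u
    using f5[of u] fV(1)[of u] that by (auto simp: p_def)
  have pinj: "p u = p v \<longleftrightarrow> u = v" if "u < 5" "v < 5" for u v
  proof -
    have "f (f u) = u" "f (f v) = v" using fV(2) that by simp_all
    then show ?thesis using p(1)[OF that(1)] p(1)[OF that(2)] by metis
  qed
  have outer: "?H u v = of_bool (cycle5 u v)" if "u < 5" "v < 5" for u v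
    using petersen_blocks that p(1)[OF that(1)] spokes(1)[OF that(1)] by (auto simp: matching_weight_def)
  have inner: "?H (f u) (f v) = of_bool (p u \<noteq> p v \<and> \<not> cycle5 (p u) (p v))" if "u < 5" "v < 5" for u v
    using petersen_blocks that p[OF that(1)] p[OF that(2)] spokes(2)[OF p(2)[OF that(1)]] fV(2)[of u]
    by (auto simp: matching_weight_def)
  have pim: "p ` {..<5} = {..<5}"
    using p(2) pinj by (intro endo_inj_surj) (auto simp: inj_on_def)
  have sums: "(\<Sum>v<5. of_bool (cycle5 u v)) = (2 :: nat)" "(\<Sum>v<5. of_bool (u \<noteq> v \<and> \<not> cycle5 u v)) = (2 :: nat)"
    if "u < 5" for u
  proof -
    have "\<forall>u<5. (\<Sum>v<5. of_bool (cycle5 u v)) = (2 :: nat) \<and> (\<Sum>v<5. of_bool (u \<noteq> v \<and> \<not> cycle5 u v)) = (2 :: nat)"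
      unfolding all_less_5 sum_less_5 by (simp add: cycle5_def)
    then show "(\<Sum>v<5. of_bool (cycle5 u v)) = (2 :: nat)" "(\<Sum>v<5. of_bool (u \<noteq> v \<and> \<not> cycle5 u v)) = (2 :: nat)"
      using that by blast+
  qed
  \<comment> \<open>Otherwise \<open>f\<close> carries the outer edge from \<open>a\<close> to
    \<open>b\<close> to an inner edge, and \<open>?H\<close> is decomposable by a shared
    edge.\<close>
  have "cycle5 (p a) (p b)" if ab: "a < 5" "b < 5" "cycle5 a b" for a b
  proof (rule ccontr)
    assume n: "\<not> cycle5 (p a) (p b)"
    have "?V - {..<5} = f ` {..<5}"
      by (rule perfect_matching_swaps_sides[OF f fin(1)]) (use f5 in auto)
    then have V: "?V = {..<5} \<union> f ` {..<5}" by auto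
    have "a \<noteq> b" using ab(1,3) by (auto simp: cycle5_def) presburger+
    have "decomposable ?V ?H"
    proof (rule shared_edge_decomposable[OF wrgraphD(1)[OF H] f _ _ V f5, of a b])
      fix u v :: nat assume uv: "u \<in> {..<5}" "v \<in> {..<5}"
      show "?H u (f v) = of_bool (u = v)"
        using cross[of u "f v"] uv fV p[of v] pinj[of u v] p[of u] by auto
      show "?H u v \<le> 1" "?H (f u) (f v) \<le> 1" using outer inner uv by auto
    next
      fix u :: nat assume u: "u \<in> {..<5}"
      show "(\<Sum>v<5. ?H u v) = 2" using sums(1)[of u] outer u by simp
      have "(\<Sum>v<5. ?H (f u) (f v)) = (\<Sum>v<5. of_bool (p u \<noteq> p v \<and> \<not> cycle5 (p u) (p v)))"
        using inner u by (intro sum.cong) auto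
      also have "\<dots> = (\<Sum>v\<in>p ` {..<5}. of_bool (p u \<noteq> v \<and> \<not> cycle5 (p u) v))"
        using pinj by (subst sum.reindex) (auto simp: inj_on_def)
      finally show "(\<Sum>v<5. ?H (f u) (f v)) = 2" using sums(2)[of "p u"] pim p(2) u by simp
    qed (use ab n outer inner pinj[of a b] \<open>a \<noteq> b\<close> in auto)
    then show False using nH by blast
  qed
  then have pl: "[p 0, p 1, p 2, p 3, p 4] \<in> set [[0,1,2,3,4], [1,2,3,4,0], [2,3,4,0,1], [3,4,0,1,2], [4,0,1,2,3],
    [0,4,3,2,1], [1,0,4,3,2], [2,1,0,4,3], [3,2,1,0,4], [4,3,2,1,0]]"
    by (intro cycle5_automorphism) (use p(2) pinj in \<open>auto simp: inj_on_def\<close>)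
  have fp: "f 0 = p 0 + 5" "f 1 = p 1 + 5" "f 2 = p 2 + 5" "f 3 = p 3 + 5" "f 4 = p 4 + 5"
    "f (p 0 + 5) = 0" "f (p 1 + 5) = 1" "f (p 2 + 5) = 2" "f (p 3 + 5) = 3" "f (p 4 + 5) = 4"
    using p(1)[of 0] p(1)[of 1] p(1)[of 2] p(1)[of 3] p(1)[of 4]
      fV(2)[of 0] fV(2)[of 1] fV(2)[of 2] fV(2)[of 3] fV(2)[of 4] by simp_all
  have u10: "[0..<10] = [0, 1, 2, 3, 4, 5, 6, 7, 8, 9 :: nat]" by (simp add: upt_rec)
  \<comment> \<open>Of the ten automorphisms of the 5-cycle the identity yields the spokes; the
    other nine are tabulated with their decompositions.\<close>
  have "map f [0..<10] = map ?s [0..<10] \<or> map f [0..<10] \<in> fst ` set twisted_spokes"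
    using pl fp unfolding u10 list.map list.set insert_iff empty_iff list.inject simp_thms
    by (elim disjE conjE) (simp_all add: twisted_spokes_def petersen_matching_def)
  then show ?thesis
  proof
    assume "map f [0..<10] = map ?s [0..<10]"
    then show ?thesis by (auto simp: map_eq_conv)
  next
    assume "map f [0..<10] \<in> fst ` set twisted_spokes"
    then obtain Fs where Fs: "(map f [0..<10], Fs) \<in> set twisted_spokes" by force
    have "decomposable ?V ?w"
    proof (rule decomposable_by_list)
      fix F and u :: nat assume "F \<in> set Fs" "u < 10"
      then show "F ! u < 10 \<and> F ! u \<noteq> u \<and> F ! (F ! u) = u"
        using twisted_spokes_matchings Fs by blast
    next
      fix u v :: nat assume uv: "u < 10" "v < 10"
      have "\<forall>u<10. \<forall>v<10. petersen u v + of_bool (map f [0..<10] ! u = v) = length (filter (\<lambda>F. F ! u = v) Fs)"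
        using twisted_spokes_sum Fs by blast
      then show "?w u v = length (filter (\<lambda>F. F ! u = v) Fs)"
        using uv by (simp add: matching_weight_def)
    qed
    then show ?thesis using nd by blast
  qed
qed

definition petersen_weight :: "nat list \<Rightarrow> nat \<Rightarrow> nat \<Rightarrow> nat" where
  "petersen_weight n u v = petersen u v + (\<Sum>i<6. n ! i * matching_weight (petersen_matching i) u v)"

lemma petersen_side_subset: "i < 6 \<Longrightarrow> set (petersen_side i) \<subseteq> {..<10}"
proof -
  have "\<forall>i<6. \<forall>u\<in>set (petersen_side i). u < 10"
    unfolding all_less_6 by (simp add: petersen_side_def)
  then show "i < 6 \<Longrightarrow> set (petersen_side i) \<subseteq> {..<10}" by blast
qed

text \<open>Each crossing edge is counted from both ends. A sum over all vertices can be exchanged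
  with the sum over the six sides.\<close>

lemma twice_cut_matching:
  assumes f: "perfect_matching V f" and V: "finite V" and X: "X \<subseteq> V"
  shows "2 * edge_cut V (matching_weight f) X = (\<Sum>u\<in>V. of_bool ((u \<in> X) \<noteq> (f u \<in> X)))"
proof -
  have fX: "finite X" using X V finite_subset by blast
  have "(\<Sum>u\<in>V. of_bool ((u \<in> X) \<noteq> (f u \<in> X))) =
      (\<Sum>u\<in>V - X. of_bool ((u \<in> X) \<noteq> (f u \<in> X))) + (\<Sum>u\<in>X. of_bool ((u \<in> X) \<noteq> (f u \<in> X)) :: nat)"
    using sum.subset_diff[OF X V] .
  also have "(\<Sum>u\<in>X. of_bool ((u \<in> X) \<noteq> (f u \<in> X)) :: nat) = (\<Sum>u\<in>X. of_bool (f u \<notin> X))"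
    by (intro sum.cong) auto
  also have "\<dots> = edge_cut V (matching_weight f) X"
    by (simp only: card_filter_eq_sum[OF fX, symmetric] cut_matching_eq_card[OF f V X])
  also have "(\<Sum>u\<in>V - X. of_bool ((u \<in> X) \<noteq> (f u \<in> X)) :: nat) = (\<Sum>u\<in>V - X. of_bool (f u \<notin> V - X))"
    using f by (intro sum.cong) (auto simp: perfect_matching_def)
  also have "\<dots> = edge_cut V (matching_weight f) (V - X)"
    using V by (simp only: card_filter_eq_sum[symmetric] cut_matching_eq_card[OF f V] finite_Diff Diff_subset)
  also have "\<dots> = edge_cut V (matching_weight f) X"
    using cut_complement[OF matching_wgraph[OF f V] X] .
  finally show ?thesis by simp
qed

text \<open>If \<open>f\<close> crossed each of the six cuts once, the double sum over cuts and
  vertices would be 12; but each of the ten vertices is separated from its partner by two cuts or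
  more. An automorphism turns a cut that is not crossed just once into the one between the outer and
  the inner cycle.\<close>

lemma petersen_plus_matching:
  assumes f: "perfect_matching {..<10} f"
    and nd: "\<not> decomposable {..<10} (\<lambda>u v. petersen u v + matching_weight f u v)"
  shows "\<exists>i<6. \<forall>u<10. f u = petersen_matching i u"
proof -
  let ?V = "{..<10 :: nat}"
  let ?S = "\<lambda>i. set (petersen_side i)"
  have "\<exists>i<6. edge_cut ?V (matching_weight f) (?S i) \<noteq> 1"
  proof (rule ccontr)
    assume "\<not> ?thesis"
    then have "(\<Sum>i<(6::nat). \<Sum>u\<in>?V. of_bool ((u \<in> ?S i) \<noteq> (f u \<in> ?S i)) :: nat) = (\<Sum>i<(6::nat). 2)"
      using twice_cut_matching[OF f _ petersen_side_subset] by (intro sum.cong refl) force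
    then have "(\<Sum>u\<in>?V. \<Sum>i<(6::nat). of_bool ((u \<in> ?S i) \<noteq> (f u \<in> ?S i)) :: nat) = 12"
      by (subst sum.swap) simp
    moreover have "(\<Sum>u\<in>?V. 2) \<le> (\<Sum>u\<in>?V. \<Sum>i<(6::nat). of_bool ((u \<in> ?S i) \<noteq> (f u \<in> ?S i)) :: nat)"
    proof (rule sum_mono)
      fix u assume "u \<in> ?V"
      then have "u < 10" "f u < 10" "f u \<noteq> u" using f by (auto simp: perfect_matching_def)
      then show "2 \<le> (\<Sum>i<(6::nat). of_bool ((u \<in> ?S i) \<noteq> (f u \<in> ?S i)) :: nat)"
        using petersen_separated_twice by (metis (no_types))
    qed
    ultimately show False by simp
  qed
  then obtain i where i: "i < 6" "edge_cut ?V (matching_weight f) (?S i) \<noteq> 1" by blast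
  note t = petersen_turn[OF i(1)]
  let ?t = "petersen_turn i"
  define s where "s = inv_into ?V ?t"
  have s: "bij_betw s ?V ?V" "\<And>u. u < 10 \<Longrightarrow> ?t (s u) = u" "\<And>u. u < 10 \<Longrightarrow> s (?t u) = u" "\<And>u. u < 10 \<Longrightarrow> s u < 10"
      "\<And>u. u < 10 \<Longrightarrow> ?t u < 10"
    using t(1) bij_betw_inv_into[OF t(1)] unfolding s_def
    by (auto simp: bij_betw_def f_inv_into_f inv_into_into)
  obtain g where g: "perfect_matching ?V g" "\<And>u. u \<in> ?V \<Longrightarrow> s (g u) = f (s u)"
    "\<And>u v. u \<in> ?V \<Longrightarrow> v \<in> ?V \<Longrightarrow> matching_weight f (s u) (s v) = matching_weight g u v"
    by (rule perfect_matching_bij[OF s(1) f]) (rule that)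
  have "\<not> decomposable ?V (\<lambda>u v. petersen u v + matching_weight g u v)"
  proof
    assume d: "decomposable ?V (\<lambda>u v. petersen u v + matching_weight g u v)"
    have "decomposable ?V (\<lambda>u v. petersen u v + matching_weight f u v)"
    proof (rule decomposable_bij[OF s(1) _ d])
      fix u v assume uv: "u \<in> ?V" "v \<in> ?V"
      show "petersen (s u) (s v) + matching_weight f (s u) (s v) = petersen u v + matching_weight g u v"
        using t(3)[of "s u" "s v"] s(2,4) g(3)[OF uv] uv by simp
    qed
    then show False using nd by blast
  qed
  moreover have "edge_cut ?V (matching_weight g) {..<5} \<noteq> 1"
  proof -
    have side: "s u \<in> ?S i \<longleftrightarrow> u < 5" if "u < 10" for u using t(4)[of "s u"] s(2,4) that by simp
    have gV: "g u < 10" if "u < 10" for u using g(1) that by (auto simp: perfect_matching_def)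
    have "2 * edge_cut ?V (matching_weight g) {..<5} = (\<Sum>u\<in>?V. of_bool ((s u \<in> ?S i) \<noteq> (s (g u) \<in> ?S i)))"
      using twice_cut_matching[OF g(1), of "{..<5}"] side gV by simp
    also have "\<dots> = (\<Sum>u\<in>?V. of_bool ((s u \<in> ?S i) \<noteq> (f (s u) \<in> ?S i)))"
      using g(2) by (intro sum.cong) auto
    also have "\<dots> = (\<Sum>u\<in>?V. of_bool ((u \<in> ?S i) \<noteq> (f u \<in> ?S i)))"
      using sum.reindex_bij_betw[OF s(1), of "\<lambda>u. of_bool ((u \<in> ?S i) \<noteq> (f u \<in> ?S i)) :: nat"] .
    also have "\<dots> = 2 * edge_cut ?V (matching_weight f) (?S i)"
      using twice_cut_matching[OF f _ petersen_side_subset[OF i(1)]] by simp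
    finally show ?thesis using i(2) by simp
  qed
  ultimately have gs: "\<forall>u<10. g u = petersen_matching 5 u"
    using petersen_plus_matching_spokes[OF g(1)] by blast
  have "f u = petersen_matching i u" if u: "u < 10" for u
  proof -
    have "f u = s (g (?t u))" using g(2)[of "?t u"] s(3,5) u by simp
    also have "g (?t u) = ?t (petersen_matching i u)" using gs t(2)[OF u] s(5)[OF u] by simp
    also have "s \<dots> = petersen_matching i u"
      using s(3) petersen_matching_perfect[OF i(1)] u by (auto simp: perfect_matching_def)
    finally show ?thesis .
  qed
  then show ?thesis using i(1) by blast
qed

lemma petersen_weight_add_matching:
  assumes "length n = 6" "i < 6"
  shows "petersen_weight (n[i := n ! i + 1]) u v = petersen_weight n u v + matching_weight (petersen_matching i) u v"
proof -
  have "(\<Sum>k<6. n[i := n ! i + 1] ! k * matching_weight (petersen_matching k) u v)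
    = (\<Sum>k<6. n ! k * matching_weight (petersen_matching k) u v
        + (if k = i then matching_weight (petersen_matching k) u v else 0))"
    using assms by (intro sum.cong) (auto simp: nth_list_update)
  then show ?thesis using assms by (simp add: petersen_weight_def sum.distrib)
qed

text \<open>The removed matching \<open>f\<close>, seen on the Petersen graph as \<open>g\<close>,
  has to be one of the six: otherwise the Petersen graph plus \<open>g\<close> would be
  decomposable, and with it \<open>w\<close>, which differs from it by further matchings only. The
  induction ends where no matching is removable, since this forces degree 3.\<close>

theorem order_10_classification:
  assumes "wrgraph V r w" "card V = 10" "\<not> decomposable V w"
  shows "\<exists>\<phi> n. bij_betw \<phi> {..<10} V \<and> length n = 6 \<and> sum_list n + 3 = r \<and>
    (\<forall>u<10. \<forall>v<10. w (\<phi> u) (\<phi> v) = petersen_weight n u v)"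
  using assms
proof (induction r arbitrary: w)
  case 0
  then show ?case using wrgraph_zero_decomposable by blast
next
  case (Suc r)
  note G = Suc.prems(1) and V = Suc.prems(2) and nd = Suc.prems(3)
  note wg = wrgraphD(1)[OF G]
  have fin: "finite V" by (rule wgraphD(1)[OF wg])
  show ?case
  proof (cases "\<exists>f. perfect_matching V f \<and> (\<forall>u\<in>V. 0 < w u (f u)) \<and>
      \<not> (\<exists>X\<subseteq>V. card X = 5 \<and> edge_cut V w X = Suc r + 2 \<and> (\<forall>u\<in>X. f u \<notin> X))")
    case True
    then obtain f where f0: "perfect_matching V f \<and> (\<forall>u\<in>V. 0 < w u (f u)) \<and>
      \<not> (\<exists>X\<subseteq>V. card X = 5 \<and> edge_cut V w X = Suc r + 2 \<and> (\<forall>u\<in>X. f u \<notin> X))" ..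
    then have f: "perfect_matching V f" "\<And>u. u \<in> V \<Longrightarrow> 0 < w u (f u)" by blast+
    have good: "\<not> (\<forall>u\<in>X. f u \<notin> X)" if "X \<subseteq> V" "card X = 5" "edge_cut V w X = Suc r + 2" for X
      using f0 that by blast
    let ?w = "\<lambda>u v. w u v - matching_weight f u v"
    have le: "matching_weight f u v \<le> w u v" if "u \<in> V" for u v
      using matching_weight_le[OF f(1), of w] f(2) that by blast
    have "wrgraph V (Suc r - 1) ?w"
    proof (rule wrgraph_diff_matching[OF G _ f])
      fix X assume X: "X \<subseteq> V" "odd (card X)" "3 \<le> card X" "card X + 3 \<le> card V"
      let ?c = "edge_cut V (matching_weight f) X"
      have ge: "Suc r + 2 \<le> edge_cut V w X" using order_10_nontight[OF G V nd X] .
      have par: "even (edge_cut V w X) \<longleftrightarrow> even (Suc r)"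
        using cut_parity[OF wg X(1) wrgraphD(2)[OF G] X(2)] .
      have c5: "?c \<le> 5" using cut_matching_le_5[OF f(1) fin V X(1)] .
      have co: "odd ?c" using cut_matching_odd[OF f(1) fin X(1,2)] .
      \<comment> \<open>By parity, removal can fail only at a cut of size \<open>Suc r + 2\<close>
        that loses five edges. Both its sides have five vertices, which the choice of
        \<open>f\<close> excludes.\<close>
      have "?c \<noteq> 5 \<or> edge_cut V w X \<noteq> Suc r + 2"
      proof (rule ccontr)
        assume a: "\<not> ?thesis"
        have cV: "card V = card X + card (V - X)"
          by (rule card_eq_card_plus_Diff[OF fin X(1)])
        have "?c \<le> card X" "?c \<le> card (V - X)"
          using cut_matching_le[OF f(1) fin X(1)] cut_matching_le[OF f(1) fin, of "V - X"]
            cut_complement[OF matching_wgraph[OF f(1) fin] X(1)] by auto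
        then have "card X = 5" using a cV V by linarith
        then show False using a good[OF X(1)] crossing_all_iff[OF f(1) fin X(1)] by auto
      qed
      moreover have "c + r' \<le> m + 1"
        if "r' + 2 \<le> m" "even m \<longleftrightarrow> even r'" "c \<le> 5" "odd c" "c \<noteq> 5 \<or> m \<noteq> r' + 2" for c m r' :: nat
        using that by presburger
      ultimately show "?c + Suc r \<le> edge_cut V w X + 1" using ge par c5 co by blast
    qed simp_all
    moreover have "\<not> decomposable V ?w" using decomposable_diff_matching[OF _ f(1), of w] f(2) nd by blast
    ultimately obtain \<phi> n where \<phi>: "bij_betw \<phi> {..<10} V" and n: "length n = 6" "sum_list n + 3 = r"
      and w: "\<forall>u<10. \<forall>v<10. ?w (\<phi> u) (\<phi> v) = petersen_weight n u v"
      using Suc.IH[of ?w] V by auto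
    obtain g where g: "perfect_matching {..<10} g" "\<And>u. u \<in> {..<10} \<Longrightarrow> \<phi> (g u) = f (\<phi> u)"
      "\<And>u v. u \<in> {..<10} \<Longrightarrow> v \<in> {..<10} \<Longrightarrow> matching_weight f (\<phi> u) (\<phi> v) = matching_weight g u v"
      by (rule perfect_matching_bij[OF \<phi> f(1)]) (rule that)
    have wg: "w (\<phi> u) (\<phi> v) = petersen_weight n u v + matching_weight g u v" if "u < 10" "v < 10" for u v
    proof -
      have "\<phi> u \<in> V" using \<phi> that by (auto simp: bij_betw_def)
      then show ?thesis using w le[of "\<phi> u" "\<phi> v"] g(3)[of u v] that by fastforce
    qed
    have "\<not> decomposable {..<10} (\<lambda>u v. petersen u v + matching_weight g u v)"
    proof
      assume "decomposable {..<10} (\<lambda>u v. petersen u v + matching_weight g u v)"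
      then have "decomposable {..<10} (\<lambda>u v. petersen u v + matching_weight g u v
          + (\<Sum>i<6. n ! i * matching_weight (petersen_matching i) u v))"
        using petersen_matching_perfect by (intro decomposable_add_multiples) auto
      then have "decomposable V w"
        by (rule decomposable_bij[OF \<phi>, rotated]) (simp add: wg petersen_weight_def algebra_simps)
      then show False using nd by blast
    qed
    then obtain i where i: "i < 6" "\<forall>u<10. g u = petersen_matching i u"
      using petersen_plus_matching[OF g(1)] by blast
    have "w (\<phi> u) (\<phi> v) = petersen_weight (n[i := n ! i + 1]) u v" if "u < 10" "v < 10" for u v
      using wg[OF that] i that petersen_weight_add_matching[OF n(1) i(1)] by (simp add: matching_weight_def)
    moreover have "sum_list (n[i := n ! i + 1]) + 3 = Suc r"
      using n i(1) sum_list_update[of i n "n ! i + 1"] member_le_sum_list[of "n ! i" n] by simp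
    ultimately show ?thesis
      using \<phi> n(1) by (intro exI[of _ \<phi>] exI[of _ "n[i := n ! i + 1]"]) simp
  next
    case False
    then have bad: "\<exists>X\<subseteq>V. card X = 5 \<and> edge_cut V w X = Suc r + 2 \<and> (\<forall>u\<in>X. f u \<notin> X)"
      if "perfect_matching V f" "\<And>u. u \<in> V \<Longrightarrow> 0 < w u (f u)" for f using that by blast
    have r3: "Suc r = 3"
      by (rule no_removable_matching(1)[OF G V _ nd]) (simp, rule bad, simp_all)
    have "\<exists>f X. perfect_matching V f \<and> X \<subseteq> V \<and> card X = 5 \<and> edge_cut V w X = 5 \<and>
        (\<forall>u\<in>X. f u \<notin> X) \<and> (\<forall>u\<in>V. 0 < w u (f u))"
      by (rule no_removable_matching(2)[OF G V _ nd]) (simp, rule bad, simp_all)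
    then obtain f X where f0: "perfect_matching V f \<and> X \<subseteq> V \<and> card X = 5 \<and> edge_cut V w X = 5 \<and>
        (\<forall>u\<in>X. f u \<notin> X) \<and> (\<forall>u\<in>V. 0 < w u (f u))" by (elim exE)
    then have fX: "perfect_matching V f" "X \<subseteq> V" "card X = 5" "edge_cut V w X = 5"
      "\<And>u. u \<in> X \<Longrightarrow> f u \<notin> X" "\<And>u. u \<in> V \<Longrightarrow> 0 < w u (f u)"
      by blast+
    have G3: "wrgraph V 3 w" using G r3 by simp
    obtain \<phi> where \<phi>: "bij_betw \<phi> {..<10} V" "\<And>i j. i < 10 \<Longrightarrow> j < 10 \<Longrightarrow> w (\<phi> i) (\<phi> j) = petersen i j"
      by (rule cubic_order_10[OF G3 V nd fX(1) _ fX(2,3,4)]) (use fX(5,6) in blast)+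
    then show ?thesis
      using r3 by (intro exI[of _ \<phi>] exI[of _ "replicate 6 0"]) (simp add: petersen_weight_def sum_list_replicate)
  qed
qed

section \<open>Petersen graphs with additional perfect matchings\<close>

lemma petersen_zero: "petersen u v = 0 \<Longrightarrow> i < 6 \<Longrightarrow> petersen_matching i u \<noteq> v"
  by (auto simp: petersen_def)

lemma petersen_weight_positive: "0 < petersen_weight n u v \<longleftrightarrow> petersen u v = 1"
proof (cases "petersen u v = 0")
  case True
  then show ?thesis using petersen_zero[OF True] by (simp add: petersen_weight_def matching_weight_def)
next
  case False
  then show ?thesis by (simp add: petersen_weight_def petersen_def)
qed

text \<open>Each added matching crosses every odd set, so the cuts grow at least as fast as the
  degree.\<close>

lemma petersen_weight_wrgraph:
  assumes "length n = 6"
  shows "wrgraph {..<10} (sum_list n + 3) (petersen_weight n)"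
proof -
  let ?V = "{..<10 :: nat}" and ?m = "\<lambda>i. matching_weight (petersen_matching i)"
  have sl: "sum_list n = (\<Sum>i<6. n ! i)"
    using assms by (simp add: sum_list_sum_nth atLeast0LessThan)
  have deg: "(\<Sum>v\<in>?V. petersen_weight n u v) = sum_list n + 3" if u: "u \<in> ?V" for u
  proof -
    have "(\<Sum>v\<in>?V. \<Sum>i<6. n ! i * ?m i u v) = (\<Sum>i<6. n ! i * (\<Sum>v\<in>?V. ?m i u v))"
      by (subst sum.swap) (simp add: sum_distrib_left)
    also have "\<dots> = sum_list n"
      unfolding sl using sum_matching_weight[OF petersen_matching_perfect _ u] by (intro sum.cong) auto
    finally show ?thesis
      using wrgraphD(2)[OF petersen_wrgraph u] by (simp add: petersen_weight_def sum.distrib)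
  qed
  have "sum_list n + 3 \<le> edge_cut ?V (petersen_weight n) X" if X: "X \<subseteq> ?V" "odd (card X)" for X
  proof -
    have "edge_cut ?V (petersen_weight n) X =
        edge_cut ?V petersen X + edge_cut ?V (\<lambda>u v. \<Sum>i<6. n ! i * ?m i u v) X"
      unfolding petersen_weight_def by (rule cut_add)
    moreover have "edge_cut ?V (\<lambda>u v. \<Sum>i<6. n ! i * ?m i u v) X = (\<Sum>i<6. edge_cut ?V (\<lambda>u v. n ! i * ?m i u v) X)"
      by (rule cut_sum) simp
    moreover have "n ! i \<le> edge_cut ?V (\<lambda>u v. n ! i * ?m i u v) X" if "i < 6" for i
    proof -
      have "odd (edge_cut ?V (?m i) X)" using cut_matching_odd[OF petersen_matching_perfect[OF that] _ X] by simp
      then have "n ! i * 1 \<le> n ! i * edge_cut ?V (?m i) X" by (intro mult_left_mono) (auto simp: Suc_le_eq intro!: gr0I)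
      then show ?thesis by (simp add: edge_cut_def sum_distrib_left)
    qed
    then have "sum_list n \<le> (\<Sum>i<6. edge_cut ?V (\<lambda>u v. n ! i * ?m i u v) X)"
      unfolding sl by (intro sum_mono) simp
    ultimately show ?thesis using wrgraphD(3)[OF petersen_wrgraph X] by simp
  qed
  moreover have "wgraph ?V (petersen_weight n)"
    unfolding wgraph_def
  proof (intro conjI ballI)
    fix u v assume uv: "u \<in> ?V" "v \<in> ?V"
    have "?m i u v = ?m i v u" if "i < 6" for i
      using wgraphD(3)[OF matching_wgraph[OF petersen_matching_perfect[OF that]] uv] by simp
    then show "petersen_weight n u v = petersen_weight n v u"
      using petersen_symmetric uv by (simp add: petersen_weight_def)
  next
    fix u assume "u \<in> ?V"
    then have "petersen u u = 0" using petersen_symmetric by blast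
    then show "petersen_weight n u u = 0" using petersen_weight_positive[of n u u] by simp
  qed simp
  ultimately show ?thesis using deg unfolding wrgraph_def by blast
qed

lemma petersen_weight_pair:
  assumes "i < 6" "j < 6" "i \<noteq> j"
  obtains u where "u < 10" "\<And>k. k < 6 \<Longrightarrow> petersen_matching k u = petersen_matching i u \<longleftrightarrow> k = i \<or> k = j"
    "\<And>n. petersen_weight n u (petersen_matching i u) = 1 + n ! i + n ! j"
proof -
  obtain u where u: "u < 10" "\<forall>k<6. petersen_matching k u = petersen_matching i u \<longleftrightarrow> k = i \<or> k = j"
    using petersen_matchings_meet_once[OF assms] by blast
  have "petersen_weight n u (petersen_matching i u) = 1 + n ! i + n ! j" for n
  proof -
    have "(\<Sum>k<6. n ! k * matching_weight (petersen_matching k) u (petersen_matching i u)) = (\<Sum>k\<in>{i, j}. n ! k)"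
      using u(2) assms by (intro sum.mono_neutral_cong_right) (auto simp: matching_weight_def)
    then show ?thesis
      using petersen_matching_support[OF assms(1), of u] assms(3) by (simp add: petersen_weight_def)
  qed
  then show thesis using that u by blast
qed

text \<open>In a decomposition into perfect matchings of the Petersen graph let \<open>c i\<close> be the multiplicity
  of the \<open>i\<close>-th matching. Every two of the six matchings share an edge that is in no other one, so
  \<open>c i + c j = 1 + n i + n j\<close>; summing over three pairs gives a parity contradiction.\<close>

lemma petersen_weight_not_decomposable: "\<not> decomposable {..<10} (petersen_weight n)"
proof
  assume "decomposable {..<10} (petersen_weight n)"
  then obtain I :: "nat set" and F where F: "colouring {..<10} (petersen_weight n) I F"
    unfolding decomposable_def by blast
  have "\<exists>k<6. \<forall>u<10. F i u = petersen_matching k u" if "i \<in> I" for i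
    using F that colouring_matching_support[OF F that]
    by (intro petersen_perfect_matching) (auto simp: colouring_def petersen_weight_positive)
  then obtain \<kappa> where \<kappa>: "\<And>i. i \<in> I \<Longrightarrow> \<kappa> i < 6" "\<And>i u. i \<in> I \<Longrightarrow> u < 10 \<Longrightarrow> F i u = petersen_matching (\<kappa> i) u"
    by metis
  define c where "c k = card {i\<in>I. \<kappa> i = k}" for k
  have fI: "finite I" using F by (simp add: colouring_def)
  have pair: "c k + c l = 1 + n ! k + n ! l" if kl: "k < 6" "l < 6" "k \<noteq> l" for k l
  proof -
    obtain u where u: "u < 10" "\<And>j. j < 6 \<Longrightarrow> petersen_matching j u = petersen_matching k u \<longleftrightarrow> j = k \<or> j = l"
      and w: "petersen_weight n u (petersen_matching k u) = 1 + n ! k + n ! l"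
      using petersen_weight_pair[OF kl] by metis
    have "petersen_matching k u < 10"
      using petersen_matching_perfect[OF kl(1)] u(1) by (auto simp: perfect_matching_def)
    then have "1 + n ! k + n ! l = card {i\<in>I. F i u = petersen_matching k u}"
      using F u(1) w by (simp add: colouring_def)
    also have "{i\<in>I. F i u = petersen_matching k u} = {i\<in>I. \<kappa> i = k} \<union> {i\<in>I. \<kappa> i = l}"
      using \<kappa> u by auto
    also have "card \<dots> = c k + c l"
      unfolding c_def using fI kl(3) by (intro card_Un_disjoint) auto
    finally show ?thesis by simp
  qed
  have "a + b \<noteq> 1 + x + y \<or> b + c \<noteq> 1 + y + z \<or> a + c \<noteq> 1 + x + z" for a b c x y z :: nat
    by presburger
  then show False using pair[of 0 1] pair[of 1 2] pair[of 0 2] by simp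
qed

text \<open>An isomorphism preserves the support, which is the Petersen graph, and so permutes the
  six perfect matchings. Shared edges give equal pair sums, and the three pair sums among three
  indices determine each of the three values.\<close>

lemma petersen_weight_bij_mset:
  assumes \<phi>: "bij_betw \<phi> {..<10} {..<10}"
    and len: "length m = 6" "length n = 6"
    and w: "\<And>u v. u < 10 \<Longrightarrow> v < 10 \<Longrightarrow> petersen_weight m (\<phi> u) (\<phi> v) = petersen_weight n u v"
  shows "mset m = mset n"
proof -
  let ?V = "{..<10 :: nat}" and ?p = petersen_matching
  have \<phi>V: "\<phi> u < 10" if "u < 10" for u using \<phi> that by (auto simp: bij_betw_def)
  have \<phi>inj: "\<phi> u = \<phi> v \<longleftrightarrow> u = v" if "u < 10" "v < 10" for u v
    using \<phi> that by (auto simp: bij_betw_def inj_on_def)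
  have pV: "?p i u < 10" "?p i (?p i u) = u" if "i < 6" "u < 10" for i u
    using petersen_matching_perfect[OF that(1)] that(2) by (auto simp: perfect_matching_def)
  have pet: "petersen (\<phi> u) (\<phi> v) = 1 \<longleftrightarrow> petersen u v = 1" if "u < 10" "v < 10" for u v
    using w[OF that] petersen_weight_positive by metis
  define \<psi> where "\<psi> = inv_into ?V \<phi>"
  have \<psi>: "bij_betw \<psi> ?V ?V" "\<And>x. x < 10 \<Longrightarrow> \<psi> x < 10" "\<And>x. x < 10 \<Longrightarrow> \<phi> (\<psi> x) = x" "\<And>u. u < 10 \<Longrightarrow> \<psi> (\<phi> u) = u"
    using \<phi> bij_betw_inv_into[OF \<phi>] unfolding \<psi>_def
    by (auto simp: bij_betw_def f_inv_into_f inv_into_into)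
  have "\<exists>k<6. \<forall>u<10. \<phi> (?p i u) = ?p k (\<phi> u)" if i: "i < 6" for i
  proof -
    obtain g where g: "perfect_matching ?V g" "\<And>u. u \<in> ?V \<Longrightarrow> \<psi> (g u) = ?p i (\<psi> u)"
      "\<And>u v. u \<in> ?V \<Longrightarrow> v \<in> ?V \<Longrightarrow> matching_weight (?p i) (\<psi> u) (\<psi> v) = matching_weight g u v"
      by (rule perfect_matching_bij[OF \<psi>(1) petersen_matching_perfect[OF i]]) (rule that)
    have gV: "g x < 10" if "x < 10" for x using g(1) that by (auto simp: perfect_matching_def)
    have "petersen x (g x) = 1" if x: "x < 10" for x
    proof -
      have "petersen (\<psi> x) (\<psi> (g x)) = 1"
        using g(2)[of x] petersen_matching_support[OF i] x by simp
      then show ?thesis using pet[of "\<psi> x" "\<psi> (g x)"] \<psi>(2,3) gV[OF x] x by simp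
    qed
    then obtain k where k: "k < 6" "\<forall>u<10. g u = ?p k u"
      using petersen_perfect_matching[OF g(1)] by blast
    have "\<phi> (?p i u) = ?p k (\<phi> u)" if u: "u < 10" for u
    proof -
      have "\<psi> (g (\<phi> u)) = ?p i u" using g(2)[of "\<phi> u"] \<psi>(4)[OF u] \<phi>V[OF u] by simp
      then have "\<phi> (?p i u) = g (\<phi> u)" using \<psi>(3)[OF gV[OF \<phi>V[OF u]]] by simp
      then show ?thesis using k(2) \<phi>V[OF u] by simp
    qed
    then show ?thesis using k(1) by blast
  qed
  then obtain \<sigma> where \<sigma>: "\<And>i. i < 6 \<Longrightarrow> \<sigma> i < 6" "\<And>i u. i < 6 \<Longrightarrow> u < 10 \<Longrightarrow> \<phi> (?p i u) = ?p (\<sigma> i) (\<phi> u)"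
    by metis
  \<comment> \<open>If \<open>i\<close> and \<open>j\<close> had the same image, the edge common to
    \<open>i\<close> and a third matching \<open>l\<close> would also lie in
    \<open>j\<close>.\<close>
  have inj: "inj_on \<sigma> {..<6}"
  proof (rule inj_onI, rule ccontr)
    fix i j assume ij: "i \<in> {..<6}" "j \<in> {..<6}" "\<sigma> i = \<sigma> j" "i \<noteq> j"
    obtain l where l: "l < 6" "l \<noteq> i" "l \<noteq> j"
    proof -
      have "\<not> {..<6} \<subseteq> {i, j}" using card_mono[of "{i, j}" "{..<6 :: nat}"] ij(4) by auto
      then show thesis using that by blast
    qed
    obtain u where u: "u < 10" "\<And>k. k < 6 \<Longrightarrow> ?p k u = ?p i u \<longleftrightarrow> k = i \<or> k = l"
      by (rule petersen_weight_pair[of i l]) (use ij l in auto)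
    have "\<phi> (?p i u) = \<phi> (?p j u)" using \<sigma>(2)[of _ u] ij u(1) by simp
    then show False using u(2)[of j] \<phi>inj pV(1) ij l u(1) by auto
  qed
  have s6: "\<sigma> ` {..<6} = {..<6}" using inj \<sigma>(1) by (intro endo_inj_surj) auto
  have pairs: "n ! i + n ! j = m ! \<sigma> i + m ! \<sigma> j" if ij: "i < 6" "j < 6" "i \<noteq> j" for i j
  proof -
    obtain u where u: "u < 10" "\<And>k. k < 6 \<Longrightarrow> ?p k u = ?p i u \<longleftrightarrow> k = i \<or> k = j"
      "petersen_weight n u (?p i u) = 1 + n ! i + n ! j"
      using petersen_weight_pair[OF ij] by metis
    have "petersen_weight m (\<phi> u) (\<phi> (?p i u)) = 1 + m ! \<sigma> i + m ! \<sigma> j"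
    proof -
      have "petersen (\<phi> u) (\<phi> (?p i u)) = 1"
        using pet[of u "?p i u"] pV(1)[OF ij(1) u(1)] u(1) petersen_matching_support[OF ij(1)] by simp
      moreover have "(\<Sum>k<6. m ! k * matching_weight (?p k) (\<phi> u) (\<phi> (?p i u)))
          = (\<Sum>k<6. m ! \<sigma> k * matching_weight (?p (\<sigma> k)) (\<phi> u) (\<phi> (?p i u)))"
        using sum.reindex[OF inj, of "\<lambda>k. m ! k * matching_weight (?p k) (\<phi> u) (\<phi> (?p i u))"] s6 by simp
      moreover have "\<dots> = (\<Sum>k\<in>{i, j}. m ! \<sigma> k)"
      proof (rule sum.mono_neutral_cong_right)
        show "\<forall>k\<in>{..<6} - {i, j}. m ! \<sigma> k * matching_weight (?p (\<sigma> k)) (\<phi> u) (\<phi> (?p i u)) = 0"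
        proof
          fix k assume "k \<in> {..<6} - {i, j}"
          then have "?p (\<sigma> k) (\<phi> u) \<noteq> \<phi> (?p i u)"
            using \<sigma>(2)[of k u] u(1) u(2)[of k] \<phi>inj[OF pV(1)[of k u] pV(1)[of i u]] ij by auto
          then show "m ! \<sigma> k * matching_weight (?p (\<sigma> k)) (\<phi> u) (\<phi> (?p i u)) = 0"
            by (simp add: matching_weight_def)
        qed
      next
        fix k assume "k \<in> {i, j}"
        then have "?p (\<sigma> k) (\<phi> u) = \<phi> (?p i u)" using \<sigma>(2)[of k u] u(1) u(2)[of k] ij by auto
        then show "m ! \<sigma> k * matching_weight (?p (\<sigma> k)) (\<phi> u) (\<phi> (?p i u)) = m ! \<sigma> k"
          by (simp add: matching_weight_def)
      qed (use ij in auto)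
      ultimately show ?thesis using ij(3) by (simp add: petersen_weight_def)
    qed
    then show ?thesis using w[OF u(1) pV(1)[OF ij(1) u(1)]] u(3) by simp
  qed
  have eq: "n ! i = m ! \<sigma> i" if "i < 6" for i
  proof -
    show ?thesis
    proof (cases "i = 0")
      case True
      then show ?thesis using pairs[of i 1] pairs[of i 2] pairs[of 1 2] by simp
    next
      case i0: False
      show ?thesis
      proof (cases "i = 1")
        case True
        then show ?thesis using pairs[of i 0] pairs[of i 2] pairs[of 0 2] by simp
      next
        case False
        then show ?thesis using pairs[of i 0] pairs[of i 1] pairs[of 0 1] that i0 by simp
      qed
    qed
  qed
  have "mset n = image_mset ((!) n) (mset_set {..<6})"
    using len(2) by (metis map_nth mset_map mset_upt atLeast0LessThan)
  also have "\<dots> = image_mset (\<lambda>i. m ! \<sigma> i) (mset_set {..<6})"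
    using eq by (intro image_mset_cong) simp
  also have "\<dots> = image_mset ((!) m) (image_mset \<sigma> (mset_set {..<6}))"
    by (simp add: multiset.map_comp comp_def)
  also have "image_mset \<sigma> (mset_set {..<6}) = mset_set {..<6}"
    using image_mset_mset_set[OF inj] s6 by simp
  also have "image_mset ((!) m) (mset_set {..<6}) = mset m"
    using len(1) by (metis map_nth mset_map mset_upt atLeast0LessThan)
  finally show ?thesis by simp
qed

section \<open>Automorphisms acting on the six perfect matchings\<close>

definition petersen_automorphism :: "(nat \<Rightarrow> nat) \<Rightarrow> (nat \<Rightarrow> nat) \<Rightarrow> bool" where
  "petersen_automorphism \<alpha> \<sigma> \<longleftrightarrow> bij_betw \<alpha> {..<10} {..<10} \<and> bij_betw \<sigma> {..<6} {..<6} \<and>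
     (\<forall>i<6. \<forall>u<10. \<alpha> (petersen_matching i u) = petersen_matching (\<sigma> i) (\<alpha> u))"

lemma petersen_automorphism_comp:
  assumes "petersen_automorphism \<alpha> \<sigma>" "petersen_automorphism \<beta> \<tau>"
  shows "petersen_automorphism (\<beta> \<circ> \<alpha>) (\<tau> \<circ> \<sigma>)"
  unfolding petersen_automorphism_def
proof (intro conjI allI impI)
  note a = assms(1)[unfolded petersen_automorphism_def] and b = assms(2)[unfolded petersen_automorphism_def]
  show "bij_betw (\<beta> \<circ> \<alpha>) {..<10} {..<10}" "bij_betw (\<tau> \<circ> \<sigma>) {..<6} {..<6}"
    using a b by (blast intro: bij_betw_trans)+
  fix i u :: nat assume "i < 6" "u < 10"
  moreover from this have "\<sigma> i < 6" "\<alpha> u < 10" using a unfolding bij_betw_def by blast+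
  ultimately show "(\<beta> \<circ> \<alpha>) (petersen_matching i u) = petersen_matching ((\<tau> \<circ> \<sigma>) i) ((\<beta> \<circ> \<alpha>) u)"
    using a b by simp
qed

text \<open>The graph is the union of its six matchings, so a map that permutes these preserves
  it.\<close>

lemma petersen_automorphism_weight:
  assumes a: "petersen_automorphism \<alpha> \<sigma>" and mn: "\<And>i. i < 6 \<Longrightarrow> m ! \<sigma> i = n ! i" and uv: "u < 10" "v < 10"
  shows "petersen_weight m (\<alpha> u) (\<alpha> v) = petersen_weight n u v"
proof -
  have \<alpha>: "bij_betw \<alpha> {..<10} {..<10}" and \<sigma>: "bij_betw \<sigma> {..<6} {..<6}"
    and p: "\<And>i u. i < 6 \<Longrightarrow> u < 10 \<Longrightarrow> \<alpha> (petersen_matching i u) = petersen_matching (\<sigma> i) (\<alpha> u)"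
    using a unfolding petersen_automorphism_def by auto
  have eq: "petersen_matching (\<sigma> i) (\<alpha> u) = \<alpha> v \<longleftrightarrow> petersen_matching i u = v" if "i < 6" for i
  proof -
    have "petersen_matching i u < 10"
      using petersen_matching_perfect[OF that] uv(1) by (auto simp: perfect_matching_def)
    then show ?thesis using p[OF that uv(1)] \<alpha> uv(2) unfolding bij_betw_def inj_on_def by (metis lessThan_iff)
  qed
  have "(\<exists>i<6. petersen_matching i (\<alpha> u) = \<alpha> v) \<longleftrightarrow> (\<exists>i<6. petersen_matching (\<sigma> i) (\<alpha> u) = \<alpha> v)"
    using \<sigma> unfolding bij_betw_def by (metis imageE imageI lessThan_iff)
  then have "petersen (\<alpha> u) (\<alpha> v) = petersen u v"
    unfolding petersen_def using eq by auto
  moreover have "(\<Sum>i<6. m ! i * matching_weight (petersen_matching i) (\<alpha> u) (\<alpha> v))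
      = (\<Sum>i<6. m ! \<sigma> i * matching_weight (petersen_matching (\<sigma> i)) (\<alpha> u) (\<alpha> v))"
    using sum.reindex_bij_betw[OF \<sigma>, of "\<lambda>i. m ! i * matching_weight (petersen_matching i) (\<alpha> u) (\<alpha> v)"] by simp
  moreover have "\<dots> = (\<Sum>i<6. n ! i * matching_weight (petersen_matching i) u v)"
    using eq mn by (intro sum.cong) (auto simp: matching_weight_def)
  ultimately show ?thesis by (simp add: petersen_weight_def)
qed

text \<open>Automorphisms, each with the permutation that it induces on the six perfect matchings.\<close>

definition petersen_symmetries :: "(nat list \<times> nat list) list" where
  "petersen_symmetries =
    [([0, 1, 6, 9, 4, 5, 2, 8, 7, 3], [5, 3, 4, 1, 2, 0]),
     ([0, 1, 2, 7, 5, 4, 6, 3, 9, 8], [3, 5, 4, 0, 2, 1]),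
     ([0, 5, 7, 9, 4, 1, 8, 2, 6, 3], [4, 1, 5, 3, 0, 2]),
     ([0, 1, 6, 8, 5, 4, 2, 9, 3, 7], [1, 0, 2, 5, 4, 3]),
     ([0, 5, 7, 2, 1, 4, 8, 9, 3, 6], [3, 2, 0, 4, 5, 1]),
     ([0, 1, 2, 3, 4, 5, 6, 7, 8, 9], [0, 1, 2, 3, 4, 5]),
     ([1, 2, 3, 4, 0, 6, 7, 8, 9, 5], [1, 2, 3, 4, 0, 5]),
     ([2, 3, 4, 0, 1, 7, 8, 9, 5, 6], [2, 3, 4, 0, 1, 5]),
     ([3, 4, 0, 1, 2, 8, 9, 5, 6, 7], [3, 4, 0, 1, 2, 5]),
     ([4, 0, 1, 2, 3, 9, 5, 6, 7, 8], [4, 0, 1, 2, 3, 5]),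
     ([5, 7, 9, 6, 8, 0, 2, 4, 1, 3], [0, 2, 4, 1, 3, 5]),
     ([5, 8, 6, 9, 7, 0, 3, 1, 4, 2], [0, 3, 1, 4, 2, 5]),
     ([0, 4, 3, 2, 1, 5, 9, 8, 7, 6], [0, 4, 3, 2, 1, 5])]"

lemma petersen_symmetries_automorphism:
  assumes "(A, S) \<in> set petersen_symmetries"
  shows "petersen_automorphism ((!) A) ((!) S)"
proof -
  have "\<forall>(A, S)\<in>set petersen_symmetries. distinct A \<and> distinct S \<and> length A = 10 \<and> length S = 6 \<and>
      set A \<subseteq> {..<10} \<and> set S \<subseteq> {..<6}"
    by (simp add: petersen_symmetries_def)
  then have AS: "distinct A" "distinct S" "length A = 10" "length S = 6" "set A \<subseteq> {..<10}" "set S \<subseteq> {..<6}"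
    using assms by blast+
  have "set A = {..<10}" "set S = {..<6}"
    using AS distinct_card[of A] distinct_card[of S] card_subset_eq[of "{..<10}" "set A"]
      card_subset_eq[of "{..<6}" "set S"] by simp_all
  then have "bij_betw ((!) A) {..<10} {..<10}" "bij_betw ((!) S) {..<6} {..<6}"
    using AS by (auto intro: bij_betw_nth)
  moreover have "\<forall>(A, S)\<in>set petersen_symmetries. \<forall>i<6. \<forall>u<10.
      A ! petersen_matching i u = petersen_matching (S ! i) (A ! u)"
    unfolding all_less_6 all_less_10 by (simp add: petersen_symmetries_def petersen_matching_def)
  ultimately show ?thesis using assms unfolding petersen_automorphism_def by blast
qed

text \<open>Transversals of a stabiliser chain with base points 5, 0, 1; composing one element of
  each gives 3-transitivity.\<close>

lemma petersen_symmetries_cover: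
  shows "i < 6 \<Longrightarrow> \<exists>(A, S)\<in>set petersen_symmetries. S ! i = 5"
    and "i < 5 \<Longrightarrow> \<exists>(A, S)\<in>set petersen_symmetries. S ! 5 = 5 \<and> S ! i = 0"
    and "i < 5 \<Longrightarrow> i \<noteq> 0 \<Longrightarrow> \<exists>(A, S)\<in>set petersen_symmetries. S ! 5 = 5 \<and> S ! 0 = 0 \<and> S ! i = 1"
proof -
  have "\<forall>i<6. \<exists>(A, S)\<in>set petersen_symmetries. S ! i = 5"
    unfolding all_less_6 by (simp add: petersen_symmetries_def)
  then show "i < 6 \<Longrightarrow> \<exists>(A, S)\<in>set petersen_symmetries. S ! i = 5" by blast
  have "\<forall>i<5. \<exists>(A, S)\<in>set petersen_symmetries. S ! 5 = 5 \<and> S ! i = 0"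
    unfolding all_less_5 by (simp add: petersen_symmetries_def)
  then show "i < 5 \<Longrightarrow> \<exists>(A, S)\<in>set petersen_symmetries. S ! 5 = 5 \<and> S ! i = 0" by blast
  have "\<forall>i<5. i \<noteq> 0 \<longrightarrow> (\<exists>(A, S)\<in>set petersen_symmetries. S ! 5 = 5 \<and> S ! 0 = 0 \<and> S ! i = 1)"
    unfolding all_less_5 by (simp add: petersen_symmetries_def)
  then show "i < 5 \<Longrightarrow> i \<noteq> 0 \<Longrightarrow> \<exists>(A, S)\<in>set petersen_symmetries. S ! 5 = 5 \<and> S ! 0 = 0 \<and> S ! i = 1" by blast
qed

lemma petersen_automorphism_3_transitive:
  assumes ijk: "i < 6" "j < 6" "k < 6" "i \<noteq> j" "i \<noteq> k" "j \<noteq> k"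
  obtains \<alpha> \<sigma> where "petersen_automorphism \<alpha> \<sigma>" "\<sigma> i = 5" "\<sigma> j = 0" "\<sigma> k = 1"
proof -
  have perm: "s x < 6" "s x = s y \<longleftrightarrow> x = y" if "petersen_automorphism a s" "x < 6" "y < 6" for a s x y
    using that unfolding petersen_automorphism_def bij_betw_def inj_on_def by blast+
  obtain A1 S1 where 1: "petersen_automorphism ((!) A1) ((!) S1)" "S1 ! i = 5"
  proof -
    obtain A S where AS: "(A, S) \<in> set petersen_symmetries" "S ! i = 5"
      using petersen_symmetries_cover(1)[OF ijk(1)] by blast
    show thesis by (rule that[of A S]) (use AS petersen_symmetries_automorphism in auto)
  qed
  define j1 k1 where "j1 = S1 ! j" and "k1 = S1 ! k"
  have "j1 < 6" "k1 < 6" "j1 \<noteq> 5" "k1 \<noteq> 5" "j1 \<noteq> k1"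
    using perm(1)[OF 1(1) ijk(2,2)] perm(1)[OF 1(1) ijk(3,3)] perm(2)[OF 1(1) ijk(2,1)]
      perm(2)[OF 1(1) ijk(3,1)] perm(2)[OF 1(1) ijk(2,3)] 1(2) ijk(4,5,6) unfolding j1_def k1_def by auto
  then have jk1: "j1 < 5" "k1 < 5" "j1 \<noteq> k1" by simp_all
  obtain A2 S2 where 2: "petersen_automorphism ((!) A2) ((!) S2)" "S2 ! 5 = 5" "S2 ! j1 = 0"
  proof -
    obtain A S where AS: "(A, S) \<in> set petersen_symmetries" "S ! 5 = 5 \<and> S ! j1 = 0"
      using petersen_symmetries_cover(2)[OF jk1(1)] by blast
    show thesis by (rule that[of A S]) (use AS petersen_symmetries_automorphism in auto)
  qed
  define k2 where "k2 = S2 ! k1"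
  have k2: "k2 < 6" "k2 \<noteq> 5" "k2 \<noteq> 0"
    using perm(1)[OF 2(1), of k1 k1] perm(2)[OF 2(1), of k1 5] perm(2)[OF 2(1), of k1 j1] 2 jk1
    unfolding k2_def by auto
  then have "k2 < 5" by simp
  obtain A3 S3 where 3: "petersen_automorphism ((!) A3) ((!) S3)" "S3 ! 5 = 5" "S3 ! 0 = 0" "S3 ! k2 = 1"
  proof -
    obtain A S where AS: "(A, S) \<in> set petersen_symmetries" "S ! 5 = 5 \<and> S ! 0 = 0 \<and> S ! k2 = 1"
      using petersen_symmetries_cover(3)[OF \<open>k2 < 5\<close> k2(3)] by blast
    show thesis by (rule that[of A S]) (use AS petersen_symmetries_automorphism in auto)
  qed
  show thesis
    by (rule that[OF petersen_automorphism_comp[OF petersen_automorphism_comp[OF 1(1) 2(1)] 3(1)]])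
      (use 1 2 3 in \<open>simp_all add: j1_def k1_def k2_def\<close>)
qed

section \<open>Multigraphs and multiplicities\<close>

definition multiplicity :: "('v, 'e) mgraph \<Rightarrow> 'v \<Rightarrow> 'v \<Rightarrow> nat" where
  "multiplicity G u v = (if u = v then 0 else card {e\<in>edges G. ends G e = {u, v}})"

lemma multigraphD:
  assumes "multigraph G"
  shows "finite (verts G)" "finite (edges G)" "e \<in> edges G \<Longrightarrow> ends G e \<subseteq> verts G"
    "e \<in> edges G \<Longrightarrow> card (ends G e) = 2"
  using assms unfolding multigraph_def by auto

lemma multiplicity_wgraph: "multigraph G \<Longrightarrow> wgraph (verts G) (multiplicity G)"
  by (auto simp: wgraph_def multiplicity_def multigraph_def insert_commute)

lemma multigraph_ends:
  assumes "multigraph G" "e \<in> edges G" "u \<in> ends G e"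
  obtains v where "v \<in> verts G" "u \<in> verts G" "v \<noteq> u" "ends G e = {u, v}"
proof -
  obtain x y where xy: "ends G e = {x, y}" "x \<noteq> y"
    using multigraphD(4)[OF assms(1,2)] by (auto simp: card_2_iff)
  then show thesis
    using that[of y] that[of x] multigraphD(3)[OF assms(1,2)] assms(3) by auto
qed

lemma degree_eq_sum:
  assumes G: "multigraph G" and u: "u \<in> verts G"
  shows "degree G u = (\<Sum>v\<in>verts G. multiplicity G u v)"
proof -
  note fin = multigraphD(1,2)[OF G]
  have "{e\<in>edges G. u \<in> ends G e} = (\<Union>v\<in>verts G - {u}. {e\<in>edges G. ends G e = {u, v}})"
  proof
    show "{e\<in>edges G. u \<in> ends G e} \<subseteq> (\<Union>v\<in>verts G - {u}. {e\<in>edges G. ends G e = {u, v}})"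
    proof
      fix e assume e: "e \<in> {e\<in>edges G. u \<in> ends G e}"
      then obtain v where "v \<in> verts G" "v \<noteq> u" "ends G e = {u, v}"
        using multigraph_ends[OF G, of e u] by blast
      then show "e \<in> (\<Union>v\<in>verts G - {u}. {e\<in>edges G. ends G e = {u, v}})" using e by blast
    qed
  qed auto
  then have "degree G u = card (\<Union>v\<in>verts G - {u}. {e\<in>edges G. ends G e = {u, v}})"
    by (simp add: degree_def)
  also have "\<dots> = (\<Sum>v\<in>verts G - {u}. card {e\<in>edges G. ends G e = {u, v}})"
    using fin by (intro card_UN_disjoint) (auto simp: doubleton_eq_iff)
  also have "\<dots> = (\<Sum>v\<in>verts G. multiplicity G u v)"
    using fin by (intro sum.mono_neutral_cong_left) (auto simp: multiplicity_def)
  finally show ?thesis .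
qed

lemma card_boundary_eq_cut:
  assumes G: "multigraph G" and X: "X \<subseteq> verts G"
  shows "card (boundary G X) = edge_cut (verts G) (multiplicity G) X"
proof -
  note fin = multigraphD(1,2)[OF G]
  have fX: "finite X" using X fin(1) finite_subset by blast
  let ?E = "\<lambda>p. {e\<in>edges G. ends G e = {fst p, snd p}}"
  have "boundary G X = (\<Union>p\<in>X \<times> (verts G - X). ?E p)"
  proof
    show "boundary G X \<subseteq> (\<Union>p\<in>X \<times> (verts G - X). ?E p)"
    proof
      fix e assume "e \<in> boundary G X"
      then have e: "e \<in> edges G" "card (ends G e \<inter> X) = 1" by (auto simp: boundary_def)
      then obtain u where u: "ends G e \<inter> X = {u}" by (auto simp: card_1_singleton_iff)
      then obtain v where v: "v \<in> verts G" "v \<noteq> u" "ends G e = {u, v}"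
        using multigraph_ends[OF G e(1), of u] by blast
      then have "(u, v) \<in> X \<times> (verts G - X)" "e \<in> ?E (u, v)" using u e(1) by auto
      then show "e \<in> (\<Union>p\<in>X \<times> (verts G - X). ?E p)" by blast
    qed
    show "(\<Union>p\<in>X \<times> (verts G - X). ?E p) \<subseteq> boundary G X"
    proof
      fix e assume "e \<in> (\<Union>p\<in>X \<times> (verts G - X). ?E p)"
      then obtain u v where "u \<in> X" "v \<notin> X" "e \<in> edges G" "ends G e = {u, v}" by auto
      then show "e \<in> boundary G X" by (simp add: boundary_def)
    qed
  qed
  then have "card (boundary G X) = (\<Sum>p\<in>X \<times> (verts G - X). card (?E p))"
    using fin fX by (simp only:) (intro card_UN_disjoint, auto simp: doubleton_eq_iff)
  also have "\<dots> = (\<Sum>u\<in>X. \<Sum>v\<in>verts G - X. card {e\<in>edges G. ends G e = {u, v}})"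
    by (simp add: sum.cartesian_product case_prod_beta)
  also have "\<dots> = edge_cut (verts G) (multiplicity G) X"
    unfolding edge_cut_def by (intro sum.cong refl) (auto simp: multiplicity_def)
  finally show ?thesis .
qed

lemma r_graph_iff_wrgraph:
  assumes "multigraph G"
  shows "r_graph r G \<longleftrightarrow> wrgraph (verts G) r (multiplicity G)"
  using assms multiplicity_wgraph[OF assms] degree_eq_sum[OF assms] card_boundary_eq_cut[OF assms]
  unfolding r_graph_def wrgraph_def regular_def by auto

text \<open>Parallel edges are interchangeable, so equal multiplicities allow a bijection of edges
  to be assembled separately for each pair of ends.\<close>

lemma isomorphic_iff:
  assumes G: "multigraph G" and H: "multigraph H"
  shows "isomorphic G H \<longleftrightarrow> (\<exists>\<phi>. bij_betw \<phi> (verts G) (verts H) \<and>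
    (\<forall>u\<in>verts G. \<forall>v\<in>verts G. multiplicity H (\<phi> u) (\<phi> v) = multiplicity G u v))"
proof
  assume "isomorphic G H"
  then obtain \<phi> \<psi> where \<phi>: "bij_betw \<phi> (verts G) (verts H)" and \<psi>: "bij_betw \<psi> (edges G) (edges H)"
    and e: "\<forall>e\<in>edges G. ends H (\<psi> e) = \<phi> ` ends G e"
    unfolding isomorphic_def by blast
  have "multiplicity H (\<phi> u) (\<phi> v) = multiplicity G u v" if uv: "u \<in> verts G" "v \<in> verts G" for u v
  proof (cases "u = v")
    case False
    have inj: "inj_on \<phi> (verts G)" using \<phi> by (simp add: bij_betw_def)
    have "{e\<in>edges G. ends G e = {u, v}} = {e\<in>edges G. ends H (\<psi> e) = {\<phi> u, \<phi> v}}"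
    proof (intro Collect_cong conj_cong refl)
      fix x assume x: "x \<in> edges G"
      have "\<phi> ` ends G x = \<phi> ` {u, v} \<longleftrightarrow> ends G x = {u, v}"
        using inj_on_image_eq_iff[OF inj, of "ends G x" "{u, v}"] multigraphD(3)[OF G x] uv by simp
      then show "ends G x = {u, v} \<longleftrightarrow> ends H (\<psi> x) = {\<phi> u, \<phi> v}" using e x by simp
    qed
    moreover have "card {e\<in>edges G. ends H (\<psi> e) = {\<phi> u, \<phi> v}} = card {f\<in>edges H. ends H f = {\<phi> u, \<phi> v}}"
      by (rule bij_betw_same_card[OF bij_betw_filter[OF \<psi>]])
    moreover have "\<phi> u \<noteq> \<phi> v" using False inj uv by (auto simp: inj_on_def)
    ultimately show ?thesis using False by (simp add: multiplicity_def)
  qed (simp add: multiplicity_def)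
  then show "\<exists>\<phi>. bij_betw \<phi> (verts G) (verts H) \<and>
    (\<forall>u\<in>verts G. \<forall>v\<in>verts G. multiplicity H (\<phi> u) (\<phi> v) = multiplicity G u v)"
    using \<phi> by blast
next
  assume "\<exists>\<phi>. bij_betw \<phi> (verts G) (verts H) \<and>
    (\<forall>u\<in>verts G. \<forall>v\<in>verts G. multiplicity H (\<phi> u) (\<phi> v) = multiplicity G u v)"
  then obtain \<phi> where \<phi>: "bij_betw \<phi> (verts G) (verts H)"
    and m: "\<And>u v. u \<in> verts G \<Longrightarrow> v \<in> verts G \<Longrightarrow> multiplicity H (\<phi> u) (\<phi> v) = multiplicity G u v"
    by blast
  have inj: "inj_on \<phi> (verts G)" and im: "\<phi> ` verts G = verts H" using \<phi> by (auto simp: bij_betw_def)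
  have "card {e\<in>edges G. \<phi> ` ends G e = C} = card {f\<in>edges H. ends H f = C}" for C
  proof (cases "\<exists>u\<in>verts G. \<exists>v\<in>verts G. u \<noteq> v \<and> C = {\<phi> u, \<phi> v}")
    case True
    then obtain u v where uv: "u \<in> verts G" "v \<in> verts G" "u \<noteq> v" "C = {\<phi> u, \<phi> v}" by blast
    have "{e\<in>edges G. \<phi> ` ends G e = C} = {e\<in>edges G. ends G e = {u, v}}"
    proof (intro Collect_cong conj_cong refl)
      fix x assume x: "x \<in> edges G"
      show "\<phi> ` ends G x = C \<longleftrightarrow> ends G x = {u, v}"
        using inj_on_image_eq_iff[OF inj, of "ends G x" "{u, v}"] multigraphD(3)[OF G x] uv by simp
    qed
    moreover have "\<phi> u \<noteq> \<phi> v" using inj uv by (auto simp: inj_on_def)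
    ultimately show ?thesis using m[OF uv(1,2)] uv(3,4) by (simp add: multiplicity_def)
  next
    case False
    have "\<phi> ` ends G e \<noteq> C" if e: "e \<in> edges G" for e
    proof -
      obtain x y where "ends G e = {x, y}" "x \<noteq> y"
        using multigraphD(4)[OF G e] by (auto simp: card_2_iff)
      then show ?thesis using False multigraphD(3)[OF G e] by auto
    qed
    moreover have "ends H e \<noteq> C" if e: "e \<in> edges H" for e
    proof -
      obtain x y where xy: "ends H e = {x, y}" "x \<noteq> y"
        using multigraphD(4)[OF H e] by (auto simp: card_2_iff)
      then have "x \<in> \<phi> ` verts G" "y \<in> \<phi> ` verts G" using multigraphD(3)[OF H e] im by auto
      then show ?thesis using False xy by auto
    qed
    ultimately have "{e\<in>edges G. \<phi> ` ends G e = C} = {}" "{f\<in>edges H. ends H f = C} = {}" by auto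
    then show ?thesis by (simp only: card.empty)
  qed
  then obtain \<psi> where "bij_betw \<psi> (edges G) (edges H)" "\<And>e. e \<in> edges G \<Longrightarrow> ends H (\<psi> e) = \<phi> ` ends G e"
    using bij_betw_of_equal_fibres[of "edges G" "edges H" "\<lambda>e. \<phi> ` ends G e" "ends H"]
      multigraphD(2)[OF G] multigraphD(2)[OF H] by blast
  then show "isomorphic G H" unfolding isomorphic_def using \<phi> by blast
qed

text \<open>Edges are triples with \<open>u < v\<close>, one for each copy of an unordered pair, and
  are then numbered.\<close>

lemma multigraph_realization:
  fixes V :: "nat set"
  assumes "wgraph V w"
  obtains G :: "(nat, nat) mgraph" where "multigraph G" "verts G = V"
    "\<And>u v. u \<in> V \<Longrightarrow> v \<in> V \<Longrightarrow> multiplicity G u v = w u v"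
proof -
  define E where "E = {(u, v, k). u \<in> V \<and> v \<in> V \<and> u < v \<and> k < w u v}"
  have fV: "finite V" using wgraphD(1)[OF assms] .
  have "E \<subseteq> (SIGMA u:V. SIGMA v:V. {..<w u v})" by (auto simp: E_def)
  then have fE: "finite E" using fV by (auto intro: finite_subset)
  obtain h where h: "bij_betw h {0..<card E} E" using ex_bij_betw_nat_finite[OF fE] by blast
  define G :: "(nat, nat) mgraph" where
    "G = \<lparr>verts = V, edges = {0..<card E}, ends = (\<lambda>i. {fst (h i), fst (snd (h i))})\<rparr>"
  have hE: "h i \<in> E" if "i < card E" for i using h that by (auto simp: bij_betw_def)
  have "multigraph G"
    unfolding multigraph_def using fV hE by (fastforce simp: G_def E_def)
  moreover have "multiplicity G u v = w u v" if uv: "u \<in> V" "v \<in> V" "u < v" for u v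
  proof -
    have "multiplicity G u v = card {i\<in>{0..<card E}. {fst (h i), fst (snd (h i))} = {u, v}}"
      using uv(3) by (simp add: multiplicity_def G_def)
    also have "\<dots> = card {e\<in>E. {fst e, fst (snd e)} = {u, v}}"
      by (rule bij_betw_same_card[OF bij_betw_filter[OF h]])
    also have "{e\<in>E. {fst e, fst (snd e)} = {u, v}} = (\<lambda>k. (u, v, k)) ` {..<w u v}"
      using uv by (auto simp: E_def doubleton_eq_iff)
    finally show ?thesis by (simp add: card_image inj_on_def)
  qed
  moreover have "multiplicity G u v = multiplicity G v u" for u v
    by (simp add: multiplicity_def insert_commute)
  ultimately have "multiplicity G u v = w u v" if "u \<in> V" "v \<in> V" for u v
    using that wgraphD(2,3)[OF assms] by (metis linorder_neqE_nat multiplicity_def)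
  then show thesis using that[of G] \<open>multigraph G\<close> by (simp add: G_def)
qed

text \<open>At a vertex of degree r each of r colours occurs, so colour classes are perfect
  matchings. Conversely, a decomposition only counts the edges between two vertices; a bijection to
  \<open>B\<close>, the edges of the matchings tagged with their colours, distributes parallel edges
  over colours.\<close>

lemma r_colouring_iff_decomposable:
  assumes G: "multigraph G" and reg: "regular r G"
  shows "(\<exists>c. proper_edge_colouring G r c) \<longleftrightarrow> decomposable (verts G) (multiplicity G)"
proof
  note fin = multigraphD(1,2)[OF G]
  assume "\<exists>c. proper_edge_colouring G r c"
  then obtain c where c: "c ` edges G \<subseteq> {..<r}"
    and proper: "\<And>e f. e \<in> edges G \<Longrightarrow> f \<in> edges G \<Longrightarrow> ends G e \<inter> ends G f \<noteq> {} \<Longrightarrow> c e = c f \<Longrightarrow> e = f"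
    unfolding proper_edge_colouring_def by metis
  have *: "\<exists>e. e \<in> edges G \<and> u \<in> ends G e \<and> c e = i" if u: "u \<in> verts G" and i: "i < r" for u i
  proof -
    let ?I = "{e\<in>edges G. u \<in> ends G e}"
    have "inj_on c ?I" using proper by (auto simp: inj_on_def)
    then have "card (c ` ?I) = r" using reg u by (simp add: card_image regular_def degree_def)
    then have "c ` ?I = {..<r}" using c by (intro card_subset_eq) auto
    then show ?thesis using i by (metis (mono_tags, lifting) imageE lessThan_iff mem_Collect_eq)
  qed
  define a where "a i u = (SOME e. e \<in> edges G \<and> u \<in> ends G e \<and> c e = i)" for i u
  have a: "a i u \<in> edges G \<and> u \<in> ends G (a i u) \<and> c (a i u) = i" if "u \<in> verts G" "i < r" for u i
    unfolding a_def by (rule someI_ex) (use *[OF that] in blast)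
  define F where "F i u = (SOME v. v \<in> verts G \<and> v \<noteq> u \<and> ends G (a i u) = {u, v})" for i u
  have F: "F i u \<in> verts G \<and> F i u \<noteq> u \<and> ends G (a i u) = {u, F i u}" if ui: "u \<in> verts G" "i < r" for u i
    unfolding F_def
  proof (rule someI_ex)
    show "\<exists>v. v \<in> verts G \<and> v \<noteq> u \<and> ends G (a i u) = {u, v}"
      using multigraph_ends[OF G, of "a i u" u] a[OF ui] by metis
  qed
  have aF: "a i (F i u) = a i u" if "u \<in> verts G" "i < r" for u i
    using proper[of "a i (F i u)" "a i u"] a[of "F i u" i] a[OF that] F[OF that] that by auto
  have "colouring (verts G) (multiplicity G) {..<r} F"
    unfolding colouring_def
  proof (intro conjI ballI)
    show "perfect_matching (verts G) (F i)" if "i \<in> {..<r}" for i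
      unfolding perfect_matching_def
    proof
      fix u assume u: "u \<in> verts G"
      have i: "i < r" using that by simp
      have "{F i u, F i (F i u)} = {u, F i u}"
        using F[OF u i] F[of "F i u" i] aF[OF u i] i by metis
      then have "F i (F i u) = u" using F[OF u i] F[of "F i u" i] i by (auto simp: doubleton_eq_iff)
      then show "F i u \<in> verts G \<and> F i u \<noteq> u \<and> F i (F i u) = u" using F[OF u i] by blast
    qed
    fix u v assume uv: "u \<in> verts G" "v \<in> verts G"
    show "multiplicity G u v = card {i\<in>{..<r}. F i u = v}"
    proof (cases "u = v")
      case True
      then have "{i\<in>{..<r}. F i u = v} = {}" using F uv by auto
      then show ?thesis using True by (simp add: multiplicity_def)
    next
      case False
      have "bij_betw (\<lambda>i. a i u) {i\<in>{..<r}. F i u = v} {e\<in>edges G. ends G e = {u, v}}"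
      proof (rule bij_betw_byWitness[where f' = c])
        show "\<forall>i\<in>{i\<in>{..<r}. F i u = v}. c (a i u) = i" using a uv by auto
        show ac: "\<forall>e\<in>{e\<in>edges G. ends G e = {u, v}}. a (c e) u = e"
        proof
          fix e assume e: "e \<in> {e\<in>edges G. ends G e = {u, v}}"
          then have "c e < r" using c by auto
          then show "a (c e) u = e" using proper[of "a (c e) u" e] a[OF uv(1)] e by auto
        qed
        show "c ` {e\<in>edges G. ends G e = {u, v}} \<subseteq> {i\<in>{..<r}. F i u = v}"
        proof (intro image_subsetI)
          fix e assume e: "e \<in> {e\<in>edges G. ends G e = {u, v}}"
          then have i: "c e < r" using c by auto
          have "{u, F (c e) u} = {u, v}" using F[OF uv(1) i] ac e by auto
          then show "c e \<in> {i\<in>{..<r}. F i u = v}"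
            using F[OF uv(1) i] i by (auto simp: doubleton_eq_iff)
        qed
        show "(\<lambda>i. a i u) ` {i\<in>{..<r}. F i u = v} \<subseteq> {e\<in>edges G. ends G e = {u, v}}"
          using a F uv by auto
      qed
      then show ?thesis using False by (simp add: multiplicity_def bij_betw_same_card)
    qed
  qed simp
  then show "decomposable (verts G) (multiplicity G)" by (rule colouring_decomposable)
next
  note fin = multigraphD(1,2)[OF G]
  assume "decomposable (verts G) (multiplicity G)"
  then obtain I :: "nat set" and F where F: "colouring (verts G) (multiplicity G) I F"
    unfolding decomposable_def by blast
  then have fI: "finite I" by (simp add: colouring_def)
  have pm: "F i u \<in> verts G" "F i u \<noteq> u" "F i (F i u) = u" if "i \<in> I" "u \<in> verts G" for i u
    using F that by (auto simp: colouring_def perfect_matching_def)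
  define B where "B = (\<lambda>(i, u). (i, {u, F i u})) ` (I \<times> verts G)"
  have fB: "finite B" using fI fin by (simp add: B_def)
  have "card {e\<in>edges G. ends G e = C} = card {b\<in>B. snd b = C}" for C
  proof (cases "\<exists>u\<in>verts G. \<exists>v\<in>verts G. u \<noteq> v \<and> C = {u, v}")
    case True
    then obtain u v where uv: "u \<in> verts G" "v \<in> verts G" "u \<noteq> v" "C = {u, v}" by blast
    have "{b\<in>B. snd b = C} = (\<lambda>i. (i, {u, v})) ` {i\<in>I. F i u = v}"
    proof
      show "(\<lambda>i. (i, {u, v})) ` {i\<in>I. F i u = v} \<subseteq> {b\<in>B. snd b = C}"
        using uv by (auto simp: B_def)
      show "{b\<in>B. snd b = C} \<subseteq> (\<lambda>i. (i, {u, v})) ` {i\<in>I. F i u = v}"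
      proof
        fix b assume "b \<in> {b\<in>B. snd b = C}"
        then obtain i x where b: "b = (i, {x, F i x})" "i \<in> I" "x \<in> verts G" "{x, F i x} = {u, v}"
          using uv(4) by (auto simp: B_def)
        then have "F i u = v" using pm[OF b(2,3)] by (auto simp: doubleton_eq_iff)
        then show "b \<in> (\<lambda>i. (i, {u, v})) ` {i\<in>I. F i u = v}" using b by auto
      qed
    qed
    then have "card {b\<in>B. snd b = C} = card {i\<in>I. F i u = v}" by (simp add: card_image inj_on_def)
    moreover have "multiplicity G u v = card {i\<in>I. F i u = v}"
      using F uv(1,2) unfolding colouring_def by blast
    ultimately show ?thesis using uv(3,4) by (simp add: multiplicity_def)
  next
    case False
    have "ends G e \<noteq> C" if e: "e \<in> edges G" for e
    proof -
      obtain x y where "ends G e = {x, y}" "x \<noteq> y"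
        using multigraphD(4)[OF G e] by (auto simp: card_2_iff)
      then show ?thesis using False multigraphD(3)[OF G e] by auto
    qed
    moreover have "snd b \<noteq> C" if b: "b \<in> B" for b
    proof -
      obtain i x where "i \<in> I" "x \<in> verts G" "snd b = {x, F i x}" using b by (auto simp: B_def)
      then show ?thesis using False pm[of i x] by metis
    qed
    ultimately have "{e\<in>edges G. ends G e = C} = {}" "{b\<in>B. snd b = C} = {}" by auto
    then show ?thesis by (simp only: card.empty)
  qed
  then obtain h where h: "bij_betw h (edges G) B" "\<And>e. e \<in> edges G \<Longrightarrow> snd (h e) = ends G e"
    using bij_betw_of_equal_fibres[OF fin(2) fB, of "ends G" snd] by blast
  obtain t where t: "bij_betw t I {0..<card I}" using ex_bij_betw_finite_nat[OF fI] by blast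
  have hB: "fst (h e) \<in> I" "u \<in> ends G e \<Longrightarrow> ends G e = {u, F (fst (h e)) u}" if e: "e \<in> edges G" for e u
  proof -
    have "h e \<in> B" using h(1) e by (auto simp: bij_betw_def)
    then obtain i x where b: "h e = (i, {x, F i x})" "i \<in> I" "x \<in> verts G" by (auto simp: B_def)
    then show "fst (h e) \<in> I" by simp
    have "ends G e = {x, F i x}" using h(2)[OF e] b by simp
    then show "ends G e = {u, F (fst (h e)) u}" if "u \<in> ends G e"
      using that pm(3)[OF b(2,3)] b(1) by auto
  qed
  \<comment> \<open>Without vertices the index set can have any size, but then there are no edges to
    colour.\<close>
  have "edges G = {} \<or> card I = r"
  proof (cases "edges G = {}")
    case False
    then obtain e u where "e \<in> edges G" "u \<in> ends G e" using multigraphD(4)[OF G] by fastforce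
    then have u: "u \<in> verts G" using multigraphD(3)[OF G] by blast
    have "(\<Sum>v\<in>verts G. multiplicity G u v) = r"
      using degree_eq_sum[OF G u] reg u by (simp add: regular_def)
    then show ?thesis using card_colouring[OF F fin(1) u] by simp
  qed simp
  moreover have "proper_edge_colouring G (card I) (\<lambda>e. t (fst (h e)))"
    unfolding proper_edge_colouring_def
  proof (intro conjI ballI impI)
    show "(\<lambda>e. t (fst (h e))) ` edges G \<subseteq> {..<card I}" using hB(1) t by (fastforce simp: bij_betw_def)
    fix e f assume ef: "e \<in> edges G" "f \<in> edges G" "e \<noteq> f \<and> ends G e \<inter> ends G f \<noteq> {}"
    then obtain u where u: "u \<in> ends G e" "u \<in> ends G f" by blast
    show "t (fst (h e)) \<noteq> t (fst (h f))"
    proof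
      assume "t (fst (h e)) = t (fst (h f))"
      then have eq: "fst (h e) = fst (h f)"
        using t hB(1)[OF ef(1)] hB(1)[OF ef(2)] by (auto simp: bij_betw_def inj_on_def)
      then have "ends G e = ends G f" using hB(2)[OF ef(1) u(1)] hB(2)[OF ef(2) u(2)] by simp
      then have "h e = h f" using eq h(2)[OF ef(1)] h(2)[OF ef(2)] by (simp add: prod_eq_iff)
      then show False using h(1) ef by (auto simp: bij_betw_def inj_on_def)
    qed
  qed
  ultimately show "\<exists>c. proper_edge_colouring G r c"
    by (auto simp: proper_edge_colouring_def)
qed

text \<open>The edges at a vertex need different colours, so class 1 means that as many colours as
  the maximum degree suffice.\<close>

lemma class1_iff_decomposable:
  assumes G: "r_graph r G"
  shows "class1 G \<longleftrightarrow> decomposable (verts G) (multiplicity G)"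
proof -
  have mg: "multigraph G" and reg: "regular r G" using G by (auto simp: r_graph_def)
  note fin = multigraphD(1,2)[OF mg]
  let ?P = "\<lambda>k. \<exists>c. proper_edge_colouring G k c"
  have ex: "?P (card (edges G))"
  proof -
    obtain h where "bij_betw h (edges G) {0..<card (edges G)}" using ex_bij_betw_finite_nat[OF fin(2)] by blast
    then show ?thesis unfolding proper_edge_colouring_def bij_betw_def inj_on_def by (intro exI[of _ h]) auto
  qed
  \<comment> \<open>The graph without vertices is an r-graph for every r but has maximum degree 0,
    so \<open>s\<close> may differ from r.\<close>
  define s where "s = max_degree G"
  have regs: "regular s G" and lower: "s \<le> k" if k: "?P k" for k
  proof -
    show "regular s G"
    proof (cases "verts G = {}")
      case False
      then have "degree G ` verts G = {r}" using reg by (auto simp: regular_def)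
      then have "s = r" by (simp add: s_def max_degree_def)
      then show ?thesis using reg by simp
    qed (simp add: regular_def)
    show "s \<le> k"
    proof (cases "verts G = {}")
      case True
      then show ?thesis by (simp add: s_def max_degree_def)
    next
      case False
      then obtain u where u: "u \<in> verts G" by blast
      have "degree G u = s" using \<open>regular s G\<close> u by (simp add: regular_def)
      obtain c where c: "proper_edge_colouring G k c" using k by blast
      have "inj_on c {e\<in>edges G. u \<in> ends G e}"
        using c unfolding proper_edge_colouring_def inj_on_def by blast
      moreover have "c ` {e\<in>edges G. u \<in> ends G e} \<subseteq> {..<k}"
        using c unfolding proper_edge_colouring_def by blast
      ultimately have "card {e\<in>edges G. u \<in> ends G e} \<le> card {..<k}"
        by (intro card_inj_on_le) auto
      then show ?thesis using \<open>degree G u = s\<close> by (simp add: degree_def)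
    qed
  qed
  have "class1 G \<longleftrightarrow> ?P s"
  proof
    assume "class1 G"
    then have "(LEAST k. ?P k) = s" by (simp add: class1_def chromatic_index_def s_def)
    then show "?P s" using LeastI[of ?P, OF ex] by simp
  next
    assume "?P s"
    then have "(LEAST k. ?P k) = s" using lower by (intro Least_equality) auto
    then show "class1 G" by (simp add: class1_def chromatic_index_def s_def)
  qed
  then show ?thesis using r_colouring_iff_decomposable[OF mg regs[OF ex]] by simp
qed

section \<open>Counting isomorphism classes\<close>

lemma card_images_eq:
  assumes "\<And>x y. x \<in> N \<Longrightarrow> y \<in> N \<Longrightarrow> f x = f y \<longleftrightarrow> g x = g y"
  shows "card (f ` N) = card (g ` N)"
proof -
  define h where "h z = g (SOME x. x \<in> N \<and> f x = z)" for z
  have h: "h (f x) = g x" if "x \<in> N" for x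
  proof -
    have "(SOME y. y \<in> N \<and> f y = f x) \<in> N \<and> f (SOME y. y \<in> N \<and> f y = f x) = f x"
      by (rule someI[of _ x]) (use that in simp)
    then show ?thesis using assms that unfolding h_def by blast
  qed
  then have "bij_betw h (f ` N) (g ` N)"
    using assms by (auto simp: bij_betw_def inj_on_def image_image)
  then show ?thesis by (rule bij_betw_same_card)
qed

text \<open>\<open>g\<close> factors through \<open>f\<close>, and the factor identifies two values
  of \<open>f\<close>.\<close>

lemma card_images_less:
  assumes fin: "finite N" and fg: "\<And>x y. x \<in> N \<Longrightarrow> y \<in> N \<Longrightarrow> f x = f y \<Longrightarrow> g x = g y"
    and ab: "a \<in> N" "b \<in> N" "g a = g b" "f a \<noteq> f b"
  shows "card (g ` N) < card (f ` N)"
proof -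
  define h where "h z = g (SOME x. x \<in> N \<and> f x = z)" for z
  have h: "h (f x) = g x" if "x \<in> N" for x
  proof -
    have "(SOME y. y \<in> N \<and> f y = f x) \<in> N \<and> f (SOME y. y \<in> N \<and> f y = f x) = f x"
      by (rule someI[of _ x]) (use that in simp)
    then show ?thesis using fg that unfolding h_def by blast
  qed
  then have "h ` f ` N = g ` N" by (auto simp: image_image)
  moreover have "\<not> inj_on h (f ` N)"
  proof
    assume "inj_on h (f ` N)"
    moreover have "h (f a) = h (f b)" using h ab by simp
    ultimately show False using ab by (auto dest!: inj_onD)
  qed
  ultimately have "card (g ` N) \<noteq> card (f ` N)" "card (g ` N) \<le> card (f ` N)"
    using fin inj_on_iff_eq_card[of "f ` N" h] card_image_le[of "f ` N" h] by auto
  then show ?thesis by simp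
qed

section \<open>Representatives of the isomorphism classes\<close>

definition compositions :: "nat \<Rightarrow> nat list set" where
  "compositions s = {n. length n = 6 \<and> sum_list n = s}"

lemma finite_compositions: "finite (compositions s)"
proof (rule finite_subset)
  show "compositions s \<subseteq> {n. set n \<subseteq> {..s} \<and> length n = 6}"
    using member_le_sum_list by (fastforce simp: compositions_def)
  show "finite {n. set n \<subseteq> {..s} \<and> length n = 6}" by (rule finite_lists_length_eq) simp
qed

lemma num_partitions_eq: "num_partitions s 6 = card (mset ` compositions s)"
proof -
  have "{N :: nat multiset. size N = 6 \<and> sum_mset N = s} = mset ` compositions s"
  proof
    show "{N :: nat multiset. size N = 6 \<and> sum_mset N = s} \<subseteq> mset ` compositions s"
    proof
      fix N :: "nat multiset" assume N: "N \<in> {N. size N = 6 \<and> sum_mset N = s}"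
      obtain n where n: "mset n = N" using ex_mset by blast
      then have "n \<in> compositions s"
        using N by (auto simp: compositions_def sum_mset_sum_list)
      then show "N \<in> mset ` compositions s" using n by blast
    qed
  qed (auto simp: compositions_def sum_mset_sum_list)
  then show ?thesis by (simp add: num_partitions_def)
qed

text \<open>Only multiplicities matter up to isomorphism, so any realisation serves.\<close>

definition petersen_graph :: "nat list \<Rightarrow> (nat, nat) mgraph" where
  "petersen_graph n = (SOME G. multigraph G \<and> verts G = {..<10} \<and>
     (\<forall>u<10. \<forall>v<10. multiplicity G u v = petersen_weight n u v))"

lemma petersen_graph:
  assumes "length n = 6"
  shows "multigraph (petersen_graph n)" "verts (petersen_graph n) = {..<10}"
    "u < 10 \<Longrightarrow> v < 10 \<Longrightarrow> multiplicity (petersen_graph n) u v = petersen_weight n u v"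
proof -
  obtain G :: "(nat, nat) mgraph" where "multigraph G" "verts G = {..<10}"
    "\<And>u v. u \<in> {..<10} \<Longrightarrow> v \<in> {..<10} \<Longrightarrow> multiplicity G u v = petersen_weight n u v"
    by (rule multigraph_realization[OF wrgraphD(1)[OF petersen_weight_wrgraph[OF assms]]]) (rule that)
  then have "multigraph G \<and> verts G = {..<10} \<and>
     (\<forall>u<10. \<forall>v<10. multiplicity G u v = petersen_weight n u v)" by auto
  then have "multigraph (petersen_graph n) \<and> verts (petersen_graph n) = {..<10} \<and>
     (\<forall>u<10. \<forall>v<10. multiplicity (petersen_graph n) u v = petersen_weight n u v)"
    unfolding petersen_graph_def by (rule someI)
  then show "multigraph (petersen_graph n)" "verts (petersen_graph n) = {..<10}"
    "u < 10 \<Longrightarrow> v < 10 \<Longrightarrow> multiplicity (petersen_graph n) u v = petersen_weight n u v" by blast+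
qed

lemma wrgraph_cong:
  assumes "\<And>u v. u \<in> V \<Longrightarrow> v \<in> V \<Longrightarrow> w u v = w' u v"
  shows "wrgraph V r w \<longleftrightarrow> wrgraph V r w'"
proof -
  have "(\<Sum>v\<in>V. w u v) = (\<Sum>v\<in>V. w' u v)" if "u \<in> V" for u using assms that by simp
  moreover have "edge_cut V w X = edge_cut V w' X" if "X \<subseteq> V" for X
    using cut_cong[of X V w w'] assms that by blast
  ultimately show ?thesis using assms unfolding wrgraph_def wgraph_def by simp
qed

lemma petersen_graph_class2:
  assumes "3 \<le> r" "n \<in> compositions (r - 3)"
  shows "r_graph r (petersen_graph n)" "class2 (petersen_graph n)"
proof -
  have n: "length n = 6" "sum_list n + 3 = r" using assms by (auto simp: compositions_def)
  note p = petersen_graph[OF n(1)]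
  have "wrgraph {..<10} r (multiplicity (petersen_graph n)) \<longleftrightarrow> wrgraph {..<10} r (petersen_weight n)"
    by (rule wrgraph_cong) (use p(3) in simp)
  then show r: "r_graph r (petersen_graph n)"
    using petersen_weight_wrgraph[OF n(1)] n(2) p(1,2) by (simp add: r_graph_iff_wrgraph)
  have "decomposable {..<10} (multiplicity (petersen_graph n)) \<longleftrightarrow> decomposable {..<10} (petersen_weight n)"
    by (rule decomposable_cong) (use p(3) in simp)
  then show "class2 (petersen_graph n)"
    using petersen_weight_not_decomposable class1_iff_decomposable[OF r] p(2) by (simp add: class2_def)
qed

lemma class2_card_ge_10:
  assumes "r_graph r G" "class2 G"
  shows "10 \<le> card (verts G)"
proof (rule ccontr)
  assume "\<not> ?thesis"
  moreover have "wrgraph (verts G) r (multiplicity G)"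
    using assms(1) r_graph_iff_wrgraph unfolding r_graph_def by blast
  ultimately have "decomposable (verts G) (multiplicity G)" by (intro card_lt_10_decomposable) auto
  then show False using class1_iff_decomposable[OF assms(1)] assms(2) by (simp add: class2_def)
qed

text \<open>Provides a class 2 graph on ten vertices for each r, so that the minimum order is
  exactly ten.\<close>

lemma replicate_composition: "s # replicate 5 0 \<in> compositions s"
  by (simp add: compositions_def sum_list_replicate)

lemma smallest_class2_iff:
  assumes r: "3 \<le> r"
  shows "G \<in> smallest_class2 r \<longleftrightarrow> r_graph r G \<and> class2 G \<and> card (verts G) = 10"
proof
  assume G: "G \<in> smallest_class2 r"
  note p = petersen_graph_class2[OF r replicate_composition]
  have "card (verts (petersen_graph ((r - 3) # replicate 5 0))) = 10"
    using petersen_graph(2)[of "(r - 3) # replicate 5 0"] by simp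
  then have "card (verts G) \<le> 10" using G p unfolding smallest_class2_def by fastforce
  moreover have "10 \<le> card (verts G)" using G class2_card_ge_10 unfolding smallest_class2_def by blast
  ultimately show "r_graph r G \<and> class2 G \<and> card (verts G) = 10" using G by (simp add: smallest_class2_def)
next
  assume "r_graph r G \<and> class2 G \<and> card (verts G) = 10"
  then show "G \<in> smallest_class2 r" using class2_card_ge_10 by (auto simp: smallest_class2_def)
qed

lemma petersen_graph_smallest:
  assumes "3 \<le> r" "n \<in> compositions (r - 3)"
  shows "petersen_graph n \<in> smallest_class2 r"
  using petersen_graph_class2[OF assms] petersen_graph(2)[of n] assms
  by (simp add: smallest_class2_iff compositions_def)

lemma smallest_class2_cover:
  assumes r: "3 \<le> r" and G: "G \<in> smallest_class2 r"
  shows "\<exists>n\<in>compositions (r - 3). isomorphic (petersen_graph n) G"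
proof -
  have g: "r_graph r G" "class2 G" "card (verts G) = 10" using G by (simp_all add: smallest_class2_iff[OF r])
  have mg: "multigraph G" using g(1) by (simp add: r_graph_def)
  have "wrgraph (verts G) r (multiplicity G)" using g(1) r_graph_iff_wrgraph[OF mg] by simp
  moreover have "\<not> decomposable (verts G) (multiplicity G)"
    using class1_iff_decomposable[OF g(1)] g(2) by (simp add: class2_def)
  ultimately obtain \<phi> n where \<phi>: "bij_betw \<phi> {..<10} (verts G)" and n: "length n = 6" "sum_list n + 3 = r"
    and w: "\<forall>u<10. \<forall>v<10. multiplicity G (\<phi> u) (\<phi> v) = petersen_weight n u v"
    using order_10_classification[OF _ g(3)] by blast
  note p = petersen_graph[OF n(1)]
  have "isomorphic (petersen_graph n) G"
    unfolding isomorphic_iff[OF p(1) mg] using \<phi> w p(2,3) by (intro exI[of _ \<phi>]) simp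
  moreover have "n \<in> compositions (r - 3)" using n by (auto simp: compositions_def)
  ultimately show ?thesis by blast
qed

lemma petersen_graph_isomorphic_iff:
  assumes "length m = 6" "length n = 6"
  shows "isomorphic (petersen_graph n) (petersen_graph m) \<longleftrightarrow> (\<exists>\<phi>. bij_betw \<phi> {..<10} {..<10} \<and>
    (\<forall>u<10. \<forall>v<10. petersen_weight m (\<phi> u) (\<phi> v) = petersen_weight n u v))"
proof -
  note p = petersen_graph[OF assms(1)] and q = petersen_graph[OF assms(2)]
  have "(\<forall>u\<in>{..<10}. \<forall>v\<in>{..<10}. multiplicity (petersen_graph m) (\<phi> u) (\<phi> v) = multiplicity (petersen_graph n) u v)
      \<longleftrightarrow> (\<forall>u<10. \<forall>v<10. petersen_weight m (\<phi> u) (\<phi> v) = petersen_weight n u v)"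
    if "bij_betw \<phi> {..<10} {..<10}" for \<phi>
  proof -
    have "\<phi> u < 10" if "u < 10" for u using \<open>bij_betw \<phi> _ _\<close> that by (auto simp: bij_betw_def)
    then show ?thesis using p(3) q(3) by auto
  qed
  then show ?thesis unfolding isomorphic_iff[OF q(1) p(1)] p(2) q(2) by blast
qed

section \<open>Isomorphism compared with equality of multisets\<close>

lemma petersen_graph_isomorphic_mset:
  assumes "length m = 6" "length n = 6" "isomorphic (petersen_graph n) (petersen_graph m)"
  shows "mset m = mset n"
  using assms petersen_weight_bij_mset[of _ m n] by (auto simp: petersen_graph_isomorphic_iff)

text \<open>A normal form: three positions are moved to 5, 0 and 1, and it does not matter how the
  automorphism permutes the other three, where the entries agree.\<close>

lemma petersen_graph_canonical:
  assumes n: "length n = 6" and ijk: "i < 6" "j < 6" "k < 6" "i \<noteq> j" "i \<noteq> k" "j \<noteq> k"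
    and c: "\<And>l. l < 6 \<Longrightarrow> l \<noteq> i \<Longrightarrow> l \<noteq> j \<Longrightarrow> l \<noteq> k \<Longrightarrow> n ! l = c"
  shows "isomorphic (petersen_graph n) (petersen_graph [n ! j, n ! k, c, c, c, n ! i])"
proof -
  obtain \<alpha> \<sigma> where a: "petersen_automorphism \<alpha> \<sigma>" "\<sigma> i = 5" "\<sigma> j = 0" "\<sigma> k = 1"
    using petersen_automorphism_3_transitive[OF ijk] by blast
  have \<sigma>: "\<sigma> l < 6" "\<sigma> l = \<sigma> l' \<longleftrightarrow> l = l'" if "l < 6" "l' < 6" for l l'
    using a(1) that unfolding petersen_automorphism_def bij_betw_def inj_on_def by blast+
  have "[n ! j, n ! k, c, c, c, n ! i] ! \<sigma> l = n ! l" if l: "l < 6" for l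
  proof (cases "l = i \<or> l = j \<or> l = k")
    case True
    then show ?thesis using a by auto
  next
    case False
    then have "\<sigma> l \<noteq> 5" "\<sigma> l \<noteq> 0" "\<sigma> l \<noteq> 1"
      using \<sigma>(2)[OF l ijk(1)] \<sigma>(2)[OF l ijk(2)] \<sigma>(2)[OF l ijk(3)] a by auto
    then have "\<sigma> l = 2 \<or> \<sigma> l = 3 \<or> \<sigma> l = 4" using \<sigma>(1)[OF l l] by linarith
    then show ?thesis using c[OF l] False by auto
  qed
  then show ?thesis
    using petersen_automorphism_weight[OF a(1)] a(1) n
    by (subst petersen_graph_isomorphic_iff) (auto simp: petersen_automorphism_def)
qed

text \<open>Either 0 or 1 occurs at least three times: four nonzero entries and four entries
  different from 1 would force the sum to be at least 6.\<close>

lemma constant_outside_three: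
  fixes n :: "nat list"
  assumes "length n = 6" "sum_list n \<le> 5"
  obtains c i j k where "i < 6" "j < 6" "k < 6" "i \<noteq> j" "i \<noteq> k" "j \<noteq> k"
    "\<And>l. l < 6 \<Longrightarrow> l \<noteq> i \<Longrightarrow> l \<noteq> j \<Longrightarrow> l \<noteq> k \<Longrightarrow> n ! l = c"
proof -
  define D where "D c = {l\<in>{..<6}. n ! l \<noteq> c}" for c
  have "\<exists>c. card (D c) \<le> 3"
  proof (rule ccontr)
    assume "\<not> ?thesis"
    then have gt: "3 < card (D 0)" "3 < card (D 1)" by (auto simp: not_le)
    \<comment> \<open>With the weights 2 and 1 an entry x contributes at most x + 1, with equality
      for 0, 1 and 2. The total would be at least 12 and at most 11.\<close>
    have "2 * card (D 0) + card (D 1) = (\<Sum>l<6. 2 * of_bool (n ! l \<noteq> 0) + of_bool (n ! l \<noteq> 1))"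
      unfolding D_def by (simp only: card_filter_eq_sum finite_lessThan sum.distrib sum_distrib_left)
    also have "\<dots> \<le> (\<Sum>l<6. n ! l + 1)" by (intro sum_mono) auto
    also have "\<dots> = sum_list n + 6" using assms(1) by (simp only: sum_list_sum_nth atLeast0LessThan sum.distrib) simp
    finally show False using gt assms(2) by simp
  qed
  then obtain c where "card (D c) \<le> 3" by blast
  moreover have "D c \<subseteq> {..<6}" by (auto simp: D_def)
  ultimately obtain T where T: "D c \<subseteq> T" "T \<subseteq> {..<6}" "card T = 3"
    using exists_subset_between[of "D c" 3 "{..<6}"] by auto
  then obtain i j k where "T = {i, j, k}" "i \<noteq> j" "j \<noteq> k" "i \<noteq> k" by (auto simp: card_3_iff)
  then show thesis using that[of i j k c] T by (auto simp: D_def)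
qed

text \<open>The permutation of positions carrying \<open>n\<close> to \<open>m\<close> need not come
  from an automorphism, but it shows that both lists have the same normal form.\<close>

lemma equal_mset_isomorphic:
  assumes n: "length n = 6" "sum_list n \<le> 5" and m: "length m = 6" and eq: "mset m = mset n"
  shows "isomorphic (petersen_graph n) (petersen_graph m)"
proof -
  have "count (mset xs) x = card {l\<in>{..<6}. xs ! l = x}" if "length xs = 6" for xs :: "nat list" and x
    unfolding count_mset count_list_eq_length_filter length_filter_conv_card that
    by (rule arg_cong[of _ _ card]) auto
  then have "card {l\<in>{..<6}. n ! l = x} = card {l\<in>{..<6}. m ! l = x}" for x
    using n(1) m eq by metis
  then obtain \<pi> where \<pi>: "bij_betw \<pi> {..<6} {..<6}" "\<And>l. l \<in> {..<6} \<Longrightarrow> m ! \<pi> l = n ! l"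
    using bij_betw_of_equal_fibres[of "{..<6}" "{..<6}" "(!) n" "(!) m"] by blast
  obtain c i j k where ijk: "i < 6" "j < 6" "k < 6" "i \<noteq> j" "i \<noteq> k" "j \<noteq> k"
    and c: "\<And>l. l < 6 \<Longrightarrow> l \<noteq> i \<Longrightarrow> l \<noteq> j \<Longrightarrow> l \<noteq> k \<Longrightarrow> n ! l = c"
    by (rule constant_outside_three[OF n]) (rule that)
  have \<pi>6: "\<pi> l < 6" "\<pi> l = \<pi> l' \<longleftrightarrow> l = l'" if "l < 6" "l' < 6" for l l'
    using \<pi>(1) that unfolding bij_betw_def inj_on_def by blast+
  have "m ! l = c" if l: "l < 6" "l \<noteq> \<pi> i" "l \<noteq> \<pi> j" "l \<noteq> \<pi> k" for l
  proof -
    obtain l' where "l' < 6" "l = \<pi> l'" using \<pi>(1) l(1) unfolding bij_betw_def by blast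
    then show ?thesis using c[of l'] \<pi>(2)[of l'] l by auto
  qed
  moreover have "\<pi> i < 6" "\<pi> j < 6" "\<pi> k < 6" "\<pi> i \<noteq> \<pi> j" "\<pi> i \<noteq> \<pi> k" "\<pi> j \<noteq> \<pi> k"
    using \<pi>6 ijk by auto
  ultimately have "isomorphic (petersen_graph m) (petersen_graph [m ! \<pi> j, m ! \<pi> k, c, c, c, m ! \<pi> i])"
    using petersen_graph_canonical[OF m] by blast
  then have "isomorphic (petersen_graph [n ! j, n ! k, c, c, c, n ! i]) (petersen_graph m)"
    using isomorphic_sym[OF petersen_graph(1)[OF m]] \<pi>(2) ijk by simp
  then show ?thesis
    using isomorphic_trans[OF petersen_graph_canonical[OF n(1) ijk c]] by blast
qed

text \<open>The two arrangements differ in whether the edge of multiplicity \<open>1\<close> is adjacent to an edge of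
  multiplicity \<open>3\<close>.\<close>

lemma equal_mset_not_isomorphic:
  assumes "2 \<le> t"
  shows "\<not> isomorphic (petersen_graph [0, 2, 1, t, 1, 0]) (petersen_graph [0, 1, 2, t, 1, 0])"
proof
  let ?n = "[0, 2, 1, t, 1, 0]" and ?m = "[0, 1, 2, t, 1, 0]"
  assume "isomorphic (petersen_graph ?n) (petersen_graph ?m)"
  then obtain \<phi> where \<phi>: "bij_betw \<phi> {..<10} {..<10}"
    and w: "\<forall>u<10. \<forall>v<10. petersen_weight ?m (\<phi> u) (\<phi> v) = petersen_weight ?n u v"
    by (subst (asm) petersen_graph_isomorphic_iff) auto
  have \<phi>10: "\<phi> u < 10" if "u < 10" for u using \<phi> that by (auto simp: bij_betw_def)
  \<comment> \<open>The edge 05 is common to the matchings 0 and 5, the edge 01 to the matchings 2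
    and 4.\<close>
  have "petersen_weight ?n 0 5 = 1" "petersen_weight ?n 0 1 = 3"
    unfolding petersen_weight_def sum_less_6
    by (simp_all add: petersen_table petersen_matching_def matching_weight_def)
  then have w': "petersen_weight ?m (\<phi> 0) (\<phi> 5) = 1" "petersen_weight ?m (\<phi> 0) (\<phi> 1) = 3"
    using w by simp_all
  have "\<forall>u<10. \<forall>v<10. petersen_weight ?m u v = 1 \<longrightarrow> u = 0 \<or> u = 5"
    unfolding petersen_weight_def sum_less_6 all_less_10 using assms
    by (simp add: petersen_table petersen_matching_def matching_weight_def)
  moreover have "\<phi> 0 < 10" "\<phi> 5 < 10" using \<phi>10 by simp_all
  ultimately have "\<phi> 0 = 0 \<or> \<phi> 0 = 5" using w'(1) by blast
  \<comment> \<open>The edges at 0 and 5 other than 05 have multiplicity 4 or t + 2.\<close>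
  moreover have "\<forall>x<10. petersen_weight ?m 0 x \<noteq> 3 \<and> petersen_weight ?m 5 x \<noteq> 3"
    unfolding petersen_weight_def sum_less_6 all_less_10 using assms
    by (simp add: petersen_table petersen_matching_def matching_weight_def)
  ultimately show False using w'(2) \<phi>10[of 1] by auto
qed

theorem theorem2p4:
  fixes r :: nat
  assumes "r \<ge> 3"
  shows "(r \<le> 8 \<longrightarrow> num_smallest_class2 r = num_partitions (r - 3) 6) \<and>
         (r \<ge> 9 \<longrightarrow> num_smallest_class2 r > num_partitions (r - 3) 6)"
proof -
  let ?S = "smallest_class2 r" and ?N = "compositions (r - 3)"
  let ?q = "\<lambda>n. iso_rel ?S `` {petersen_graph n}"
  note inS = petersen_graph_smallest[OF assms]
  have len: "length n = 6" if "n \<in> ?N" for n using that by (simp add: compositions_def)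
  have "?S // iso_rel ?S = ?q ` ?N"
  proof
    show "?q ` ?N \<subseteq> ?S // iso_rel ?S" using inS by (auto simp: quotient_def)
    show "?S // iso_rel ?S \<subseteq> ?q ` ?N"
    proof
      fix C assume "C \<in> ?S // iso_rel ?S"
      then obtain G where G: "G \<in> ?S" "C = iso_rel ?S `` {G}" by (auto simp: quotient_def)
      then obtain n where n: "n \<in> ?N" "isomorphic (petersen_graph n) G"
        using smallest_class2_cover[OF assms] by blast
      then have "(petersen_graph n, G) \<in> iso_rel ?S" using inS G(1) by (simp add: iso_rel_def)
      then have "?q n = C" using equiv_class_eq[OF equiv_iso_rel] G(2) by blast
      then show "C \<in> ?q ` ?N" using n(1) by blast
    qed
  qed
  then have num: "num_smallest_class2 r = card (?q ` ?N)" by (simp add: num_smallest_class2_def)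
  have q: "?q n = ?q m \<longleftrightarrow> isomorphic (petersen_graph n) (petersen_graph m)" if "n \<in> ?N" "m \<in> ?N" for n m
    using eq_equiv_class_iff[OF equiv_iso_rel, of "petersen_graph n" r "petersen_graph m"] inS that
    by (simp add: iso_rel_def)
  have q_mset: "mset n = mset m" if "n \<in> ?N" "m \<in> ?N" "?q n = ?q m" for n m
    using q[OF that(1,2)] that(3) petersen_graph_isomorphic_mset[OF len[OF that(2)] len[OF that(1)]] by simp
  have "num_smallest_class2 r = num_partitions (r - 3) 6" if "r \<le> 8"
    unfolding num num_partitions_eq
  proof (rule card_images_eq)
    fix n m assume nm: "n \<in> ?N" "m \<in> ?N"
    have "sum_list n \<le> 5" using nm(1) that by (simp add: compositions_def)
    then show "?q n = ?q m \<longleftrightarrow> mset n = mset m"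
      using q[OF nm] q_mset[OF nm] equal_mset_isomorphic[OF len[OF nm(1)] _ len[OF nm(2)]] by metis
  qed
  moreover have "num_smallest_class2 r > num_partitions (r - 3) 6" if r9: "r \<ge> 9"
    unfolding num num_partitions_eq
  proof (rule card_images_less[OF finite_compositions q_mset])
    \<comment> \<open>The entries then add up to r - 3, and r \<ge> 9 gives t \<ge> 2.\<close>
    define t where "t = r - 7"
    show "[0, 2, 1, t, 1, 0] \<in> ?N" "[0, 1, 2, t, 1, 0] \<in> ?N"
      using r9 by (simp_all add: compositions_def t_def)
    then show "?q [0, 2, 1, t, 1, 0] \<noteq> ?q [0, 1, 2, t, 1, 0]"
      using q equal_mset_not_isomorphic[of t] r9 by (simp add: t_def)
    show "mset [0, 2, 1, t, 1, 0] = mset [0, 1, 2, t, 1, 0]" by simp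
  qed
  ultimately show ?thesis by blast
qed

end
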